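(* Let $\gamma=\{\gamma_\nu;\,\nu\ge1\}$ be a system of integers, with $\gamma_\nu=0$ for all but finitely many $\nu$, such that $\sum_{\nu\ge1}\nu\,\gamma_\nu=0$ and such that the Landau function $\mathcal{L}(t)=\sum_\nu\gamma_\nu\lfloor\nu t\rfloor$ satisfies $\mathcal{L}(t)\ge0$ for all real $t$. Let $u_n=\prod_{\nu\ge1}(\nu n)!^{\gamma_\nu}$ for $n\ge0$, let $N=\mathrm{lcm}\{\nu : \gamma_\nu\ne0\}$, and let $$F_\gamma(x,y)=f^{-1}(f(x)+f(y)),\qquad f(x)=\sum_{n=0}^\infty u_n\frac{x^{Nn+1}}{Nn+1}.$$ The coefficients of the formal group law $F_\gamma$ are $p$-integral for all but finitely many primes $p$ if and only if $$\mathcal{L}\Bigl(\frac{i-1}{N}\Bigr)\ge1\quad\text{ for every integer } 2\le i\le N-1\text{ with }\gcd(i,N)=1.$$ If this condition is satisfied, then $F_\gamma$ is $p$-integral for all primes $p>N$.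
   Context: $p$-integral means that all coefficients lie in $\mathbb{Z}_{(p)}$; $f^{-1}$ is the compositional inverse of $f$. *)

theory Defs
  imports Complex_Main "HOL-Computational_Algebra.Computational_Algebra"
begin

text \<open>
  A system \<open>\<gamma> = {\<gamma>\<^sub>\<nu>; \<nu> \<ge> 1}\<close> is a function \<open>nat \<Rightarrow> int\<close>; the value at \<open>0\<close> carries no
  meaning, so every sum, product and lcm below ranges over \<open>gsupp \<gamma>\<close>, which excludes \<open>0\<close>.
\<close>

definition gsupp :: "(nat \<Rightarrow> int) \<Rightarrow> nat set" where
  "gsupp \<gamma> = {\<nu>. \<nu> \<ge> 1 \<and> \<gamma> \<nu> \<noteq> 0}"

definition landau :: "(nat \<Rightarrow> int) \<Rightarrow> real \<Rightarrow> int" where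
  "landau \<gamma> t = (\<Sum>\<nu>\<in>gsupp \<gamma>. \<gamma> \<nu> * \<lfloor>real \<nu> * t\<rfloor>)"

definition ucoeff :: "(nat \<Rightarrow> int) \<Rightarrow> nat \<Rightarrow> rat" where
  "ucoeff \<gamma> n = (\<Prod>\<nu>\<in>gsupp \<gamma>. fact (\<nu> * n) powi \<gamma> \<nu>)"

text \<open>For \<open>\<gamma> = 0\<close> this is \<open>Lcm {} = 1\<close>.\<close>

definition glcm :: "(nat \<Rightarrow> int) \<Rightarrow> nat" where
  "glcm \<gamma> = Lcm (gsupp \<gamma>)"

definition flog :: "(nat \<Rightarrow> int) \<Rightarrow> rat fps" where
  "flog \<gamma> = Abs_fps (\<lambda>m. if m \<ge> 1 \<and> glcm \<gamma> dvd m - 1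
                         then ucoeff \<gamma> ((m - 1) div glcm \<gamma>) / of_nat m else 0)"

text \<open>
  \<open>R[[x,y]]\<close> is represented as \<open>R[[x]][[y]]\<close>: the coefficient of \<open>x\<^sup>i y\<^sup>j\<close> in \<open>F\<close> is
  \<open>F $ j $ i\<close>.
\<close>

definition fps2_X :: "'a::comm_ring_1 fps fps" where
  "fps2_X = fps_const fps_X"

definition fps2_Y :: "'a::comm_ring_1 fps fps" where
  "fps2_Y = fps_X"

text \<open>
  Substitution \<open>g(h(x,y)) = (\<Sum>k. g\<^sub>k h\<^sup>k)\<close> for \<open>h\<close> with zero constant term \<open>h $ 0 $ 0\<close>. Then
  \<open>h\<^sup>k\<close> has only terms of total degree at least \<open>k\<close>, so only \<open>k \<le> i + j\<close> contribute to the
  coefficient of \<open>x\<^sup>i y\<^sup>j\<close>. The library's composition \<open>fps_compose\<close> does not apply here: it would require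
  \<open>h $ 0 = 0\<close>, which fails for \<open>h = f(x) + f(y)\<close>.
\<close>

definition fps2_subst :: "'a::comm_ring_1 fps \<Rightarrow> 'a fps fps \<Rightarrow> 'a fps fps" where
  "fps2_subst g h = Abs_fps (\<lambda>j. Abs_fps (\<lambda>i. \<Sum>k=0..i + j. g $ k * (h ^ k) $ j $ i))"

definition fgl :: "(nat \<Rightarrow> int) \<Rightarrow> rat fps fps" where
  "fgl \<gamma> = fps2_subst (fps_inv (flog \<gamma>))
             (fps2_subst (flog \<gamma>) fps2_X + fps2_subst (flog \<gamma>) fps2_Y)"

definition Z_localized :: "nat \<Rightarrow> rat set" where
  "Z_localized p = {of_int a / of_int b | a b. \<not> int p dvd b}"

definition p_integral :: "nat \<Rightarrow> rat fps fps \<Rightarrow> bool" where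
  "p_integral p F \<longleftrightarrow> (\<forall>i j. F $ j $ i \<in> Z_localized p)"

lemma fps2_subst_X: "fps2_subst g fps2_X = fps_const g"
proof -
  have "(fps2_subst g fps2_X) $ j $ i = (fps_const g :: 'a fps fps) $ j $ i" for i j
  proof (cases "j = 0")
    case True
    have "(\<Sum>k=0..i. g $ k * (fps_X ^ k) $ i) = (\<Sum>k=0..i. if k = i then g $ k else 0)"
      by (intro sum.cong) (auto simp: fps_X_power_nth)
    then show ?thesis using True
      by (simp add: fps2_subst_def fps2_X_def)
  qed (simp add: fps2_subst_def fps2_X_def)
  then show ?thesis by (simp add: fps_eq_iff)
qed

lemma fps2_subst_Y: "fps2_subst g fps2_Y = Abs_fps (\<lambda>j. fps_const (g $ j))"
proof -
  have "(fps2_subst g fps2_Y) $ j $ i = fps_const (g $ j) $ i" for i j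
  proof -
    have "(\<Sum>k=0..i + j. g $ k * (fps_X ^ k) $ j $ i) =
        (\<Sum>k=0..i + j. if k = j then g $ k * (if i = 0 then 1 else 0) else 0)"
      by (intro sum.cong) (auto simp: fps_X_power_nth)
    then show ?thesis by (simp add: fps2_subst_def fps2_Y_def)
  qed
  then show ?thesis by (simp add: fps_eq_iff)
qed

lemma glcm_pos: "finite (gsupp \<gamma>) \<Longrightarrow> glcm \<gamma> > 0"
  unfolding glcm_def gsupp_def by (rule Nat.gr0I) (auto simp: Lcm_0_iff)

lemma flog_nth:
  assumes "finite (gsupp \<gamma>)"
  shows "flog \<gamma> $ (glcm \<gamma> * n + 1) = ucoeff \<gamma> n / of_nat (glcm \<gamma> * n + 1)"
  using glcm_pos[OF assms] by (simp add: flog_def)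

lemma flog_0: "flog \<gamma> $ 0 = 0"
  by (simp add: flog_def)

lemma flog_1: "flog \<gamma> $ 1 = 1"
  by (simp add: flog_def ucoeff_def)

end

theory Submission
  imports Defs "HOL-Number_Theory.Number_Theory"
begin

text \<open>
  Sufficiency. Let \<open>p > N\<close>, let \<open>r\<close> be the order of \<open>p\<close> modulo \<open>N\<close> and \<open>q = p^r\<close>. Stripping all
  multiples of \<open>p\<close> from the factorials in \<open>u_n\<close>, with \<open>N n + 1 = q (N n' + 1)\<close>, gives
  \<open>u_n = p^e \<lambda>(n) u_n'\<close>, where \<open>\<lambda>(n)\<close> is a \<open>p\<close>-adic unit depending \<open>p\<close>-adically continuously on
  \<open>n\<close> and \<open>e = \<Sum>j=1..r. L(n / p^j)\<close>. As \<open>L(n / p^j) = L((i_j - 1) / N)\<close> with \<open>i_j p^j \<equiv> 1 (mod N)\<close>,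
  the condition on \<open>L\<close> implies that \<open>e \<ge> r - 1\<close>. So up to any given degree \<open>f(x) - c f(x^q)\<close> is
  \<open>p\<close>-integral for some rational \<open>c\<close> with \<open>p c\<close> \<open>p\<close>-integral, and Hazewinkel's functional equation
  lemma shows that \<open>F\<close> is \<open>p\<close>-integral up to that degree.

  Necessity. Given \<open>i\<close>, Dirichlet's theorem yields a prime \<open>p > N\<close> with \<open>p i \<equiv> 1 (mod N)\<close> for
  which \<open>F\<close> is \<open>p\<close>-integral. The coefficient \<open>f_p\<close> vanishes because \<open>p\<close> is not \<open>1\<close> modulo \<open>N\<close>;
  comparing the coefficients of degree \<open>n\<close> in \<open>f(F) = f(x) + f(y)\<close> gives
  \<open>f_n ((x + y)^n - x^n - y^n)\<close> \<open>p\<close>-integral, hence \<open>f_n\<close> \<open>p\<close>-integral for all \<open>n < p^2\<close> by induction.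
  For \<open>n = p i\<close> this means that \<open>p\<close> divides \<open>u_((p i - 1) / N)\<close>, whose \<open>p\<close>-adic valuation is
  \<open>L((i - 1) / N)\<close>.

  Dirichlet's theorem is proved by Shapiro's method: with
  \<open>T(\<chi>) = \<Sum>n\<le>x. \<chi>(n) \<Lambda>(n) / n\<close> one has \<open>T(\<chi>) = O(1)\<close> if \<open>L(1,\<chi>) \<noteq> 0\<close> and
  \<open>T(\<chi>) = - ln x + O(1)\<close> otherwise, for nonprincipal \<open>\<chi>\<close>, while \<open>T(\<chi>) = ln x + O(1)\<close> for the principal
  one. As \<open>\<Sum>\<chi>. T(\<chi>) \<ge> 0\<close>, at most one \<open>\<chi>\<close> has \<open>L(1,\<chi>) = 0\<close>, so
  that \<open>\<chi>\<close> would be real, and this case is excluded by Monsky's argument with Lambert series.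
\<close>

section \<open>Dirichlet characters\<close>

definition dir_char :: "nat \<Rightarrow> (nat \<Rightarrow> complex) \<Rightarrow> bool" where
  "dir_char m \<chi> \<longleftrightarrow> \<chi> 1 = 1 \<and> (\<forall>a b. \<chi> (a * b) = \<chi> a * \<chi> b) \<and>
     (\<forall>a b. [a = b] (mod m) \<longrightarrow> \<chi> a = \<chi> b) \<and> (\<forall>a. \<not> coprime a m \<longrightarrow> \<chi> a = 0)"

text \<open>Characters of the subgroup of \<open>(\<int>/m)\<^sup>*\<close> whose residue classes make up \<open>H\<close>.\<close>

definition partial_char :: "nat \<Rightarrow> nat set \<Rightarrow> (nat \<Rightarrow> complex) \<Rightarrow> bool" where
  "partial_char m H \<psi> \<longleftrightarrow> 1 \<in> H \<and> \<psi> 1 = 1 \<and> (\<forall>a\<in>H. coprime a m) \<and>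
     (\<forall>a\<in>H. \<forall>b\<in>H. a * b \<in> H \<and> \<psi> (a * b) = \<psi> a * \<psi> b) \<and>
     (\<forall>a\<in>H. \<forall>b. [a = b] (mod m) \<longrightarrow> b \<in> H \<and> \<psi> b = \<psi> a)"

lemma partial_char_one: "partial_char m H \<psi> \<Longrightarrow> 1 \<in> H" "partial_char m H \<psi> \<Longrightarrow> \<psi> 1 = 1"
  unfolding partial_char_def by blast+

lemma partial_char_coprime: "partial_char m H \<psi> \<Longrightarrow> a \<in> H \<Longrightarrow> coprime a m"
  unfolding partial_char_def by blast

lemma partial_char_mult:
  assumes "partial_char m H \<psi>" "a \<in> H" "b \<in> H"
  shows "a * b \<in> H" "\<psi> (a * b) = \<psi> a * \<psi> b"
  using assms unfolding partial_char_def by blast+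

lemma partial_char_cong:
  assumes "partial_char m H \<psi>" "a \<in> H" "[a = b] (mod m)"
  shows "b \<in> H" "\<psi> b = \<psi> a"
  using assms unfolding partial_char_def by blast+

lemma partial_char_power:
  assumes "partial_char m H \<psi>" "a \<in> H"
  shows "a ^ k \<in> H \<and> \<psi> (a ^ k) = \<psi> a ^ k"
proof (induction k)
  case 0
  then show ?case using partial_char_one[OF assms(1)] by simp
next
  case (Suc k)
  then show ?case using partial_char_mult[OF assms(1,2), of "a ^ k"] by simp
qed

lemma power_totient_inverse:
  fixes a m :: nat
  assumes "m > 0" "coprime a m"
  shows "[a * a ^ (totient m - 1) = 1] (mod m)"
proof -
  have "totient m > 0" using assms by simp
  then have "a * a ^ (totient m - 1) = a ^ totient m" by (metis power_eq_if neq0_conv)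
  then show ?thesis using euler_theorem[OF assms(2)] by simp
qed

text \<open>A power of \<open>y\<close> inverts \<open>y\<close> modulo \<open>m\<close> and stays
  in \<open>H\<close>, so multiplying \<open>x * y\<close> by it recovers \<open>x\<close> up to
  congruence.\<close>

lemma partial_char_cancel:
  assumes P: "partial_char m H \<psi>" and m: "m > 0" and y: "y \<in> H" and xy: "x * y \<in> H"
  shows "x \<in> H"
proof -
  have "[x * (y * y ^ (totient m - 1)) = x * 1] (mod m)"
    using power_totient_inverse[OF m partial_char_coprime[OF P y]] by (rule cong_scalar_left)
  moreover have "x * y * y ^ (totient m - 1) \<in> H"
    using partial_char_mult(1)[OF P xy] partial_char_power[OF P y] by blast
  ultimately show ?thesis using partial_char_cong(1)[OF P] by (simp add: mult.assoc)
qed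

lemma partial_char_power_dvd:
  assumes P: "partial_char m H \<psi>" and m: "m > 0" and k: "k > 0" "a ^ k \<in> H"
    and min: "\<forall>j>0. a ^ j \<in> H \<longrightarrow> k \<le> j" and d: "a ^ d \<in> H" and z: "z ^ k = \<psi> (a ^ k)"
  shows "\<psi> (a ^ d) = z ^ d"
proof -
  have "a ^ d = a ^ (d mod k) * (a ^ k) ^ (d div k)"
    by (simp flip: power_mult power_add)
  then have "a ^ (d mod k) \<in> H"
    using partial_char_cancel[OF P m _ d[unfolded \<open>a ^ d = _\<close>]] partial_char_power[OF P k(2)] by blast
  then have "d mod k = 0" using min k(1) by (meson mod_less_divisor not_le neq0_conv)
  then have d: "d = k * (d div k)" by auto
  have "\<psi> (a ^ d) = \<psi> ((a ^ k) ^ (d div k))" using d by (metis power_mult)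
  also have "\<dots> = (z ^ k) ^ (d div k)" using partial_char_power[OF P k(2)] z by simp
  also have "\<dots> = z ^ d" using d by (metis power_mult)
  finally show ?thesis .
qed

text \<open>Cancelling the smaller power of \<open>a\<close> leaves a power
  \<open>a ^ (j - i)\<close> that lies in \<open>H\<close>; there \<psi> already agrees with the
  powers of \<open>z\<close>.\<close>

lemma partial_char_extend_welldef:
  assumes P: "partial_char m H \<psi>" and m: "m > 0" and a: "coprime a m" and k: "k > 0" "a ^ k \<in> H"
    and min: "\<forall>j>0. a ^ j \<in> H \<longrightarrow> k \<le> j" and z: "z ^ k = \<psi> (a ^ k)"
    and h: "h \<in> H" "h' \<in> H" and c: "[a ^ i * h = a ^ j * h'] (mod m)"
  shows "z ^ i * \<psi> h = z ^ j * \<psi> h'"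
proof -
  have main: "z ^ i * \<psi> h = z ^ j * \<psi> h'"
    if ij: "i \<le> j" and h: "h \<in> H" "h' \<in> H" and c: "[a ^ i * h = a ^ j * h'] (mod m)" for i j h h'
  proof -
    have "[a ^ i * h = a ^ i * (a ^ (j - i) * h')] (mod m)"
      using c ij by (simp flip: mult.assoc power_add)
    then have c': "[h = a ^ (j - i) * h'] (mod m)"
      using a by (subst (asm) cong_mult_lcancel_nat) auto
    have H: "a ^ (j - i) * h' \<in> H" "\<psi> (a ^ (j - i) * h') = \<psi> h"
      using partial_char_cong[OF P h(1) c'] .
    then have A: "a ^ (j - i) \<in> H" using partial_char_cancel[OF P m h(2)] by blast
    have "\<psi> (a ^ (j - i)) = z ^ (j - i)"
      by (rule partial_char_power_dvd[OF P m k min A z])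
    then have "\<psi> h = z ^ (j - i) * \<psi> h'"
      using H(2) partial_char_mult(2)[OF P A h(2)] by simp
    then show ?thesis using ij by (simp flip: mult.assoc power_add)
  qed
  consider "i \<le> j" | "j \<le> i" by linarith
  then show ?thesis
  proof cases
    case 1
    then show ?thesis using main[OF _ h c] by blast
  next
    case 2
    then show ?thesis using main[OF _ h(2,1) cong_sym[OF c]] by simp
  qed
qed

text \<open>A character of \<open>H\<close> extends to \<open>\<langle>H, a\<rangle>\<close> by sending \<open>a\<close> to any \<open>k\<close>-th root of \<open>\<psi>(a^k)\<close>,
  where \<open>a^k\<close> is the first power of \<open>a\<close> in \<open>H\<close>.\<close>

lemma partial_char_extend:
  assumes P: "partial_char m H \<psi>" and m: "m > 0" and a: "coprime a m" and k: "k > 0" "a ^ k \<in> H"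
    and min: "\<forall>j>0. a ^ j \<in> H \<longrightarrow> k \<le> j" and z: "z ^ k = \<psi> (a ^ k)"
  shows "\<exists>H' \<psi>'. partial_char m H' \<psi>' \<and> H \<subseteq> H' \<and> a \<in> H' \<and> \<psi>' a = z \<and> (\<forall>h\<in>H. \<psi>' h = \<psi> h)"
proof -
  define H' where "H' = {n. \<exists>j. \<exists>h\<in>H. [a ^ j * h = n] (mod m)}"
  \<comment> \<open>Choice selects one representation of \<open>n\<close>; \<open>val\<close> then
    shows that every representation gives the same value.\<close>
  define \<psi>' where "\<psi>' n = (SOME v. \<exists>j. \<exists>h\<in>H. [a ^ j * h = n] (mod m) \<and> v = z ^ j * \<psi> h)" for n
  have val: "\<psi>' n = z ^ j * \<psi> h" if "h \<in> H" "[a ^ j * h = n] (mod m)" for n j h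
  proof -
    have "\<exists>v j. \<exists>h\<in>H. [a ^ j * h = n] (mod m) \<and> v = z ^ j * \<psi> h" using that by blast
    then have "\<exists>j. \<exists>h\<in>H. [a ^ j * h = n] (mod m) \<and> \<psi>' n = z ^ j * \<psi> h"
      unfolding \<psi>'_def by (rule someI_ex)
    then obtain j' h' where *: "h' \<in> H" "[a ^ j' * h' = n] (mod m)" "\<psi>' n = z ^ j' * \<psi> h'" by blast
    have "[a ^ j' * h' = a ^ j * h] (mod m)" using *(2) that(2) by (metis cong_sym cong_trans)
    from partial_char_extend_welldef[OF P m a k min z *(1) that(1) this]
    show ?thesis using *(3) by simp
  qed
  have sub: "h \<in> H' \<and> \<psi>' h = \<psi> h" if "h \<in> H" for h
    using that val[OF that, of 0 h] by (auto simp: H'_def intro!: exI[of _ 0] bexI[of _ h])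
  have ah: "a \<in> H' \<and> \<psi>' a = z"
    using val[OF partial_char_one(1)[OF P], of 1 a] partial_char_one[OF P]
    by (auto simp: H'_def intro!: exI[of _ 1] bexI[of _ 1])
  have "partial_char m H' \<psi>'"
    unfolding partial_char_def
  proof (intro conjI ballI allI impI)
    show "1 \<in> H'" "\<psi>' 1 = 1" using sub[OF partial_char_one(1)[OF P]] partial_char_one(2)[OF P] by auto
    fix x assume "x \<in> H'"
    then obtain i h where x: "h \<in> H" "[a ^ i * h = x] (mod m)" by (auto simp: H'_def)
    have "coprime (a ^ i * h) m" using a partial_char_coprime[OF P x(1)] by simp
    then show "coprime x m" using x(2) by (meson cong_imp_coprime)
    { fix y assume "y \<in> H'"
      then obtain j h' where y: "h' \<in> H" "[a ^ j * h' = y] (mod m)" by (auto simp: H'_def)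
      have hh: "h * h' \<in> H" "\<psi> (h * h') = \<psi> h * \<psi> h'" using partial_char_mult[OF P x(1) y(1)] .
      have c: "[a ^ (i + j) * (h * h') = x * y] (mod m)"
        using cong_mult[OF x(2) y(2)] by (simp add: power_add ac_simps)
      show "x * y \<in> H'" using c hh(1) by (auto simp: H'_def)
      show "\<psi>' (x * y) = \<psi>' x * \<psi>' y"
        using val[OF hh(1) c] val[OF x] val[OF y] hh(2) by (simp add: power_add)
    }
    { fix y assume c: "[x = y] (mod m)"
      have c: "[a ^ i * h = y] (mod m)" using cong_trans[OF x(2) c] .
      then show "y \<in> H'" using x(1) by (auto simp: H'_def)
      show "\<psi>' y = \<psi>' x" using val[OF x(1) c] val[OF x] by simp
    }
  qed
  then show ?thesis using sub ah by blast
qed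

lemma partial_char_least_power:
  assumes P: "partial_char m H \<psi>" and m: "m > 0" and a: "coprime a m"
  obtains k where "k > 0" "a ^ k \<in> H" "\<forall>j>0. a ^ j \<in> H \<longrightarrow> k \<le> j"
proof -
  let ?Q = "\<lambda>k. k > 0 \<and> a ^ k \<in> H"
  have "?Q (totient m)"
    using m partial_char_cong(1)[OF P partial_char_one(1)[OF P] cong_sym[OF euler_theorem[OF a]]]
    by (simp only: totient_gt_0_iff simp_thms)
  then have "?Q (LEAST k. ?Q k)" by (rule LeastI)
  moreover have "(LEAST k. ?Q k) \<le> j" if "?Q j" for j using that by (rule Least_le)
  ultimately show ?thesis using that[of "LEAST k. ?Q k"] by blast
qed

lemma complex_root_exists: "k > 0 \<Longrightarrow> \<exists>z::complex. z ^ k = c"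
proof -
  assume "k > 0"
  have "c = rcis (cmod c) (Arg c)" by (simp add: rcis_cmod_Arg)
  moreover have "rcis (root k (cmod c)) (Arg c / k) ^ k = rcis (cmod c) (Arg c)"
    using \<open>k > 0\<close> by (simp add: DeMoivre2)
  ultimately show ?thesis by metis
qed

text \<open>Induction on the number of reduced residues missing from \<open>H\<close>. Adjoining a
  residue outside \<open>H\<close> lowers it; once none is missing, the character is extended by
  zero to the numbers not coprime to \<open>m\<close>.\<close>

lemma partial_char_extend_dir_char:
  assumes "partial_char m H \<psi>" and m: "m > 0"
  shows "\<exists>\<chi>. dir_char m \<chi> \<and> (\<forall>h\<in>H. \<chi> h = \<psi> h)"
  using assms(1)
proof (induction "card ({a. a < m \<and> coprime a m} - H)" arbitrary: H \<psi> rule: less_induct)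
  case (less H \<psi>)
  note P = less.prems
  show ?case
  proof (cases "\<exists>a. coprime a m \<and> a \<notin> H")
    case False
    define \<chi> where "\<chi> n = (if n \<in> H then \<psi> n else 0)" for n
    have H: "n \<in> H \<longleftrightarrow> coprime n m" for n using False partial_char_coprime[OF P] by blast
    have "dir_char m \<chi>" unfolding dir_char_def
    proof (intro conjI allI impI)
      show "\<chi> 1 = 1" using partial_char_one[OF P] by (simp add: \<chi>_def)
      show "\<chi> (a * b) = \<chi> a * \<chi> b" for a b
        using partial_char_mult[OF P, of a b] by (auto simp: \<chi>_def H)
      show "\<chi> a = \<chi> b" if "[a = b] (mod m)" for a b
        using partial_char_cong[OF P _ that] partial_char_cong[OF P _ cong_sym[OF that]] by (auto simp: \<chi>_def)
      show "\<chi> a = 0" if "\<not> coprime a m" for a using that H by (simp add: \<chi>_def)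
    qed
    then show ?thesis by (auto simp: \<chi>_def)
  next
    case True
    then obtain a where a: "coprime a m" "a \<notin> H" by blast
    obtain k where k: "k > 0" "a ^ k \<in> H" "\<forall>j>0. a ^ j \<in> H \<longrightarrow> k \<le> j"
      using partial_char_least_power[OF P m a(1)] by metis
    obtain z where z: "z ^ k = \<psi> (a ^ k)" using complex_root_exists[OF k(1)] by metis
    obtain H' \<psi>' where H': "partial_char m H' \<psi>'" "H \<subseteq> H'" "a \<in> H'" "\<forall>h\<in>H. \<psi>' h = \<psi> h"
      using partial_char_extend[OF P m a(1) k z] by metis
    have "a mod m \<in> H'" using partial_char_cong(1)[OF H'(1,3), of "a mod m"] by (simp add: cong_def)
    moreover have "a mod m \<notin> H" using partial_char_cong(1)[OF P, of "a mod m" a] a(2) by (auto simp: cong_def)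
    moreover have "coprime (a mod m) m" "a mod m < m" using a(1) m by simp_all
    ultimately have "{a. a < m \<and> coprime a m} - H' \<subset> {a. a < m \<and> coprime a m} - H"
      using H'(2) by blast
    then have "card ({a. a < m \<and> coprime a m} - H') < card ({a. a < m \<and> coprime a m} - H)"
      by (intro psubset_card_mono) auto
    from less.hyps[OF this H'(1)] show ?thesis using H'(2,4) by fastforce
  qed
qed

text \<open>The trivial character of the residue class of 1 is extended to \<open>c\<close> with a
  primitive \<open>k\<close>-th root of unity as value, where \<open>k\<close> is the order of
  \<open>c\<close>; it exceeds 1 as \<open>c\<close> is not congruent to 1.\<close>

lemma dir_char_separates:
  assumes m: "m > 0" and c: "coprime c m" "\<not> [c = 1] (mod m)"
  shows "\<exists>\<chi>. dir_char m \<chi> \<and> \<chi> c \<noteq> 1"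
proof -
  define H where "H = {n. [n = 1] (mod m)}"
  have P: "partial_char m H (\<lambda>_. 1)" unfolding partial_char_def H_def
    by (auto intro: cong_imp_coprime dest: cong_sym cong_mult intro: cong_trans)
  obtain k where k: "k > 0" "c ^ k \<in> H" "\<forall>j>0. c ^ j \<in> H \<longrightarrow> k \<le> j"
    using partial_char_least_power[OF P m c(1)] by metis
  have "k \<noteq> 1" using k(2) c(2) by (auto simp: H_def)
  then have k2: "k \<ge> 2" using k(1) by simp
  define z where "z = cis (2 * pi / k)"
  have z: "z ^ k = 1" using k(1) by (simp add: z_def DeMoivre)
  have z1: "z \<noteq> 1"
  proof
    assume "z = 1"
    then have "cos (2 * pi / k) = 1" by (simp add: z_def complex_eq_iff)
    then obtain n :: int where "2 * pi / k = n * 2 * pi" by (auto simp: cos_one_2pi_int)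
    then have "(2 * pi) * (1 / real k) = (2 * pi) * of_int n" by (simp add: mult_ac)
    then have "1 / real k = of_int n" by (subst (asm) mult_left_cancel) auto
    moreover have "0 < 1 / real k" "1 / real k < 1" using k2 by (auto simp: field_simps)
    ultimately have "0 < real_of_int n" "real_of_int n < 1" by simp_all
    then show False by simp
  qed
  obtain H' \<psi>' where H': "partial_char m H' \<psi>'" "c \<in> H'" "\<psi>' c = z"
    using partial_char_extend[OF P m c(1) k, of z] z by metis
  then show ?thesis using partial_char_extend_dir_char[OF H'(1) m] z1 by metis
qed


section \<open>Values, finiteness and orthogonality of Dirichlet characters\<close>

lemma dir_char_1: "dir_char m \<chi> \<Longrightarrow> \<chi> 1 = 1"
  and dir_char_mult: "dir_char m \<chi> \<Longrightarrow> \<chi> (a * b) = \<chi> a * \<chi> b"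
  and dir_char_cong: "dir_char m \<chi> \<Longrightarrow> [a = b] (mod m) \<Longrightarrow> \<chi> a = \<chi> b"
  and dir_char_eq_0: "dir_char m \<chi> \<Longrightarrow> \<not> coprime a m \<Longrightarrow> \<chi> a = 0"
  unfolding dir_char_def by blast+

lemma dir_char_power: "dir_char m \<chi> \<Longrightarrow> \<chi> (a ^ k) = \<chi> a ^ k"
proof (induction k)
  case 0
  then show ?case using dir_char_1 by simp
next
  case (Suc k)
  then show ?case using dir_char_mult[of m \<chi> a "a ^ k"] by simp
qed

lemma dir_char_root_of_unity:
  assumes "dir_char m \<chi>" "coprime a m"
  shows "\<chi> a ^ totient m = 1"
  using dir_char_power[OF assms(1), of a "totient m"] dir_char_cong[OF assms(1) euler_theorem[OF assms(2)]]
    dir_char_1[OF assms(1)] by simp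

lemma norm_dir_char:
  assumes "dir_char m \<chi>" "m > 0"
  shows "norm (\<chi> a) = (if coprime a m then 1 else 0)"
proof (cases "coprime a m")
  case True
  have "norm (\<chi> a) ^ totient m = 1 ^ totient m"
    using dir_char_root_of_unity[OF assms(1) True] by (metis norm_one norm_power power_one)
  then have "norm (\<chi> a) = 1" using assms(2) by (subst (asm) power_eq_iff_eq_base) auto
  then show ?thesis using True by simp
qed (simp add: dir_char_eq_0[OF assms(1)])

lemma norm_dir_char_le: "dir_char m \<chi> \<Longrightarrow> m > 0 \<Longrightarrow> norm (\<chi> a) \<le> 1"
  by (simp add: norm_dir_char)

definition principal_char :: "nat \<Rightarrow> nat \<Rightarrow> complex" where
  "principal_char m n = (if coprime n m then 1 else 0)"

lemma dir_char_principal_char: "dir_char m (principal_char m)"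
  unfolding dir_char_def principal_char_def by (auto dest: cong_imp_coprime cong_sym)

lemma dir_char_times:
  "dir_char m \<chi> \<Longrightarrow> dir_char m \<psi> \<Longrightarrow> dir_char m (\<lambda>n. \<chi> n * \<psi> n)"
  unfolding dir_char_def by (metis mult_1 mult_zero_left mult.left_commute mult.assoc)

lemma dir_char_cnj: "dir_char m \<chi> \<Longrightarrow> dir_char m (\<lambda>n. cnj (\<chi> n))"
  unfolding dir_char_def by (metis complex_cnj_one complex_cnj_mult complex_cnj_zero)

lemma dir_char_cnj_mult_self:
  assumes "dir_char m \<chi>" "dir_char m \<psi>" "m > 0"
  shows "cnj (\<chi> n) * (\<chi> n * \<psi> n) = \<psi> n"
proof (cases "coprime n m")
  case True
  have "cnj (\<chi> n) * \<chi> n = 1"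
    using norm_dir_char[OF assms(1,3), of n] True complex_norm_square[of "\<chi> n"]
    by (simp add: mult.commute)
  then show ?thesis by (metis mult.assoc mult_1)
qed (simp add: dir_char_eq_0[OF assms(2)])

text \<open>A character is determined by its values on \<open>{..<m}\<close>, and each value is 0 or
  a root of unity of order dividing \<open>totient m\<close>.\<close>

lemma finite_dir_chars:
  assumes "m > 0"
  shows "finite {\<chi>. dir_char m \<chi>}"
proof -
  let ?R = "insert 0 {z::complex. z ^ totient m = 1}"
  have "card {z::complex. z ^ totient m = 1} > 0" using assms by (simp add: card_roots_unity_eq)
  then have "finite ?R" using card_ge_0_finite by blast
  then have fin: "finite (PiE {..<m} (\<lambda>_. ?R))" by (simp add: finite_PiE)
  have "{\<chi>. dir_char m \<chi>} \<subseteq> (\<lambda>g n. g (n mod m)) ` PiE {..<m} (\<lambda>_. ?R)"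
  proof
    fix \<chi> assume "\<chi> \<in> {\<chi>. dir_char m \<chi>}"
    then have D: "dir_char m \<chi>" by simp
    have "\<chi> n = restrict \<chi> {..<m} (n mod m)" for n
      using assms dir_char_cong[OF D, of n "n mod m"] by (simp add: cong_def)
    moreover have "restrict \<chi> {..<m} \<in> PiE {..<m} (\<lambda>_. ?R)"
      using dir_char_root_of_unity[OF D] dir_char_eq_0[OF D] by auto
    ultimately show "\<chi> \<in> (\<lambda>g n. g (n mod m)) ` PiE {..<m} (\<lambda>_. ?R)" by blast
  qed
  then show ?thesis using fin finite_surj by blast
qed

text \<open>Multiplication by a character \<open>\<chi>1\<close> with
  \<open>\<chi>1 c \<noteq> 1\<close> permutes the characters, so the sum is unchanged by the factor
  \<open>\<chi>1 c\<close>.\<close>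

lemma sum_dir_chars:
  assumes m: "m > 0" and c: "coprime c m" "\<not> [c = 1] (mod m)"
  shows "(\<Sum>\<chi> | dir_char m \<chi>. \<chi> c) = 0"
proof -
  obtain \<chi>1 where \<chi>1: "dir_char m \<chi>1" "\<chi>1 c \<noteq> 1" using dir_char_separates[OF assms] by metis
  let ?S = "\<Sum>\<chi> | dir_char m \<chi>. \<chi> c"
  have "(\<Sum>\<chi> | dir_char m \<chi>. \<chi>1 c * \<chi> c) = ?S"
    by (rule sum.reindex_bij_witness[where i="\<lambda>\<chi> n. cnj (\<chi>1 n) * \<chi> n" and j="\<lambda>\<chi> n. \<chi>1 n * \<chi> n"])
       (use dir_char_cnj_mult_self[OF \<chi>1(1) _ m] dir_char_cnj_mult_self[OF dir_char_cnj[OF \<chi>1(1)] _ m]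
          dir_char_times \<chi>1(1) dir_char_cnj in \<open>auto intro!: ext\<close>)
  then have "\<chi>1 c * ?S = ?S" by (simp add: sum_distrib_left)
  then show ?thesis using \<chi>1(2) by simp
qed

text \<open>The dual argument: multiplication by \<open>b\<close> permutes the residues and
  multiplies the sum by \<open>\<chi> b\<close>.\<close>

lemma sum_dir_char_period:
  assumes D: "dir_char m \<chi>" and m: "m > 0" and b: "coprime b m" "\<chi> b \<noteq> 1"
  shows "(\<Sum>n<m. \<chi> n) = 0"
proof -
  define b' where "b' = b ^ (totient m - 1)"
  have bb: "[b * b' = 1] (mod m)" using power_totient_inverse[OF m b(1)] by (simp add: b'_def)
  have inv: "a * b mod m * b' mod m = a" "a * b' mod m * b mod m = a" if "a < m" for a
  proof -
    have "[a * (b * b') = a * 1] (mod m)" using bb by (rule cong_scalar_left)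
    then have "a * b * b' mod m = a" "a * b' * b mod m = a"
      using that by (simp_all add: cong_def mult_ac)
    then show "a * b mod m * b' mod m = a" "a * b' mod m * b mod m = a"
      by (simp_all add: mod_mult_left_eq)
  qed
  have "(\<Sum>n<m. \<chi> n * \<chi> b) = (\<Sum>n<m. \<chi> n)"
    by (rule sum.reindex_bij_witness[where i="\<lambda>n. n * b' mod m" and j="\<lambda>n. n * b mod m"])
       (use m inv dir_char_cong[OF D, of "_ * b mod m" "_ * b"] dir_char_mult[OF D] in \<open>auto\<close>)
  then have "(\<Sum>n<m. \<chi> n) * \<chi> b = (\<Sum>n<m. \<chi> n)" by (simp add: sum_distrib_right)
  then show ?thesis using b(2) by simp
qed

lemma sum_lessThan_add:
  fixes f :: "nat \<Rightarrow> 'a::comm_monoid_add"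
  shows "(\<Sum>n<m + k. f n) = (\<Sum>n<m. f n) + (\<Sum>n<k. f (m + n))"
  by (induction k) (simp_all add: add.assoc)

text \<open>Complete periods cancel, and what remains is a sum of at most \<open>m\<close> terms of
  norm at most 1.\<close>

lemma norm_sum_dir_char_le:
  assumes D: "dir_char m \<chi>" and m: "m > 0" and b: "coprime b m" "\<chi> b \<noteq> 1"
  shows "norm (\<Sum>n=1..x. \<chi> n) \<le> m"
proof -
  have "norm (\<Sum>n<x. \<chi> n) \<le> m" for x
  proof (induction x rule: less_induct)
    case (less x)
    show ?case
    proof (cases "x \<le> m")
      case True
      have "norm (\<Sum>n<x. \<chi> n) \<le> (\<Sum>n<x. 1)"
        by (intro sum_norm_le norm_dir_char_le[OF D m])
      then show ?thesis using True by simp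
    next
      case False
      have "(\<Sum>n<m + (x - m). \<chi> n) = (\<Sum>n<m. \<chi> n) + (\<Sum>n<x-m. \<chi> (m + n))"
        by (rule sum_lessThan_add)
      also have "(\<Sum>n<x-m. \<chi> (m + n)) = (\<Sum>n<x-m. \<chi> n)"
        by (intro sum.cong refl dir_char_cong[OF D]) (simp add: cong_def)
      finally have "(\<Sum>n<x. \<chi> n) = (\<Sum>n<x-m. \<chi> n)"
        using sum_dir_char_period[OF assms] False by simp
      then show ?thesis using less.IH[of "x - m"] False m by simp
    qed
  qed
  \<comment> \<open>Starting at 0 instead of 1 is harmless: \<open>m \<noteq> 1\<close>, so 0 is not
    coprime to \<open>m\<close> and \<open>\<chi> 0 = 0\<close>.\<close>
  moreover have "(\<Sum>n=1..x. \<chi> n) = (\<Sum>n<Suc x. \<chi> n)"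
  proof -
    have "m \<noteq> 1"
    proof
      assume "m = 1"
      then show False using dir_char_cong[OF D, of b 1] dir_char_1[OF D] b(2) by (simp add: cong_def)
    qed
    then have "\<chi> 0 = 0" using dir_char_eq_0[OF D] by simp
    then show ?thesis by (simp add: lessThan_Suc_atMost atMost_atLeast0 sum.atLeast_Suc_atMost)
  qed
  ultimately show ?thesis by metis
qed

section \<open>Sums of characters and of the von Mangoldt function\<close>

text \<open>Both sides run over the pairs \<open>(d, k)\<close> of positive numbers with
  \<open>d * k \<le> x\<close>.\<close>

lemma sum_divisors_swap:
  fixes f :: "nat \<Rightarrow> nat \<Rightarrow> 'a::comm_monoid_add"
  shows "(\<Sum>n=1..x. \<Sum>d | d dvd n. f d (n div d)) = (\<Sum>d=1..x. \<Sum>k=1..x div d. f d k)"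
proof -
  have "(\<Sum>n=1..x. \<Sum>d | d dvd n. f d (n div d)) =
      (\<Sum>(n, d)\<in>(SIGMA n:{1..x}. {d. d dvd n}). f d (n div d))"
    by (rule sum.Sigma) (auto intro: finite_divisors_nat)
  also have "\<dots> = (\<Sum>(d, k)\<in>(SIGMA d:{1..x}. {1..x div d}). f d k)"
  proof (rule sum.reindex_bij_witness[where i="\<lambda>(d, k). (d * k, d)" and j="\<lambda>(n, d). (d, n div d)"])
    fix y assume "y \<in> (SIGMA n:{1..x}. {d. d dvd n})"
    then obtain n d where y: "y = (n, d)" "n \<ge> 1" "n \<le> x" "d dvd n" by auto
    then have "d > 0" "n div d \<ge> 1" "n div d \<le> x div d" "d \<le> x"
      by (auto simp: div_le_mono dvd_pos_nat div_greater_zero_iff Suc_le_eq dest!: dvd_imp_le intro: Nat.gr0I)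
    then show "(case y of (n, d) \<Rightarrow> (d, n div d)) \<in> (SIGMA d:{1..x}. {1..x div d})"
      using y by auto
  next
    fix y assume "y \<in> (SIGMA d:{1..x}. {1..x div d})"
    then obtain d k where y: "y = (d, k)" "d \<ge> 1" "k \<ge> 1" "k \<le> x div d" by auto
    then have "d * k \<le> x" by (metis mult.commute less_eq_div_iff_mult_less_eq Suc_le_eq One_nat_def)
    then show "(case y of (d, k) \<Rightarrow> (d * k, d)) \<in> (SIGMA n:{1..x}. {d. d dvd n})"
      using y by auto
  qed auto
  also have "\<dots> = (\<Sum>d=1..x. \<Sum>k=1..x div d. f d k)"
    by (rule sum.Sigma[symmetric]) auto
  finally show ?thesis .
qed

lemma sum_atLeast1_split:
  fixes f :: "nat \<Rightarrow> 'a::comm_monoid_add"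
  assumes "k \<le> y"
  shows "(\<Sum>n=1..y. f n) = (\<Sum>n=1..k. f n) + (\<Sum>n=Suc k..y. f n)"
  using assms by (induction rule: dec_induct) (simp_all add: add.assoc)

lemma sum_divisors_of_divisors_swap:
  fixes f :: "nat \<Rightarrow> nat \<Rightarrow> 'a::comm_monoid_add"
  assumes n: "n > 0"
  shows "(\<Sum>d | d dvd n. \<Sum>e | e dvd n div d. f d e) = (\<Sum>e | e dvd n. \<Sum>d | d dvd n div e. f d e)"
proof -
  have fin: "finite {d. d dvd n div k}" if "k dvd n" for k
    using that n by (intro finite_divisors_nat) (auto elim!: dvdE)
  have *: "(d dvd n \<and> e dvd n div d) \<longleftrightarrow> (e dvd n \<and> d dvd n div e)" for d e
    using n by (metis div_dvd_iff_mult dvd_0_right dvd_div_iff_mult dvd_mult_left dvd_mult_right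
        mult.commute not_gr_zero dvd_0_left)
  have "(\<Sum>d | d dvd n. \<Sum>e | e dvd n div d. f d e) =
      (\<Sum>(d, e)\<in>(SIGMA d:{d. d dvd n}. {e. e dvd n div d}). f d e)"
    using fin n by (intro sum.Sigma) auto
  also have "\<dots> = (\<Sum>(e, d)\<in>(SIGMA e:{e. e dvd n}. {d. d dvd n div e}). f d e)"
    by (rule sum.reindex_bij_witness[where i="\<lambda>(a, b). (b, a)" and j="\<lambda>(a, b). (b, a)"])
       (use * in auto)
  also have "\<dots> = (\<Sum>e | e dvd n. \<Sum>d | d dvd n div e. f d e)"
    using fin n by (intro sum.Sigma[symmetric]) auto
  finally show ?thesis .
qed

section \<open>Abel summation and the value L(1, chi)\<close>

lemma norm_abel_sum_le:
  fixes a :: "nat \<Rightarrow> complex" and w :: "nat \<Rightarrow> real"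
  assumes B: "\<And>x. norm (\<Sum>n=1..x. a n) \<le> B"
    and w: "\<And>n. n > k \<Longrightarrow> w (Suc n) \<le> w n" "\<And>n. n > k \<Longrightarrow> w n \<ge> 0"
  shows "norm (\<Sum>n=Suc k..y. a n * w n) \<le> 2 * B * w (Suc k)"
proof -
  define S where "S y = (\<Sum>n=Suc k..y. a n)" for y
  have S: "norm (S y) \<le> 2 * B" if "y > k" for y
  proof -
    have "(\<Sum>n=1..y. a n) = (\<Sum>n=1..k. a n) + S y"
      using that unfolding S_def by (intro sum_atLeast1_split) auto
    then have "S y = (\<Sum>n=1..y. a n) - (\<Sum>n=1..k. a n)" by simp
    then have "norm (S y) \<le> norm (\<Sum>n=1..y. a n) + norm (\<Sum>n=1..k. a n)"
      by (simp add: norm_triangle_ineq4)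
    then show ?thesis using B[of y] B[of k] by simp
  qed
  show ?thesis
  proof (cases "y > k")
    case False
    have "0 \<le> B" using B[of 0] by simp
    then show ?thesis using False w(2)[of "Suc k"] by simp
  next
    case True
    \<comment> \<open>Summation by parts: once the boundary term \<open>S y * w y\<close> is split
      off, the rest is bounded by \<open>2 * B\<close> times the total decrease of the weights,
      which telescopes.\<close>
    have "norm ((\<Sum>n=Suc k..y. a n * w n) - S y * w y) \<le> 2 * B * (w (Suc k) - w y)"
      using Suc_leI[OF True]
    proof (induction rule: dec_induct)
      case base
      then show ?case by (simp add: S_def)
    next
      case (step y)
      have "(\<Sum>n=Suc k..Suc y. a n * w n) - S (Suc y) * w (Suc y) =
          ((\<Sum>n=Suc k..y. a n * w n) - S y * w y) + S y * of_real (w y - w (Suc y))"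
        using step.hyps by (simp add: S_def algebra_simps)
      then have "norm ((\<Sum>n=Suc k..Suc y. a n * w n) - S (Suc y) * w (Suc y)) \<le>
          norm ((\<Sum>n=Suc k..y. a n * w n) - S y * w y) + norm (S y * of_real (w y - w (Suc y)))"
        by (simp only: norm_triangle_ineq)
      also have "\<dots> \<le> 2 * B * (w (Suc k) - w y) + norm (S y * of_real (w y - w (Suc y)))"
        using step.IH by (rule add_right_mono)
      also have "norm (S y * of_real (w y - w (Suc y))) \<le> 2 * B * (w y - w (Suc y))"
        unfolding norm_mult norm_of_real
        using S[of y] w(1)[of y] step.hyps B[of 0] by (intro mult_mono) auto
      finally show ?case by (simp add: algebra_simps)
    qed
    moreover have "norm (S y * w y) \<le> 2 * B * w y"
      unfolding norm_mult norm_of_real using S[OF True] w(2)[OF True] B[of 0] by (intro mult_mono) auto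
    moreover have "norm (\<Sum>n=Suc k..y. a n * w n) \<le>
        norm ((\<Sum>n=Suc k..y. a n * w n) - S y * w y) + norm (S y * w y)"
      by (metis diff_add_cancel norm_triangle_ineq)
    ultimately show ?thesis by (simp add: algebra_simps)
  qed
qed

text \<open>The value at 1 of the Dirichlet series with coefficients \<open>a\<close>. For
  characters the series converges only conditionally, hence the limit of ordered partial sums; it
  exists when the sums of \<open>a\<close> are bounded, as the proof of
  \<open>norm_L_at_1_minus_le\<close> shows.\<close>

definition L_at_1 :: "(nat \<Rightarrow> complex) \<Rightarrow> complex" where
  "L_at_1 a = lim (\<lambda>k. \<Sum>n=1..k. a n / of_nat n)"

text \<open>Abel summation with the decreasing weights \<open>1 / n\<close> bounds every block after
  \<open>k\<close>; hence the partial sums are Cauchy, and the bound passes to the limit.\<close>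

lemma norm_L_at_1_minus_le:
  assumes B: "\<And>x. norm (\<Sum>n=1..x. a n) \<le> B"
  shows "norm (L_at_1 a - (\<Sum>n=1..k. a n / of_nat n)) \<le> 2 * B / (real k + 1)"
proof -
  define S where "S k = (\<Sum>n=1..k. a n / of_nat n)" for k
  have tail: "norm (S y - S k) \<le> 2 * B / (real k + 1)" if "y \<ge> k" for y k
  proof -
    have "S y = S k + (\<Sum>n=Suc k..y. a n / of_nat n)"
      using that unfolding S_def by (rule sum_atLeast1_split)
    then have "S y - S k = (\<Sum>n=Suc k..y. a n * of_real (1 / real n))"
      by (simp add: divide_inverse)
    also have "norm \<dots> \<le> 2 * B * (1 / real (Suc k))"
      by (rule norm_abel_sum_le[OF B]) (auto simp: frac_le)
    finally show ?thesis by (simp add: add.commute)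
  qed
  have B0: "B \<ge> 0" using B[of 0] by simp
  have "Cauchy S"
  proof (rule metric_CauchyI)
    fix e :: real assume "e > 0"
    obtain M where M: "real M > 4 * B / e" using reals_Archimedean2 by blast
    have MS: "norm (S y - S M) < e / 2" if "y \<ge> M" for y
    proof -
      have "2 * B / (real M + 1) < e / 2"
        using M \<open>e > 0\<close> B0 by (simp add: field_simps)
      then show ?thesis using tail[OF that] by linarith
    qed
    have "dist (S y) (S z) < e" if "y \<ge> M" "z \<ge> M" for y z
      using MS[OF that(1)] MS[OF that(2)] dist_triangle_half_l[of "S y" "S M" e "S z"]
      by (simp add: dist_norm)
    then show "\<exists>M. \<forall>y\<ge>M. \<forall>z\<ge>M. dist (S y) (S z) < e" by blast
  qed
  then have "S \<longlonglongrightarrow> lim S"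
    using Cauchy_convergent convergent_LIMSEQ_iff by blast
  moreover have "lim S = L_at_1 a" unfolding L_at_1_def S_def ..
  ultimately have "S \<longlonglongrightarrow> L_at_1 a" by simp
  then have "(\<lambda>y. norm (S y - S k)) \<longlonglongrightarrow> norm (L_at_1 a - S k)"
    by (intro tendsto_intros)
  moreover have "eventually (\<lambda>y. norm (S y - S k) \<le> 2 * B / (real k + 1)) sequentially"
    unfolding eventually_sequentially using tail by blast
  ultimately show ?thesis unfolding S_def[symmetric]
    by (intro tendsto_upperbound[where F=sequentially]) auto
qed

section \<open>The Moebius and von Mangoldt functions; Chebyshev and Mertens bounds\<close>

definition moebius :: "nat \<Rightarrow> real" where
  "moebius n = (if squarefree n then (-1) ^ card (prime_factors n) else 0)"

lemma abs_moebius_le: "\<bar>moebius n\<bar> \<le> 1"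
  by (simp add: moebius_def power_abs)

lemma moebius_prime_mult:
  assumes p: "prime p" and d: "d > 0" "\<not> p dvd d"
  shows "moebius (p * d) = - moebius d"
proof -
  have cop: "coprime p d" using p d(2) by (simp add: prime_imp_coprime)
  have "prime_factors (p * d) = insert p (prime_factors d)"
    using p d(1) by (subst prime_factors_product) (auto simp: prime_factorization_prime)
  moreover have "p \<notin> prime_factors d" using d(2) by auto
  ultimately show ?thesis
    using p cop squarefree_mult_coprime[OF cop] squarefree_multD(2)[of p d] squarefree_prime[OF p]
    by (auto simp: moebius_def)
qed

lemma moebius_eq_0:
  assumes "prime p" "p dvd d"
  shows "moebius (p * d) = 0"
proof -
  have "p\<^sup>2 dvd p * d" using assms(2) by (auto simp: power2_eq_square)
  then have "\<not> squarefree (p * d)"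
    using assms(1) by (meson not_prime_unit squarefreeD)
  then show ?thesis by (simp add: moebius_def)
qed

text \<open>For a prime \<open>p\<close> dividing \<open>n\<close>, the divisors \<open>d\<close>
  prime to \<open>p\<close> cancel against \<open>p * d\<close>, and \<open>moebius\<close> vanishes
  on all other divisors.\<close>

lemma sum_moebius:
  assumes n: "n > 0"
  shows "(\<Sum>d | d dvd n. moebius d) = (if n = 1 then 1 else 0)"
proof (cases "n = 1")
  case True
  then show ?thesis by (simp add: moebius_def)
next
  case False
  then obtain p where p: "prime p" "p dvd n" using prime_factor_nat by blast
  let ?D = "{d. d dvd n}" and ?E = "{d. d dvd n \<and> \<not> p dvd d}"
  have fin: "finite ?D" using n by simp
  have "(\<Sum>d\<in>?D. moebius d) = (\<Sum>d\<in>?E \<union> (*) p ` ?E. moebius d)"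
  proof (rule sum.mono_neutral_right[OF fin])
    have "p * d dvd n" if "d \<in> ?E" for d
      using that p by (intro divides_mult) (auto simp: prime_imp_coprime)
    then show "?E \<union> (*) p ` ?E \<subseteq> ?D" by auto
    show "\<forall>d\<in>?D - (?E \<union> (*) p ` ?E). moebius d = 0"
    proof
      fix d assume d: "d \<in> ?D - (?E \<union> (*) p ` ?E)"
      then have "p dvd d" by auto
      then obtain e where e: "d = p * e" by blast
      then have "p dvd e" using d by (auto dest: dvd_mult_right)
      then show "moebius d = 0" using moebius_eq_0[OF p(1)] e by simp
    qed
  qed
  also have "\<dots> = (\<Sum>d\<in>?E. moebius d) + (\<Sum>d\<in>(*) p ` ?E. moebius d)"
    using fin by (intro sum.union_disjoint) auto
  also have "(\<Sum>d\<in>(*) p ` ?E. moebius d) = (\<Sum>d\<in>?E. moebius (p * d))"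
    using p(1) by (subst sum.reindex) (auto intro!: inj_onI simp: prime_gt_0_nat)
  also have "\<dots> = (\<Sum>d\<in>?E. - moebius d)"
    using n by (intro sum.cong refl moebius_prime_mult[OF p(1)]) (auto intro: Nat.gr0I)
  finally show ?thesis using False by (simp add: sum_negf)
qed

text \<open>Moebius inversion of \<open>mangoldt_sum\<close> evaluates the sum with \<open>n\<close>
  in place of \<open>x\<close>; the correction is \<open>ln x - ln n\<close> times the sum of
  \<open>moebius\<close>, which survives only for \<open>n = 1\<close>.\<close>

lemma sum_moebius_ln:
  assumes n: "n > 0" and x: "x > 0"
  shows "(\<Sum>d | d dvd n. moebius d * ln (x / real d)) = (if n = 1 then ln x else 0) + mangoldt n"
proof -
  have dpos: "d > 0" if "d dvd n" for d using that n by (auto intro: Nat.gr0I)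
  have "(\<Sum>d | d dvd n. moebius d * ln (real (n div d))) =
      (\<Sum>d | d dvd n. \<Sum>e | e dvd n div d. moebius d * mangoldt e)"
  proof (intro sum.cong refl)
    fix d assume d: "d \<in> {d. d dvd n}"
    have "n div d \<noteq> 0" using d n by (auto elim!: dvdE)
    then show "moebius d * ln (real (n div d)) = (\<Sum>e | e dvd n div d. moebius d * mangoldt e)"
      using mangoldt_sum[of "n div d", where 'a=real] by (simp flip: sum_distrib_left)
  qed
  also have "\<dots> = (\<Sum>e | e dvd n. \<Sum>d | d dvd n div e. moebius d * mangoldt e)"
    by (rule sum_divisors_of_divisors_swap[OF n])
  also have "\<dots> = (\<Sum>e | e dvd n. if e = n then mangoldt e else 0)"
  proof (intro sum.cong refl)
    fix e assume e: "e \<in> {e. e dvd n}"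
    then have "n div e > 0" "n div e = 1 \<longleftrightarrow> e = n" using n by (auto elim!: dvdE)
    then show "(\<Sum>d | d dvd n div e. moebius d * mangoldt e) = (if e = n then mangoldt e else 0)"
      using sum_moebius[of "n div e"] by (simp flip: sum_distrib_right)
  qed
  also have "\<dots> = mangoldt n" using n by simp
  finally have 1: "(\<Sum>d | d dvd n. moebius d * ln (real (n div d))) = mangoldt n" .
  have "(\<Sum>d | d dvd n. moebius d * ln (x / real d)) =
      (\<Sum>d | d dvd n. moebius d * (ln x - ln (real n)) + moebius d * ln (real (n div d)))"
  proof (intro sum.cong refl)
    fix d assume "d \<in> {d. d dvd n}"
    then have "d dvd n" "d > 0" using dpos by auto
    then show "moebius d * ln (x / real d) =
        moebius d * (ln x - ln (real n)) + moebius d * ln (real (n div d))"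
      using x n by (simp add: real_of_nat_div ln_div algebra_simps)
  qed
  also have "\<dots> = (\<Sum>d | d dvd n. moebius d) * (ln x - ln (real n)) + mangoldt n"
    using 1 by (simp add: sum.distrib sum_distrib_right)
  finally show ?thesis using sum_moebius[OF n] by simp
qed

lemma ln_fact_eq_mangoldt: "ln (fact x) = (\<Sum>d=1..x. mangoldt d * real (x div d))"
proof -
  have "ln (fact x) = (\<Sum>n=1..x. ln (real n))"
    by (simp add: fact_prod of_nat_prod) (subst ln_prod, auto)
  also have "\<dots> = (\<Sum>n=1..x. \<Sum>d | d dvd n. mangoldt d)"
    by (intro sum.cong refl) (subst mangoldt_sum, auto)
  also have "\<dots> = (\<Sum>d=1..x. \<Sum>k=1..x div d. mangoldt d)"
    by (rule sum_divisors_swap)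
  finally show ?thesis by (simp add: mult.commute)
qed

lemma mangoldt_nonneg: "mangoldt n \<ge> (0::real)"
  using primepow_gt_Suc_0 aprimedivisor_pos_nat
  by (auto simp: mangoldt_def Suc_le_eq intro!: ln_ge_zero)

text \<open>Chebyshev's argument: the logarithm of \<open>2 * y choose y\<close> is a sum of
  \<open>mangoldt d\<close> with nonnegative multiplicities that are at least 1 for
  \<open>y < d \<le> 2 * y\<close>, and it is at most \<open>2 * y * ln 2\<close>.\<close>

lemma sum_mangoldt_double_le:
  "(\<Sum>d=1..2 * y. mangoldt d) \<le> (\<Sum>d=1..y. mangoldt d) + 2 * real y"
proof -
  have "(\<Sum>d=Suc y..2 * y. mangoldt d) \<le> (\<Sum>d=1..2*y. mangoldt d * (real (2 * y div d) - 2 * real (y div d)))"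
  proof -
    have nn: "mangoldt d * (real (2 * y div d) - 2 * real (y div d)) \<ge> 0" for d
    proof -
      have "2 * (y div d) \<le> 2 * y div d"
        by (cases "d = 0") (auto simp: less_eq_div_iff_mult_less_eq)
      then show ?thesis
        using mangoldt_nonneg by (intro mult_nonneg_nonneg) (auto simp flip: of_nat_mult)
    qed
    have "(\<Sum>d=Suc y..2 * y. mangoldt d) \<le> (\<Sum>d=Suc y..2*y. mangoldt d * (real (2 * y div d) - 2 * real (y div d)))"
    proof (rule sum_mono)
      fix d assume d: "d \<in> {Suc y..2 * y}"
      then have "y div d = 0" "2 * y div d \<ge> 1" by (auto simp: Suc_le_eq div_greater_zero_iff)
      then have "real (2 * y div d) - 2 * real (y div d) \<ge> 1" by simp
      then show "mangoldt d \<le> mangoldt d * (real (2 * y div d) - 2 * real (y div d))"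
        using mangoldt_nonneg[of d] mult_left_mono[of 1 _ "mangoldt d"] by fastforce
    qed
    also have "\<dots> \<le> (\<Sum>d=1..2*y. mangoldt d * (real (2 * y div d) - 2 * real (y div d)))"
      using nn by (intro sum_mono2) auto
    finally show ?thesis .
  qed
  also have "\<dots> = ln (fact (2 * y)) - 2 * (\<Sum>d=1..2*y. mangoldt d * real (y div d))"
    unfolding ln_fact_eq_mangoldt sum_distrib_left sum_subtractf[symmetric]
    by (intro sum.cong refl) (simp add: algebra_simps)
  also have "(\<Sum>d=1..2*y. mangoldt d * real (y div d)) = (\<Sum>d=1..y. mangoldt d * real (y div d))"
    by (rule sum.mono_neutral_right) auto
  also have "\<dots> = ln (fact y)" by (rule ln_fact_eq_mangoldt[symmetric])
  also have "ln (fact (2 * y)) - 2 * ln (fact y) = ln (real (2 * y choose y))"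
    by (simp add: binomial_fact ln_div ln_mult)
  also have "\<dots> \<le> ln (2 ^ (2 * y))"
  proof (subst ln_le_cancel_iff)
    have "(2 * y choose y) \<le> 2 ^ (2 * y)" by (rule binomial_le_pow2)
    then show "real (2 * y choose y) \<le> 2 ^ (2 * y)" by (metis of_nat_le_iff of_nat_numeral of_nat_power)
  qed auto
  also have "\<dots> = 2 * real y * ln 2" by (simp add: ln_realpow)
  also have "\<dots> \<le> 2 * real y * 1" using ln_2_less_1 by (intro mult_left_mono) auto
  finally show ?thesis using sum_atLeast1_split[of y "2 * y" "mangoldt :: nat \<Rightarrow> real"] by simp
qed

text \<open>The doubling inequality is summed over powers of 2; rounding \<open>x\<close> up to a
  power of 2 costs another factor 2.\<close>

lemma chebyshev_psi_le: "(\<Sum>d=1..x. mangoldt d) \<le> 4 * real x"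
proof (cases "x = 0")
  case False
  have pow: "(\<Sum>d=1..2 ^ k. mangoldt d) \<le> (2 * 2 ^ k :: real)" for k
  proof (induction k)
    case (Suc k)
    then show ?case using sum_mangoldt_double_le[of "2 ^ k"] by simp
  qed simp
  obtain k where k: "2 ^ k \<le> x" "x < 2 ^ (k + 1)"
    using ex_power_ivl1[of 2 x] False by auto
  have "(\<Sum>d=1..x. mangoldt d) \<le> (\<Sum>d=1..2 ^ (k + 1). mangoldt d :: real)"
    using k(2) by (intro sum_mono2) (auto simp: mangoldt_nonneg)
  also have "\<dots> \<le> 4 * 2 ^ k" using pow[of "k + 1"] by simp
  also have "\<dots> \<le> 4 * real x" using k(1) by (simp flip: of_nat_power)
  finally show ?thesis .
qed simp

lemma ln_fact_ge: "x > 0 \<Longrightarrow> ln (fact x) \<ge> real x * ln (real x) - real x"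
proof -
  assume x: "x > 0"
  have "real x ^ x / fact x \<le> exp (real x)"
  proof -
    have "(\<Sum>n\<in>{x}. real x ^ n / fact n) \<le> (\<Sum>n. real x ^ n / fact n)"
      using summable_exp[of "real x"] by (intro sum_le_suminf) (auto simp: divide_inverse mult.commute)
    then show ?thesis by (simp add: exp_def divide_inverse mult.commute scaleR_conv_of_real)
  qed
  then have "ln (real x ^ x / fact x) \<le> real x"
    using x by (metis exp_ge_zero fact_gt_zero ln_exp ln_mono of_nat_0_less_iff zero_less_divide_iff zero_less_power)
  then show ?thesis using x by (simp add: ln_div ln_realpow)
qed

lemma ln_fact_le: "ln (fact x) \<le> real x * ln (real x)"
proof (cases "x = 0")
  case False
  have "ln (fact x) \<le> ln (real x ^ x)"
    using False fact_le_power[of x, where 'a=real] by (subst ln_le_cancel_iff) auto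
  then show ?thesis using False by (simp add: ln_realpow)
qed simp

lemma mertens_lower:
  assumes "x > 0"
  shows "(\<Sum>d=1..x. mangoldt d / real d) \<ge> ln (real x) - 1"
proof -
  have "real x * ln (real x) - real x \<le> (\<Sum>d=1..x. mangoldt d * real (x div d))"
    using ln_fact_ge[OF assms] ln_fact_eq_mangoldt by simp
  also have "\<dots> \<le> (\<Sum>d=1..x. mangoldt d * (real x / real d))"
    by (intro sum_mono mult_left_mono mangoldt_nonneg) (simp add: of_nat_div_le_of_nat)
  also have "\<dots> = real x * (\<Sum>d=1..x. mangoldt d / real d)"
    by (simp add: sum_distrib_left mult_ac)
  finally have "real x * (ln (real x) - 1) \<le> real x * (\<Sum>d=1..x. mangoldt d / real d)"
    by (simp add: algebra_simps)
  then show ?thesis using assms by simp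
qed

lemma real_div_less_Suc: "d > 0 \<Longrightarrow> real x / real d < real (x div d) + 1"
  using dividend_less_times_div[of d x] by (simp add: field_simps flip: of_nat_mult of_nat_add)

text \<open>Replacing \<open>x / d\<close> by \<open>x div d + 1\<close> costs Chebyshev's sum, at
  most \<open>4 * x\<close>, which is the origin of the 4.\<close>

lemma mertens_upper:
  assumes "x > 0"
  shows "(\<Sum>d=1..x. mangoldt d / real d) \<le> ln (real x) + 4"
proof -
  have "real x * (\<Sum>d=1..x. mangoldt d / real d) = (\<Sum>d=1..x. mangoldt d * (real x / real d))"
    by (simp add: sum_distrib_left mult_ac)
  also have "\<dots> \<le> (\<Sum>d=1..x. mangoldt d * (real (x div d) + 1))"
    by (intro sum_mono mult_left_mono mangoldt_nonneg less_imp_le real_div_less_Suc) auto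
  also have "\<dots> = ln (fact x) + (\<Sum>d=1..x. mangoldt d)"
    by (simp add: ln_fact_eq_mangoldt algebra_simps sum.distrib)
  also have "\<dots> \<le> real x * ln (real x) + 4 * real x"
    using ln_fact_le chebyshev_psi_le by (intro add_mono) auto
  finally have "real x * (\<Sum>d=1..x. mangoldt d / real d) \<le> real x * (ln (real x) + 4)"
    by (simp add: algebra_simps)
  then show ?thesis using assms by simp
qed

section \<open>Character sums weighted by logarithms and by the von Mangoldt function\<close>

lemma norm_mangoldt_complex: "norm (mangoldt n :: complex) = mangoldt n"
  using mangoldt_nonneg[of n] by (metis abs_of_nonneg norm_of_real of_real_mangoldt)

text \<open>Since \<open>ln (1 + 1 / n) \<le> 1 / n\<close>, the claim reduces to
  \<open>ln n \<ge> 1\<close>; this is where \<open>n \<ge> 3\<close> enters.\<close>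

lemma ln_div_self_antimono:
  assumes "n \<ge> 3"
  shows "ln (real (Suc n)) / real (Suc n) \<le> ln (real n) / real n"
proof -
  have n: "real n \<ge> 3" using assms by simp
  have "ln (real (Suc n)) - ln (real n) = ln (real (Suc n) / real n)"
    using n by (simp add: ln_div)
  also have "real (Suc n) / real n = 1 + 1 / real n" using n by (simp add: field_simps)
  also have "ln (1 + 1 / real n) \<le> 1 / real n" using n by (intro ln_add_one_self_le_self) auto
  finally have 1: "real n * (ln (real (Suc n)) - ln (real n)) \<le> 1"
    using n by (simp add: field_simps)
  have "1 \<le> ln (real n)"
    using n exp_le by (subst ln_ge_iff) auto
  then show ?thesis using 1 n by (simp add: field_simps)
qed

text \<open>The weights \<open>ln n / n\<close> decrease only from 3 on, so Abel summation starts
  there and the first two terms are estimated separately.\<close>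

lemma sum_dir_char_ln_bounded:
  fixes a :: "nat \<Rightarrow> complex"
  assumes B: "\<And>x. norm (\<Sum>n=1..x. a n) \<le> B"
  shows "\<exists>C. \<forall>x. norm (\<Sum>n=1..x. a n * of_real (ln (real n) / real n)) \<le> C"
proof -
  define w where "w n = ln (real n) / real n" for n
  let ?S = "\<Sum>n=1..2. norm (a n * of_real (w n))"
  have B0: "B \<ge> 0" using B[of 0] by simp
  have w3: "w 3 \<ge> 0" by (simp add: w_def)
  have "norm (\<Sum>n=1..x. a n * of_real (w n)) \<le> ?S + 2 * B * w 3" for x
  proof (cases "x \<ge> 2")
    case False
    have "norm (\<Sum>n=1..x. a n * of_real (w n)) \<le> (\<Sum>n=1..x. norm (a n * of_real (w n)))"
      by (rule norm_sum)
    also have "\<dots> \<le> ?S" using False by (intro sum_mono2) auto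
    finally show ?thesis using B0 w3 by (meson add_increasing2 mult_nonneg_nonneg zero_le_numeral)
  next
    case True
    have "norm (\<Sum>n=1..2. a n * of_real (w n)) \<le> ?S" by (rule norm_sum)
    moreover have "norm (\<Sum>n=Suc 2..x. a n * of_real (w n)) \<le> 2 * B * w (Suc 2)"
      unfolding w_def
      by (rule norm_abel_sum_le[OF B]) (use ln_div_self_antimono in auto)
    ultimately show ?thesis
      unfolding sum_atLeast1_split[OF True]
      by (smt (verit) norm_triangle_ineq numeral_3_eq_3 numeral_2_eq_2)
  qed
  then show ?thesis unfolding w_def by blast
qed

lemma sum_dir_char_convolution:
  assumes D: "dir_char m \<chi>"
  shows "(\<Sum>n=1..x. \<chi> n / of_nat n * (\<Sum>d | d dvd n. g d)) =
         (\<Sum>d=1..x. \<chi> d / of_nat d * g d * (\<Sum>k=1..x div d. \<chi> k / of_nat k))"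
proof -
  have "(\<Sum>n=1..x. \<chi> n / of_nat n * (\<Sum>d | d dvd n. g d)) =
      (\<Sum>n=1..x. \<Sum>d | d dvd n. \<chi> d / of_nat d * g d * (\<chi> (n div d) / of_nat (n div d)))"
    unfolding sum_distrib_left
  proof (intro sum.cong refl)
    fix n d assume n: "n \<in> {1..x}" and d: "d \<in> {d. d dvd n}"
    then obtain k where k: "n = d * k" by blast
    then have "d > 0" "k > 0" using n by (auto intro: Nat.gr0I)
    then show "\<chi> n / of_nat n * g d = \<chi> d / of_nat d * g d * (\<chi> (n div d) / of_nat (n div d))"
      using k dir_char_mult[OF D] by simp
  qed
  also have "\<dots> = (\<Sum>d=1..x. \<Sum>k=1..x div d. \<chi> d / of_nat d * g d * (\<chi> k / of_nat k))"
    by (rule sum_divisors_swap)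
  finally show ?thesis by (simp add: sum_distrib_left)
qed

text \<open>The inner sum up to \<open>x div d\<close> misses L(1, chi) by at most
  \<open>2 * B * d / x\<close>; the factor \<open>d\<close> cancels the weight
  \<open>1 / d\<close>.\<close>

lemma norm_sum_dir_char_L_at_1_le:
  assumes D: "dir_char m \<chi>" and m: "m > 0" and B: "\<And>x. norm (\<Sum>n=1..x. \<chi> n) \<le> B" and x: "x > 0"
  shows "norm (\<Sum>d=1..x. \<chi> d / of_nat d * g d * (L_at_1 \<chi> - (\<Sum>k=1..x div d. \<chi> k / of_nat k)))
    \<le> 2 * B / real x * (\<Sum>d=1..x. norm (g d))"
proof -
  have "norm (\<Sum>d=1..x. \<chi> d / of_nat d * g d * (L_at_1 \<chi> - (\<Sum>k=1..x div d. \<chi> k / of_nat k)))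
    \<le> (\<Sum>d=1..x. 2 * B / real x * norm (g d))"
  proof (rule sum_norm_le)
    fix d assume d: "d \<in> {1..x}"
    have B0: "B \<ge> 0" using B[of 0] by simp
    have "norm (\<chi> d / of_nat d * g d * (L_at_1 \<chi> - (\<Sum>k=1..x div d. \<chi> k / of_nat k))) \<le>
        1 / real d * norm (g d) * (2 * B / (real (x div d) + 1))"
      unfolding norm_mult norm_divide norm_of_nat
      using norm_dir_char_le[OF D m, of d] norm_L_at_1_minus_le[OF B, of "x div d"] B0 d
      by (intro mult_mono divide_right_mono) auto
    also have "\<dots> \<le> 1 / real d * norm (g d) * (2 * B / (real x / real d))"
      using real_div_less_Suc[of d x] B0 d x
      by (intro mult_left_mono divide_left_mono) (auto intro!: mult_pos_pos)
    also have "1 / real d * norm (g d) * (2 * B / (real x / real d)) = 2 * B / real x * norm (g d)"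
      using d by (simp add: field_simps)
    finally show "norm (\<chi> d / of_nat d * g d * (L_at_1 \<chi> - (\<Sum>k=1..x div d. \<chi> k / of_nat k)))
      \<le> 2 * B / real x * norm (g d)" .
  qed
  then show ?thesis by (simp only: sum_distrib_left)
qed

text \<open>As \<open>ln\<close> is the divisor sum of \<open>mangoldt\<close>, the bounded sum of
  \<open>\<chi> n * ln n / n\<close> equals the sum in question times L(1, chi), up to an error that
  Chebyshev's bound keeps within \<open>8 * B\<close>.\<close>

lemma sum_dir_char_mangoldt_bounded:
  assumes D: "dir_char m \<chi>" and m: "m > 0" and B: "\<And>x. norm (\<Sum>n=1..x. \<chi> n) \<le> B"
    and L: "L_at_1 \<chi> \<noteq> 0"
  shows "\<exists>C. \<forall>x. norm (\<Sum>n=1..x. \<chi> n / of_nat n * mangoldt n) \<le> C"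
proof -
  obtain C where C: "\<And>x. norm (\<Sum>n=1..x. \<chi> n * of_real (ln (real n) / real n)) \<le> C"
    using sum_dir_char_ln_bounded[OF B] by blast
  have "norm (\<Sum>n=1..x. \<chi> n / of_nat n * mangoldt n) \<le> (C + 8 * B) / norm (L_at_1 \<chi>)" for x
  proof (cases "x = 0")
    case True
    have "C \<ge> 0" "B \<ge> 0" using C[of 0] B[of 0] by auto
    then show ?thesis using True by simp
  next
    case False
    let ?T = "\<Sum>n=1..x. \<chi> n / of_nat n * mangoldt n"
    let ?E = "\<Sum>d=1..x. \<chi> d / of_nat d * mangoldt d * (L_at_1 \<chi> - (\<Sum>k=1..x div d. \<chi> k / of_nat k))"
    have "(\<Sum>n=1..x. \<chi> n * of_real (ln (real n) / real n)) =
        (\<Sum>n=1..x. \<chi> n / of_nat n * (\<Sum>d | d dvd n. mangoldt d))"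
      by (intro sum.cong refl) (subst mangoldt_sum, auto)
    also have "\<dots> = (\<Sum>d=1..x. \<chi> d / of_nat d * mangoldt d * (\<Sum>k=1..x div d. \<chi> k / of_nat k))"
      by (rule sum_dir_char_convolution[OF D])
    also have "\<dots> = ?T * L_at_1 \<chi> - ?E"
      by (simp only: right_diff_distrib sum_subtractf sum_distrib_right) simp
    finally have "?T * L_at_1 \<chi> = (\<Sum>n=1..x. \<chi> n * of_real (ln (real n) / real n)) + ?E"
      by (simp only: diff_add_cancel)
    then have le: "norm ?T * norm (L_at_1 \<chi>) \<le> norm (\<Sum>n=1..x. \<chi> n * of_real (ln (real n) / real n)) + norm ?E"
      by (simp only: norm_mult[symmetric] norm_triangle_ineq)
    have "norm ?E \<le> 2 * B / real x * (\<Sum>d=1..x. mangoldt d)"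
      using norm_sum_dir_char_L_at_1_le[OF D m B, of x mangoldt] False by (simp add: norm_mangoldt_complex)
    also have "\<dots> \<le> 2 * B / real x * (4 * real x)"
      using B[of 0] by (intro mult_left_mono chebyshev_psi_le) auto
    also have "\<dots> = 8 * B" using False by simp
    finally have "norm ?T * norm (L_at_1 \<chi>) \<le> C + 8 * B" using C[of x] le by linarith
    then show ?thesis using L by (simp add: field_simps)
  qed
  then show ?thesis by blast
qed

text \<open>With L(1, chi) = 0 the identity for \<open>ln\<close> gives no information, so the
  convolution uses \<open>moebius d * ln (x / d)\<close>, whose divisor sum is
  \<open>mangoldt\<close> plus a term \<open>ln x\<close> at 1. The error stays bounded because the
  sum of \<open>ln (x / d)\<close> is at most \<open>x\<close>.\<close>

lemma sum_dir_char_mangoldt_L_at_1_0: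
  assumes D: "dir_char m \<chi>" and m: "m > 0" and B: "\<And>x. norm (\<Sum>n=1..x. \<chi> n) \<le> B"
    and L: "L_at_1 \<chi> = 0" and x: "x > 0"
  shows "norm ((\<Sum>n=1..x. \<chi> n / of_nat n * mangoldt n) + of_real (ln (real x))) \<le> 2 * B"
proof -
  define g where "g d = moebius d * ln (real x / real d)" for d
  have "(\<Sum>n=1..x. \<chi> n / of_nat n * (\<Sum>d | d dvd n. of_real (g d))) =
      (\<Sum>n=1..x. (if n = 1 then of_real (ln (real x)) else 0) + \<chi> n / of_nat n * mangoldt n)"
  proof (intro sum.cong refl)
    fix n assume "n \<in> {1..x}"
    then have "(\<Sum>d | d dvd n. g d) = (if n = 1 then ln (real x) else 0) + mangoldt n"
      unfolding g_def using x by (intro sum_moebius_ln) auto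
    then have "(\<Sum>d | d dvd n. complex_of_real (g d)) =
        (if n = 1 then of_real (ln (real x)) else 0) + mangoldt n"
      by (simp flip: of_real_sum)
    then show "\<chi> n / of_nat n * (\<Sum>d | d dvd n. of_real (g d)) =
        (if n = 1 then of_real (ln (real x)) else 0) + \<chi> n / of_nat n * mangoldt n"
      using dir_char_1[OF D] by simp
  qed
  also have "\<dots> = (\<Sum>n=1..x. \<chi> n / of_nat n * mangoldt n) + of_real (ln (real x))"
    using x by (simp add: sum.distrib)
  finally have "(\<Sum>d=1..x. \<chi> d / of_nat d * of_real (g d) * (\<Sum>k=1..x div d. \<chi> k / of_nat k)) =
      (\<Sum>n=1..x. \<chi> n / of_nat n * mangoldt n) + of_real (ln (real x))"
    unfolding sum_dir_char_convolution[OF D] .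
  then have "norm ((\<Sum>n=1..x. \<chi> n / of_nat n * mangoldt n) + of_real (ln (real x))) =
      norm (\<Sum>d=1..x. \<chi> d / of_nat d * of_real (g d) * (L_at_1 \<chi> - (\<Sum>k=1..x div d. \<chi> k / of_nat k)))"
    by (simp only: L diff_0 mult_minus_right sum_negf norm_minus_cancel)
  also have "\<dots> \<le> 2 * B / real x * (\<Sum>d=1..x. norm (complex_of_real (g d)))"
    by (rule norm_sum_dir_char_L_at_1_le[OF D m B x])
  also have "\<dots> \<le> 2 * B / real x * real x"
  proof (rule mult_left_mono)
    have "(\<Sum>d=1..x. norm (complex_of_real (g d))) \<le> (\<Sum>d=1..x. ln (real x) - ln (real d))"
    proof (rule sum_mono)
      fix d assume d: "d \<in> {1..x}"
      have "\<bar>g d\<bar> \<le> 1 * ln (real x / real d)"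
        unfolding g_def abs_mult using abs_moebius_le[of d] d by (intro mult_mono) auto
      then show "norm (complex_of_real (g d)) \<le> ln (real x) - ln (real d)"
        using d by (simp add: ln_div)
    qed
    also have "\<dots> = real x * ln (real x) - ln (fact x)"
      by (simp add: sum_subtractf fact_prod of_nat_prod) (subst ln_prod, auto)
    also have "\<dots> \<le> real x" using ln_fact_ge[OF x] by simp
    finally show "(\<Sum>d=1..x. norm (complex_of_real (g d))) \<le> real x" .
  qed (use B[of 0] in auto)
  also have "\<dots> = 2 * B" using x by simp
  finally show ?thesis .
qed

section \<open>Non-vanishing of \<open>L(1,\<chi>)\<close> and Dirichlet's theorem\<close>

lemma sum_divisors_prime_power_mult:
  fixes f :: "nat \<Rightarrow> 'a::comm_monoid_add"
  assumes p: "prime p" and n: "\<not> p dvd n"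
  shows "(\<Sum>d | d dvd p ^ k * n. f d) = (\<Sum>i\<le>k. \<Sum>d | d dvd n. f (p ^ i * d))"
proof -
  have n0: "n > 0" using n by (auto intro: Nat.gr0I)
  have fin: "finite {d. d dvd n}" using n0 by simp
  have "(\<Sum>i\<le>k. \<Sum>d | d dvd n. f (p ^ i * d)) = (\<Sum>(i, d)\<in>{..k} \<times> {d. d dvd n}. f (p ^ i * d))"
    by (rule sum.cartesian_product)
  also have "\<dots> = (\<Sum>d\<in>(\<lambda>(i, d). p ^ i * d) ` ({..k} \<times> {d. d dvd n}). f d)"
  proof (subst sum.reindex)
    show "inj_on (\<lambda>(i, d). p ^ i * d) ({..k} \<times> {d. d dvd n})"
    proof (rule inj_onI)
      fix u v assume "u \<in> {..k} \<times> {d. d dvd n}" "v \<in> {..k} \<times> {d. d dvd n}"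
        and eq: "(\<lambda>(i, d). p ^ i * d) u = (\<lambda>(i, d). p ^ i * d) v"
      then obtain i d j e where uv: "u = (i, d)" "v = (j, e)" "d dvd n" "e dvd n" by auto
      have nd: "\<not> p dvd d" "\<not> p dvd e" using uv n by (auto dest: dvd_trans)
      have mult: "multiplicity p (p ^ i * d) = i" if "\<not> p dvd d" for i d
        using that p by (simp add: prime_gt_1_nat multiplicity_prime_elem_times_other
            multiplicity_eqI[of p i "p ^ i * d"] dvd_mult_cancel)
      have "i = j" using mult[OF nd(1), of i] mult[OF nd(2), of j] eq uv by simp
      then show "u = v" using eq uv p by (simp add: prime_gt_0_nat)
    qed
  qed (auto intro!: sum.cong)
  also have "(\<lambda>(i, d). p ^ i * d) ` ({..k} \<times> {d. d dvd n}) = {d. d dvd p ^ k * n}"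
  proof (intro equalityI subsetI)
    fix d assume "d \<in> (\<lambda>(i, d). p ^ i * d) ` ({..k} \<times> {d. d dvd n})"
    then show "d \<in> {d. d dvd p ^ k * n}" by (auto intro!: mult_dvd_mono le_imp_power_dvd)
  next
    fix d assume "d \<in> {d. d dvd p ^ k * n}"
    then obtain a b where "d = a * b" "a dvd p ^ k" "b dvd n"
      using division_decomp[of d "p ^ k" n] by auto
    then show "d \<in> (\<lambda>(i, d). p ^ i * d) ` ({..k} \<times> {d. d dvd n})"
      using p by (auto simp: divides_primepow_nat)
  qed
  finally show ?thesis by simp
qed

lemma sum_powers_ge:
  fixes e :: real
  assumes "e = 0 \<or> e = 1 \<or> e = -1"
  shows "(\<Sum>i\<le>k. e ^ i) \<ge> 0" "even k \<Longrightarrow> (\<Sum>i\<le>k. e ^ i) \<ge> 1"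
proof -
  have "(\<Sum>i\<le>k. e ^ i) \<ge> 0 \<and> (even k \<longrightarrow> (\<Sum>i\<le>k. e ^ i) \<ge> 1)"
  proof (cases "e = -1")
    case True
    have "(\<Sum>i\<le>k. (-1) ^ i :: real) = (if even k then 1 else 0)" by (induction k) auto
    then show ?thesis using True by simp
  next
    case False
    then have e: "e \<ge> 0" using assms by auto
    have "e ^ 0 \<le> (\<Sum>i\<le>k. e ^ i)" using e by (intro member_le_sum) auto
    then show ?thesis by simp
  qed
  then show "(\<Sum>i\<le>k. e ^ i) \<ge> 0" "even k \<Longrightarrow> (\<Sum>i\<le>k. e ^ i) \<ge> 1" by auto
qed

text \<open>The divisor sum is multiplicative, so one prime is split off at a time. A prime power
  \<open>p ^ k\<close> contributes a sum of powers of \<open>r p\<close>, which is nonnegative, and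
  at least 1 for even \<open>k\<close>, the only case that occurs in a square.\<close>

lemma sum_divisors_real_char_ge:
  fixes r :: "nat \<Rightarrow> real"
  assumes r1: "r 1 = 1" and rm: "\<And>a b. r (a * b) = r a * r b"
    and rv: "\<And>a. r a = 0 \<or> r a = 1 \<or> r a = -1" and n: "n > 0"
  shows "(\<Sum>d | d dvd n. r d) \<ge> (if \<exists>j. n = j\<^sup>2 then 1 else 0)"
  using n
proof (induction n rule: less_induct)
  case (less n)
  show ?case
  proof (cases "n = 1")
    case True
    then show ?thesis using r1 by simp
  next
    case False
    then obtain p where p: "prime p" "p dvd n" using prime_factor_nat by blast
    define k where "k = multiplicity p n"
    obtain m where m: "n = p ^ k * m" "\<not> p dvd m"
      using multiplicity_decompose'[of n p] less.prems p by (metis k_def neq0_conv not_prime_unit)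
    have "k > 0" using p less.prems unfolding k_def by (simp add: prime_multiplicity_gt_zero_iff)
    then have "p ^ k > 1" using p by (metis one_less_power prime_gt_1_nat)
    moreover have m0: "m > 0" using m less.prems by (auto intro: Nat.gr0I)
    ultimately have "m < n" using m by simp
    note IH = less.IH[OF this m0]
    have rp: "r (p ^ i) = r p ^ i" for i by (induction i) (use r1 rm in auto)
    have eq: "(\<Sum>d | d dvd n. r d) = (\<Sum>i\<le>k. r p ^ i) * (\<Sum>d | d dvd m. r d)"
      unfolding m(1) sum_divisors_prime_power_mult[OF p(1) m(2)]
      by (simp only: rm rp sum_distrib_left[symmetric] sum_distrib_right[symmetric])
    have nn: "(\<Sum>d | d dvd m. r d) \<ge> 0" using IH by (auto split: if_splits)
    show ?thesis
    proof (cases "\<exists>j. n = j\<^sup>2")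
      case False
      then show ?thesis using eq sum_powers_ge(1)[OF rv] nn by simp
    next
      case True
      then obtain j where j: "n = j\<^sup>2" by blast
      have j0: "j \<noteq> 0" using j less.prems by auto
      have ev: "k = 2 * multiplicity p j"
        unfolding k_def j using p(1) j0 by (simp add: prime_elem_multiplicity_power_distrib)
      have "(p ^ multiplicity p j) dvd j" by (rule multiplicity_dvd)
      then obtain j' where j': "j = p ^ multiplicity p j * j'" by blast
      have "p ^ k * m = p ^ k * j'\<^sup>2"
        using m(1) j ev j' by (metis power_mult_distrib power_mult mult.commute)
      then have "m = j'\<^sup>2" using p(1) by (simp add: prime_gt_0_nat)
      then have "(\<Sum>d | d dvd m. r d) \<ge> 1" using IH by auto
      moreover have "(\<Sum>i\<le>k. r p ^ i) \<ge> 1" using ev sum_powers_ge(2)[OF rv] by simp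
      ultimately have "1 * 1 \<le> (\<Sum>i\<le>k. r p ^ i) * (\<Sum>d | d dvd m. r d)"
        by (intro mult_mono) auto
      then show ?thesis using eq True by simp
    qed
  qed
qed

text \<open>Reversing both sums pairs exponents \<open>a\<close> and \<open>b\<close> with
  \<open>a + b = 2 * d - 1\<close>; by the inequality of arithmetic and geometric means each pair
  contributes at least \<open>2 * t ^ d\<close>.\<close>

lemma geometric_product_ge:
  fixes t :: real
  assumes t: "0 \<le> t" "t \<le> 1" and d: "d > 0"
  shows "(\<Sum>i<d. t ^ i) * (\<Sum>j<Suc d. t ^ j) \<ge> real d * real (Suc d) * t ^ d"
proof -
  have pair: "t ^ a + t ^ b \<ge> 2 * t ^ d" if ab: "a + b = 2 * d - 1" for a b
  proof (rule power2_le_imp_le)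
    have "(t ^ a - t ^ b)\<^sup>2 \<ge> 0" by simp
    then have "4 * t ^ (a + b) \<le> (t ^ a + t ^ b)\<^sup>2"
      by (simp add: power2_eq_square algebra_simps power_add)
    moreover have "t ^ (2 * d) \<le> t ^ (a + b)" using t ab by (intro power_decreasing) auto
    ultimately show "(2 * t ^ d)\<^sup>2 \<le> (t ^ a + t ^ b)\<^sup>2"
      by (simp add: power_mult_distrib power_mult mult.commute)
  qed (use t in auto)
  have rev: "(\<Sum>i<d. t ^ (d - Suc i)) = (\<Sum>i<d. t ^ i)"
    "(\<Sum>j<Suc d. t ^ (Suc d - Suc j)) = (\<Sum>j<Suc d. t ^ j)"
    by (rule sum.nat_diff_reindex)+
  have prod: "(\<Sum>i<d. t ^ i) * (\<Sum>j<Suc d. t ^ j) = (\<Sum>i<d. \<Sum>j<Suc d. t ^ (i + j))"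
    unfolding power_add by (rule sum_product)
  have prod': "(\<Sum>i<d. t ^ i) * (\<Sum>j<Suc d. t ^ j) = (\<Sum>i<d. \<Sum>j<Suc d. t ^ ((d - Suc i) + (Suc d - Suc j)))"
    unfolding power_add rev[symmetric] by (rule sum_product)
  have "2 * ((\<Sum>i<d. t ^ i) * (\<Sum>j<Suc d. t ^ j)) =
      (\<Sum>i<d. \<Sum>j<Suc d. t ^ (i + j) + t ^ ((d - Suc i) + (Suc d - Suc j)))"
    unfolding sum.distrib prod[symmetric] prod'[symmetric] by simp
  also have "\<dots> \<ge> (\<Sum>i<d. \<Sum>j<Suc d. 2 * t ^ d)"
    by (intro sum_mono pair) auto
  finally show ?thesis by simp
qed

lemma divide_le_divide_iff_cross:
  fixes a b c d :: "'a::linordered_field"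
  shows "0 < b \<Longrightarrow> 0 < d \<Longrightarrow> a / b \<le> c / d \<longleftrightarrow> a * d \<le> c * b"
  by (simp add: field_simps)

text \<open>Monsky: if \<open>L(1,\<chi>) = 0\<close> then \<open>\<Sum>\<chi>(n) t^n / (1 - t^n)\<close> equals \<open>- \<Sum>\<chi>(n) b_n\<close> with
  \<open>b_n = 1 / (n (1 - t)) - t^n / (1 - t^n)\<close>. These weights decrease and \<open>b_1 = 1\<close>, so Abel summation
  bounds the series uniformly in \<open>t < 1\<close>; but its power series coefficients \<open>\<Sum>d dvd n. \<chi>(d)\<close> are
  nonnegative and at least \<open>1\<close> at squares.\<close>

lemma lambert_weight_antimono:
  fixes t :: real
  assumes t: "0 < t" "t < 1" and d: "d > 0"
  shows "1 / (real (Suc d) * (1 - t)) - t ^ Suc d / (1 - t ^ Suc d) \<le>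
         1 / (real d * (1 - t)) - t ^ d / (1 - t ^ d)"
proof -
  \<comment> \<open>Writing \<open>1 - t ^ k = (1 - t) * s k\<close> extracts the common factor
    \<open>1 / (1 - t)\<close> and leaves
    \<open>t ^ d / (s d * s (Suc d)) \<le> 1 / (d * (d + 1))\<close>.\<close>
  define s where "s k = (\<Sum>i<k. t ^ i)" for k
  have s: "1 - t ^ k = (1 - t) * s k" for k
    unfolding s_def using one_diff_power_eq[of t k] by simp
  have spos: "s k > 0" if "k > 0" for k
    unfolding s_def using that t by (intro sum_pos) auto
  have P: "real d * real (Suc d) * t ^ d \<le> s d * s (Suc d)"
    unfolding s_def using geometric_product_ge[of t d] t d by simp
  have sS: "s (Suc d) = s d + t ^ d" by (simp add: s_def)
  have "t ^ d / s d - t ^ Suc d / s (Suc d) = t ^ d * (s (Suc d) - t * s d) / (s d * s (Suc d))"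
    using spos[OF d] spos[of "Suc d"] by (simp add: field_simps)
  also have "s (Suc d) - t * s d = 1" using s[of d] sS by (simp add: algebra_simps)
  also have "t ^ d * 1 / (s d * s (Suc d)) \<le> 1 / (real d * real (Suc d))"
    using P spos[OF d] spos[of "Suc d"] d t
    by (subst divide_le_divide_iff_cross) (auto simp: mult_ac)
  also have "\<dots> = 1 / real d - 1 / real (Suc d)" using d by (simp add: field_simps)
  finally have "(1 / real (Suc d) - t ^ Suc d / s (Suc d)) / (1 - t) \<le> (1 / real d - t ^ d / s d) / (1 - t)"
    using t by (intro divide_right_mono) auto
  then show ?thesis
    unfolding s by (simp add: diff_divide_distrib mult.commute)
qed

lemma lambert_weight_nonneg:
  fixes t :: real
  assumes t: "0 < t" "t < 1" and d: "d > 0"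
  shows "1 / (real d * (1 - t)) - t ^ d / (1 - t ^ d) \<ge> 0"
proof -
  have "real d * t ^ d = (\<Sum>i<d. t ^ d)" by simp
  also have "\<dots> \<le> (\<Sum>i<d. t ^ i)" using t by (intro sum_mono power_decreasing) auto
  finally have "real d * t ^ d * (1 - t) \<le> (\<Sum>i<d. t ^ i) * (1 - t)"
    using t by (intro mult_right_mono) auto
  also have "\<dots> = 1 - t ^ d" using one_diff_power_eq[of t d] by (simp add: mult.commute)
  finally have "t ^ d * (real d * (1 - t)) \<le> 1 - t ^ d" by (simp add: mult_ac)
  moreover have "1 - t ^ d > 0" using t d by (simp add: power_less_one_iff)
  ultimately have "t ^ d / (1 - t ^ d) \<le> 1 / (real d * (1 - t))"
    using t d by (subst divide_le_divide_iff_cross) auto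
  then show ?thesis by simp
qed

lemma sum_geometric_from_1:
  fixes u :: real
  assumes "u \<noteq> 1"
  shows "(\<Sum>j=1..J. u ^ j) = u / (1 - u) - u ^ Suc J / (1 - u)"
proof -
  have "(1 - u) * (\<Sum>j=1..J. u ^ j) = u - u ^ Suc J"
  proof (induction J)
    case (Suc J)
    have "(1 - u) * (\<Sum>j=1..Suc J. u ^ j) = (1 - u) * (\<Sum>j=1..J. u ^ j) + (1 - u) * u ^ Suc J"
      by (simp add: distrib_left)
    moreover have "(1 - u) * u ^ Suc J = u ^ Suc J - u ^ Suc (Suc J)" by (simp add: algebra_simps)
    ultimately show ?case using Suc.IH by linarith
  qed simp
  then show ?thesis
    using assms by (simp add: eq_divide_eq mult.commute flip: diff_divide_distrib)
qed

text \<open>Finite form of the Lambert series identity. The three summands of the bound come from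
  the assumed smallness of the partial sum for L(1, chi), from Abel summation with the weights
  \<open>b\<close>, and from the tails of the geometric series, whose exponents all exceed
  \<open>K\<close>.\<close>

lemma lambert_partial_sum_le:
  fixes r :: "nat \<Rightarrow> real" and t B :: real
  assumes B: "\<And>x. \<bar>\<Sum>n=1..x. r n\<bar> \<le> B" and L: "\<bar>\<Sum>n=1..K. r n / real n\<bar> \<le> 2 * B / (real K + 1)"
    and r: "\<And>n. \<bar>r n\<bar> \<le> 1" and t: "0 < t" "t < 1"
  shows "(\<Sum>k=1..K. (\<Sum>d | d dvd k. r d) * t ^ k)
    \<le> 2 * B / (real K + 1) / (1 - t) + 2 * B + real K * t ^ K / (1 - t)"
proof -
  define b where "b d = 1 / (real d * (1 - t)) - t ^ d / (1 - t ^ d)" for d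
  have pw: "t ^ d < 1" "t ^ d \<le> t" if "d > 0" for d
    using that t power_decreasing[of 1 d t] by (auto simp: power_less_one_iff)
  have "(\<Sum>k=1..K. (\<Sum>d | d dvd k. r d) * t ^ k) =
      (\<Sum>k=1..K. \<Sum>d | d dvd k. r d * (t ^ d) ^ (k div d))"
    unfolding sum_distrib_right power_mult[symmetric] by (intro sum.cong refl) auto
  also have "\<dots> = (\<Sum>d=1..K. \<Sum>j=1..K div d. r d * (t ^ d) ^ j)"
    by (rule sum_divisors_swap)
  also have "\<dots> = (\<Sum>d=1..K. (1 / (1 - t)) * (r d / real d) - r d * b d - r d * ((t ^ d) ^ Suc (K div d) / (1 - t ^ d)))"
  proof (intro sum.cong refl)
    fix d assume "d \<in> {1..K}"
    then have d: "d > 0" by simp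
    have "(\<Sum>j=1..K div d. r d * (t ^ d) ^ j) =
        r d * (t ^ d / (1 - t ^ d) - (t ^ d) ^ Suc (K div d) / (1 - t ^ d))"
      using pw[OF d] sum_geometric_from_1[of "t ^ d" "K div d"] by (simp only: sum_distrib_left[symmetric])
    also have "t ^ d / (1 - t ^ d) = 1 / (real d * (1 - t)) - b d" by (simp add: b_def)
    finally show "(\<Sum>j=1..K div d. r d * (t ^ d) ^ j) =
        (1 / (1 - t)) * (r d / real d) - r d * b d - r d * ((t ^ d) ^ Suc (K div d) / (1 - t ^ d))"
      by (simp add: algebra_simps)
  qed
  also have "\<dots> = (1 / (1 - t)) * (\<Sum>d=1..K. r d / real d) - (\<Sum>d=1..K. r d * b d) -
      (\<Sum>d=1..K. r d * ((t ^ d) ^ Suc (K div d) / (1 - t ^ d)))"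
    by (simp only: sum_subtractf sum_distrib_left)
  also have "\<dots> \<le> (1 / (1 - t)) * (2 * B / (real K + 1)) + 2 * B + real K * (t ^ K / (1 - t))"
  proof -
    have 1: "(1 / (1 - t)) * (\<Sum>d=1..K. r d / real d) \<le> (1 / (1 - t)) * (2 * B / (real K + 1))"
      using L t by (intro mult_left_mono) auto
    have "norm (\<Sum>d=Suc 0..K. complex_of_real (r d) * of_real (b d)) \<le> 2 * B * b (Suc 0)"
    proof (rule norm_abel_sum_le)
      show "norm (\<Sum>n=1..x. complex_of_real (r n)) \<le> B" for x
        using B[of x] by (simp flip: of_real_sum)
      show "b (Suc n) \<le> b n" "b n \<ge> 0" if "n > 0" for n
        unfolding b_def using lambert_weight_antimono[OF t that] lambert_weight_nonneg[OF t that] .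
    qed
    moreover have "b (Suc 0) = 1" using t by (simp add: b_def divide_simps)
    ultimately have 2: "\<bar>\<Sum>d=1..K. r d * b d\<bar> \<le> 2 * B"
      by (simp flip: of_real_sum of_real_mult)
    have "norm (\<Sum>d=1..K. r d * ((t ^ d) ^ Suc (K div d) / (1 - t ^ d))) \<le> (\<Sum>d=1..K. t ^ K / (1 - t))"
    proof (rule sum_norm_le)
      fix d assume "d \<in> {1..K}"
      then have d: "d > 0" by simp
      have "K < d * Suc (K div d)" using dividend_less_times_div[OF d, of K] by simp
      then have "(t ^ d) ^ Suc (K div d) \<le> t ^ K"
        unfolding power_mult[symmetric] using t by (intro power_decreasing) auto
      then have "(t ^ d) ^ Suc (K div d) / (1 - t ^ d) \<le> t ^ K / (1 - t)"
        using pw[OF d] t by (intro frac_le) auto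
      moreover have "(t ^ d) ^ Suc (K div d) / (1 - t ^ d) \<ge> 0" using pw[OF d] t by simp
      ultimately have absX: "\<bar>(t ^ d) ^ Suc (K div d) / (1 - t ^ d)\<bar> \<le> t ^ K / (1 - t)"
        by (simp only: abs_of_nonneg)
      have "\<bar>r d\<bar> * \<bar>(t ^ d) ^ Suc (K div d) / (1 - t ^ d)\<bar> \<le> 1 * (t ^ K / (1 - t))"
        by (rule mult_mono[OF r absX]) simp_all
      then show "norm (r d * ((t ^ d) ^ Suc (K div d) / (1 - t ^ d))) \<le> t ^ K / (1 - t)"
        by (simp only: real_norm_def abs_mult mult_1)
    qed
    then have 3: "\<bar>\<Sum>d=1..K. r d * ((t ^ d) ^ Suc (K div d) / (1 - t ^ d))\<bar> \<le> real K * (t ^ K / (1 - t))"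
      by simp
    show ?thesis using 1 2 3 by linarith
  qed
  finally show ?thesis by (simp add: mult.commute)
qed

text \<open>If L(1, chi) were 0, letting the truncation go to infinity for fixed \<open>t\<close>
  and then \<open>t\<close> to 1 would bound all partial sums of the coefficients by
  \<open>2 * B\<close>, although every square contributes at least 1.\<close>

lemma L_at_1_real_nonzero:
  assumes D: "dir_char m \<chi>" and m: "m > 0" and B: "\<And>x. norm (\<Sum>n=1..x. \<chi> n) \<le> B"
    and real: "\<And>n. cnj (\<chi> n) = \<chi> n"
  shows "L_at_1 \<chi> \<noteq> 0"
proof
  assume L: "L_at_1 \<chi> = 0"
  define r where "r n = Re (\<chi> n)" for n
  have \<chi>: "\<chi> n = of_real (r n)" for n
    using real[of n] by (simp add: r_def complex_eq_iff)
  have rv: "r n = 0 \<or> r n = 1 \<or> r n = -1" for n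
    using norm_dir_char[OF D m, of n] by (auto simp: \<chi> split: if_splits)
  have rabs: "\<bar>r n\<bar> \<le> 1" for n using rv[of n] by auto
  have r1: "r 1 = 1" and rm: "r (a * b) = r a * r b" for a b
    using dir_char_1[OF D] dir_char_mult[OF D, of a b] by (simp_all add: r_def) (simp add: \<chi>)
  have rB: "\<bar>\<Sum>n=1..x. r n\<bar> \<le> B" for x
    using B[of x] by (simp add: \<chi> flip: of_real_sum)
  have rL: "\<bar>\<Sum>n=1..K. r n / real n\<bar> \<le> 2 * B / (real K + 1)" for K
  proof -
    have "(\<Sum>n=1..K. \<chi> n / of_nat n) = of_real (\<Sum>n=1..K. r n / real n)" by (simp add: \<chi>)
    then show ?thesis using norm_L_at_1_minus_le[OF B, of K] L by (simp del: of_real_sum)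
  qed
  define A where "A k = (\<Sum>d | d dvd k. r d)" for k
  have Age: "A k \<ge> (if \<exists>j. k = j\<^sup>2 then 1 else 0)" if "k > 0" for k
    unfolding A_def by (rule sum_divisors_real_char_ge[OF r1 rm rv that])
  have A0: "A k \<ge> 0" if "k > 0" for k
    using Age[OF that] by (auto split: if_splits)
  have bound: "(\<Sum>k=1..K. A k * t ^ k) \<le> 2 * B" if t: "0 < t" "t < 1" for K t
  proof (rule tendsto_lowerbound)
    show "(\<lambda>K. 2 * B / (real K + 1) / (1 - t) + 2 * B + real K * t ^ K / (1 - t)) \<longlonglongrightarrow> 2 * B"
    proof -
      have "(\<lambda>K. real K * t ^ K) \<longlonglongrightarrow> 0" using t by (intro powser_times_n_limit_0) auto
      moreover have "(\<lambda>K. 2 * B / (real K + 1)) \<longlonglongrightarrow> 0"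
        using lim_const_over_n[of "2 * B"] LIMSEQ_Suc[of "\<lambda>n. 2 * B / real n" 0] by (simp add: add.commute)
      ultimately have "(\<lambda>K. 2 * B / (real K + 1) / (1 - t) + 2 * B + real K * t ^ K / (1 - t))
          \<longlonglongrightarrow> 0 / (1 - t) + 2 * B + 0 / (1 - t)"
        using t by (intro tendsto_intros) auto
      then show ?thesis by simp
    qed
    have "(\<Sum>k=1..K. A k * t ^ k) \<le> 2 * B / (real K' + 1) / (1 - t) + 2 * B + real K' * t ^ K' / (1 - t)"
      if "K' \<ge> K" for K'
    proof -
      have "(\<Sum>k=1..K. A k * t ^ k) \<le> (\<Sum>k=1..K'. A k * t ^ k)"
        using that A0 t by (intro sum_mono2) auto
      also have "\<dots> \<le> 2 * B / (real K' + 1) / (1 - t) + 2 * B + real K' * t ^ K' / (1 - t)"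
        unfolding A_def by (rule lambert_partial_sum_le[OF rB rL rabs t])
      finally show ?thesis .
    qed
    then show "eventually (\<lambda>K'. (\<Sum>k=1..K. A k * t ^ k) \<le>
        2 * B / (real K' + 1) / (1 - t) + 2 * B + real K' * t ^ K' / (1 - t)) sequentially"
      unfolding eventually_sequentially by blast
  qed simp
  have bound1: "(\<Sum>k=1..K. A k) \<le> 2 * B" for K
  proof (rule tendsto_upperbound)
    have "((\<lambda>t. \<Sum>k=1..K. A k * t ^ k) \<longlongrightarrow> (\<Sum>k=1..K. A k * 1 ^ k)) (at_left 1)"
      by (intro tendsto_intros)
    then show "((\<lambda>t. \<Sum>k=1..K. A k * t ^ k) \<longlongrightarrow> (\<Sum>k=1..K. A k)) (at_left 1)" by simp
    have "eventually (\<lambda>t::real. t \<in> {0<..<1}) (at_left 1)"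
      by (rule eventually_at_left_real) simp
    then show "eventually (\<lambda>t. (\<Sum>k=1..K. A k * t ^ k) \<le> 2 * B) (at_left 1)"
      by (rule eventually_mono) (use bound in auto)
  qed simp
  obtain j where j: "real j > 2 * B" using reals_Archimedean2 by blast
  have "real j = (\<Sum>k\<in>(\<lambda>i. i\<^sup>2) ` {1..j}. 1)"
    by (simp add: card_image inj_on_def power2_eq_iff)
  also have "\<dots> \<le> (\<Sum>k\<in>(\<lambda>i. i\<^sup>2) ` {1..j}. A k)"
  proof (rule sum_mono)
    fix k assume "k \<in> (\<lambda>i. i\<^sup>2) ` {1..j}"
    then obtain i where "k = i\<^sup>2" "i \<ge> 1" by auto
    then have "k > 0" "\<exists>j. k = j\<^sup>2" by auto
    then show "1 \<le> A k" using Age[of k] by simp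
  qed
  also have "\<dots> \<le> (\<Sum>k=1..j\<^sup>2. A k)"
    using A0 by (intro sum_mono2) (auto simp: power_mono)
  finally show False using bound1[of "j\<^sup>2"] j by simp
qed

section \<open>Primes in arithmetic progressions\<close>

lemma sum_mangoldt_prime_powers_le:
  assumes P: "finite P" "\<And>p. p \<in> P \<Longrightarrow> prime p" and S: "finite S"
    and SP: "\<And>n. n \<in> S \<Longrightarrow> primepow n \<Longrightarrow> \<exists>p\<in>P. \<exists>k\<ge>k0. n = p ^ k"
  shows "(\<Sum>n\<in>S. mangoldt n / real n) \<le> (\<Sum>p\<in>P. 2 * ln (real p) / real p ^ k0)"
proof -
  define X where "X = Max (insert 0 S)"
  let ?I = "P \<times> {k0..X}" and ?f = "\<lambda>(p, k). p ^ k :: nat" and ?g = "\<lambda>n. mangoldt n / real n :: real"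
  have g0: "?g n \<ge> 0" for n using mangoldt_nonneg by simp
  have "(\<Sum>n\<in>S. ?g n) = (\<Sum>n\<in>{n \<in> S. primepow n}. ?g n)"
    using S by (intro sum.mono_neutral_right) (auto simp: mangoldt_def)
  also have "\<dots> \<le> (\<Sum>n\<in>?f ` ?I. ?g n)"
  proof (rule sum_mono2)
    show "{n \<in> S. primepow n} \<subseteq> ?f ` ?I"
    proof
      fix n assume n: "n \<in> {n \<in> S. primepow n}"
      then obtain p k where pk: "p \<in> P" "k \<ge> k0" "n = p ^ k" using SP by blast
      have "k < p ^ k" using P(2)[OF pk(1)] by (intro power_gt_expt) (auto simp: prime_gt_Suc_0_nat)
      moreover have "n \<le> X" unfolding X_def using S n by (intro Max_ge) auto
      ultimately show "n \<in> ?f ` ?I" using pk by (intro image_eqI[of _ _ "(p, k)"]) auto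
    qed
  qed (use P g0 in auto)
  also have "\<dots> \<le> (\<Sum>i\<in>?I. ?g (?f i))"
    using sum_image_le[of ?I ?g ?f] P g0 by (auto simp: o_def)
  also have "\<dots> = (\<Sum>p\<in>P. \<Sum>k=k0..X. ?g (p ^ k))"
    by (simp add: sum.cartesian_product case_prod_unfold)
  also have "\<dots> \<le> (\<Sum>p\<in>P. 2 * ln (real p) / real p ^ k0)"
  proof (rule sum_mono)
    fix p assume p: "p \<in> P"
    then have p2: "real p \<ge> 2" using P(2) prime_ge_2_nat by force
    define q where "q = 1 / real p"
    \<comment> \<open>The ratio is at most 1/2, so each geometric series is at most twice its first
      term; hence the factor 2 in the bound.\<close>
    have q: "0 < q" "q \<le> 1 / 2" using p2 by (auto simp: q_def field_simps)
    have "(\<Sum>k=k0..X. ?g (p ^ k)) \<le> (\<Sum>k=k0..X. ln (real p) * q ^ k)"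
      using P(2)[OF p] p2 by (intro sum_mono) (auto simp: mangoldt_primepow q_def field_simps)
    also have "\<dots> = ln (real p) * (\<Sum>k=k0..X. q ^ k)" by (simp only: sum_distrib_left)
    also have "(\<Sum>k=k0..X. q ^ k) \<le> q ^ k0 / (1 - q)"
      using q by (auto simp: sum_gp intro!: divide_right_mono)
    also have "\<dots> \<le> q ^ k0 / (1 / 2)" using q by (intro divide_left_mono) auto
    finally show "(\<Sum>k=k0..X. ?g (p ^ k)) \<le> 2 * ln (real p) / real p ^ k0"
      using p2 by (simp add: q_def power_divide mult_left_mono mult.commute[of 2])
  qed
  finally show ?thesis .
qed

text \<open>Each term is dominated by a difference of consecutive values of
  \<open>8 / sqrt n\<close>, so the sum telescopes. It supplies an absolute bound for sums of
  \<open>ln p / p ^ 2\<close>.\<close>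

lemma sum_sqrt_telescope_le:
  assumes "finite P" "\<And>p. p \<in> P \<Longrightarrow> p \<ge> 2"
  shows "(\<Sum>p\<in>P. 4 * sqrt (real p) / real p ^ 2) \<le> 8"
proof -
  have le: "4 * sqrt (real n) / real n ^ 2 \<le> 8 * (1 / sqrt (real (n - 1)) - 1 / sqrt (real n))"
    if n: "n \<ge> 2" for n :: nat
  proof -
    define a b where "a = sqrt (real (n - 1))" and "b = sqrt (real n)"
    have ab: "0 < a" "a < b" using n by (auto simp: a_def b_def)
    have b2: "real n = b\<^sup>2" by (simp add: b_def)
    have "a\<^sup>2 = b\<^sup>2 - 1" using n by (simp add: a_def b_def of_nat_diff)
    then have "(b - a) * (b + a) = 1" by (simp add: algebra_simps power2_eq_square)
    moreover have "(b - a) * (b + a) \<le> (b - a) * (2 * b)" using ab by (intro mult_left_mono) auto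
    ultimately have "1 / b \<le> 2 * (b - a)" using ab by (simp add: field_simps)
    then have "4 * (1 / b) / (a * b) \<le> 4 * (2 * (b - a)) / (a * b)"
      using ab by (intro divide_right_mono mult_left_mono) auto
    moreover have "4 * (1 / b) / (b * b) \<le> 4 * (1 / b) / (a * b)"
      using ab by (intro divide_left_mono mult_right_mono) (auto intro!: mult_pos_pos)
    moreover have "4 * b / (b\<^sup>2) ^ 2 = 4 * (1 / b) / (b * b)"
      using ab by (simp add: field_simps power2_eq_square)
    moreover have "4 * (2 * (b - a)) / (a * b) = 8 * (1 / a - 1 / b)"
      using ab by (simp add: field_simps)
    ultimately show ?thesis unfolding a_def[symmetric] b_def[symmetric] unfolding b2 by linarith
  qed
  define M where "M = Max (insert 2 P)"
  have M: "M \<ge> 2" "P \<subseteq> {2..M}"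
    unfolding M_def using assms by auto
  have "(\<Sum>p\<in>P. 4 * sqrt (real p) / real p ^ 2) \<le> (\<Sum>p=2..M. 4 * sqrt (real p) / real p ^ 2)"
    using M by (intro sum_mono2) auto
  also have "\<dots> \<le> (\<Sum>p=2..M. 8 * (1 / sqrt (real (p - 1)) - 1 / sqrt (real p)))"
    by (intro sum_mono le) auto
  also have "\<dots> = 8 * (1 - 1 / sqrt (real M))"
    using M(1) by (induction rule: dec_induct) (auto simp: algebra_simps)
  also have "\<dots> \<le> 8" using M by simp
  finally show ?thesis .
qed

text \<open>Prime powers that are not prime have exponent at least 2, and
  \<open>ln p \<le> 2 * sqrt p\<close> makes the resulting sums bounded. So only primes can account
  for divergence.\<close>

lemma sum_mangoldt_proper_prime_powers_bounded:
  "\<exists>C. \<forall>S. finite S \<longrightarrow> (\<forall>n\<in>S. \<not> prime n) \<longrightarrow> (\<Sum>n\<in>S. mangoldt n / real n) \<le> C"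
proof -
  have "(\<Sum>n\<in>S. mangoldt n / real n) \<le> 8"
    if S: "finite S" "\<forall>n\<in>S. \<not> prime n" for S
  proof -
    define P where "P = {p. prime p \<and> p \<le> Max (insert 0 S)}"
    have fin: "finite P" unfolding P_def by simp
    have "(\<Sum>n\<in>S. mangoldt n / real n) \<le> (\<Sum>p\<in>P. 2 * ln (real p) / real p ^ 2)"
    proof (rule sum_mangoldt_prime_powers_le[OF fin _ S(1)])
      fix n assume n: "n \<in> S" "primepow n"
      then obtain p k where pk: "prime p" "k > 0" "n = p ^ k" by (auto simp: primepow_def)
      have "k \<noteq> 1" using pk n S(2) by auto
      moreover have "p \<le> p ^ k" using pk power_increasing[of 1 k p] by (simp add: Suc_le_eq prime_gt_0_nat)
      moreover have "n \<le> Max (insert 0 S)" using S n by (intro Max_ge) auto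
      ultimately show "\<exists>p\<in>P. \<exists>k\<ge>2. n = p ^ k"
        using pk by (intro bexI[of _ p] exI[of _ k]) (auto simp: P_def)
    qed (auto simp: P_def)
    also have "\<dots> \<le> (\<Sum>p\<in>P. 4 * sqrt (real p) / real p ^ 2)"
    proof (rule sum_mono)
      fix p assume "p \<in> P"
      then have p: "real p > 0" by (simp add: P_def prime_gt_0_nat)
      have "ln (real p) = 2 * ln (sqrt (real p))" using p by (simp add: ln_sqrt)
      also have "ln (sqrt (real p)) \<le> sqrt (real p)" using p ln_le_minus_one[of "sqrt (real p)"] by simp
      finally show "2 * ln (real p) / real p ^ 2 \<le> 4 * sqrt (real p) / real p ^ 2"
        by (intro divide_right_mono) auto
    qed
    also have "\<dots> \<le> 8"
      using fin by (intro sum_sqrt_telescope_le) (auto simp: P_def prime_ge_2_nat)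
    finally show ?thesis .
  qed
  then show ?thesis by blast
qed

lemma dir_char_nonprincipal:
  assumes "dir_char m \<chi>" "\<chi> \<noteq> principal_char m"
  obtains b where "coprime b m" "\<chi> b \<noteq> 1"
proof -
  have "\<exists>b. coprime b m \<and> \<chi> b \<noteq> 1"
  proof (rule ccontr)
    assume "\<not> ?thesis"
    then have "\<chi> = principal_char m"
      using dir_char_eq_0[OF assms(1)] by (auto simp: principal_char_def fun_eq_iff)
    then show False using assms(2) by simp
  qed
  then show ?thesis using that by blast
qed

text \<open>\<open>a'\<close> is an inverse of \<open>a\<close> modulo \<open>m\<close>, so
  orthogonality applied to \<open>a' * n\<close> selects the \<open>n\<close> congruent to
  \<open>a\<close>. That \<open>a = 1\<close> gives \<open>a' = 1\<close> removes the factors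
  \<open>\<chi> a'\<close> when non-vanishing is proved.\<close>

lemma sum_dir_chars_mangoldt:
  assumes m: "m > 0" and a: "coprime a m"
  obtains a' where "\<And>x. (\<Sum>\<chi> | dir_char m \<chi>. \<chi> a' * (\<Sum>n=1..x. \<chi> n / of_nat n * mangoldt n)) =
    of_real (real (card {\<chi>. dir_char m \<chi>}) * (\<Sum>n | n \<in> {1..x} \<and> [n = a] (mod m). mangoldt n / real n))"
    "coprime a' m" "a = 1 \<Longrightarrow> a' = 1"
proof
  define a' where "a' = a ^ (totient m - 1)"
  have aa: "[a * a' = 1] (mod m)" using power_totient_inverse[OF m a] by (simp add: a'_def)
  show cop: "coprime a' m" using a by (simp add: a'_def)
  show "a' = 1" if "a = 1" using that by (simp add: a'_def)
  let ?c = "of_nat (card {\<chi>. dir_char m \<chi>}) :: complex"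
  have orth: "(\<Sum>\<chi> | dir_char m \<chi>. \<chi> (a' * n)) = (if [n = a] (mod m) then ?c else 0)" for n
  proof (cases "[n = a] (mod m)")
    case True
    have "[a' * n = a' * a] (mod m)" using True by (rule cong_scalar_left)
    then have "[a' * n = 1] (mod m)" using cong_trans aa by (metis mult.commute)
    then have "\<chi> (a' * n) = 1" if "dir_char m \<chi>" for \<chi> using dir_char_cong[OF that] dir_char_1[OF that] by simp
    then have "(\<Sum>\<chi> | dir_char m \<chi>. \<chi> (a' * n)) = (\<Sum>\<chi> | dir_char m \<chi>. 1)" by (intro sum.cong) auto
    then show ?thesis using True by simp
  next
    case False
    show ?thesis
    proof (cases "coprime n m")
      case True
      have "\<not> [a' * n = 1] (mod m)"
      proof
        assume "[a' * n = 1] (mod m)"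
        then have "[a * (a' * n) = a * 1] (mod m)" by (rule cong_scalar_left)
        moreover have "[a * a' * n = 1 * n] (mod m)" using aa by (rule cong_scalar_right)
        ultimately have "[n = a] (mod m)" by (metis cong_sym cong_trans mult.assoc mult_1 mult.right_neutral)
        then show False using \<open>\<not> [n = a] (mod m)\<close> by simp
      qed
      moreover have "coprime (a' * n) m" using cop True by simp
      ultimately show ?thesis using sum_dir_chars[OF m] \<open>\<not> [n = a] (mod m)\<close> by simp
    next
      case ncop: False
      have "\<chi> (a' * n) = 0" if "dir_char m \<chi>" for \<chi>
        using dir_char_eq_0[OF that, of "a' * n"] ncop by simp
      then have "(\<Sum>\<chi> | dir_char m \<chi>. \<chi> (a' * n)) = 0" by (intro sum.neutral) auto
      then show ?thesis using \<open>\<not> [n = a] (mod m)\<close> by simp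
    qed
  qed
  fix x
  have "(\<Sum>\<chi> | dir_char m \<chi>. \<chi> a' * (\<Sum>n=1..x. \<chi> n / of_nat n * mangoldt n)) =
      (\<Sum>\<chi> | dir_char m \<chi>. \<Sum>n=1..x. \<chi> (a' * n) * (mangoldt n / of_nat n))"
    unfolding sum_distrib_left by (intro sum.cong refl) (simp add: dir_char_mult)
  also have "\<dots> = (\<Sum>n=1..x. \<Sum>\<chi> | dir_char m \<chi>. \<chi> (a' * n) * (mangoldt n / of_nat n))"
    by (rule sum.swap)
  also have "\<dots> = (\<Sum>n=1..x. if [n = a] (mod m) then ?c * (mangoldt n / of_nat n) else 0)"
    unfolding sum_distrib_right[symmetric] orth by (intro sum.cong refl) auto
  also have "\<dots> = (\<Sum>n | n \<in> {1..x} \<and> [n = a] (mod m). ?c * (mangoldt n / of_nat n))"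
    by (rule sum.inter_filter[symmetric]) simp
  also have "\<dots> = ?c * of_real (\<Sum>n | n \<in> {1..x} \<and> [n = a] (mod m). mangoldt n / real n)"
    by (simp add: sum_distrib_left)
  finally show "(\<Sum>\<chi> | dir_char m \<chi>. \<chi> a' * (\<Sum>n=1..x. \<chi> n / of_nat n * mangoldt n)) =
    of_real (real (card {\<chi>. dir_char m \<chi>}) * (\<Sum>n | n \<in> {1..x} \<and> [n = a] (mod m). mangoldt n / real n))"
    by simp
qed

lemma sum_principal_char_mangoldt:
  "(\<Sum>n=1..x. principal_char m n / of_nat n * mangoldt n) =
    of_real (\<Sum>n | n \<in> {1..x} \<and> coprime n m. mangoldt n / real n)"
proof -
  have "(\<Sum>n=1..x. principal_char m n / of_nat n * mangoldt n) =
      (\<Sum>n=1..x. if coprime n m then mangoldt n / of_nat n else 0)"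
    by (intro sum.cong refl) (auto simp: principal_char_def)
  also have "\<dots> = (\<Sum>n | n \<in> {1..x} \<and> coprime n m. mangoldt n / of_nat n)"
    by (rule sum.inter_filter[symmetric]) simp
  finally show ?thesis by simp
qed

text \<open>Mertens' estimates for all \<open>n\<close> change only by the prime powers not coprime
  to \<open>m\<close>; these are powers of the finitely many primes dividing \<open>m\<close> and
  contribute a bounded amount.\<close>

lemma sum_principal_char_mangoldt_bounds:
  assumes m: "m > 0"
  obtains C where "\<And>x. x > 0 \<Longrightarrow> ln (real x) - C \<le> (\<Sum>n | n \<in> {1..x} \<and> coprime n m. mangoldt n / real n)"
    "\<And>x. x > 0 \<Longrightarrow> (\<Sum>n | n \<in> {1..x} \<and> coprime n m. mangoldt n / real n) \<le> ln (real x) + 4"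
proof
  fix x :: nat assume x: "x > 0"
  let ?g = "\<lambda>n. mangoldt n / real n :: real"
  let ?C = "\<Sum>p\<in>prime_factors m. 2 * ln (real p) / real p ^ 1"
  have "(\<Sum>n=1..x. ?g n) = (\<Sum>n\<in>{n. n \<in> {1..x} \<and> coprime n m} \<union> {n. n \<in> {1..x} \<and> \<not> coprime n m}. ?g n)"
    by (rule sum.cong) auto
  also have "\<dots> = (\<Sum>n | n \<in> {1..x} \<and> coprime n m. ?g n) + (\<Sum>n | n \<in> {1..x} \<and> \<not> coprime n m. ?g n)"
    by (rule sum.union_disjoint) auto
  finally have split: "(\<Sum>n=1..x. ?g n) =
    (\<Sum>n | n \<in> {1..x} \<and> coprime n m. ?g n) + (\<Sum>n | n \<in> {1..x} \<and> \<not> coprime n m. ?g n)" .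
  have "(\<Sum>n | n \<in> {1..x} \<and> \<not> coprime n m. ?g n) \<le> ?C"
  proof (rule sum_mangoldt_prime_powers_le)
    fix n assume n: "n \<in> {n. n \<in> {1..x} \<and> \<not> coprime n m}" "primepow n"
    then obtain p k where pk: "prime p" "k > 0" "n = p ^ k" by (auto simp: primepow_def)
    then have "p dvd m" using n m by (metis (mono_tags, lifting) coprime_commute coprime_power_left_iff mem_Collect_eq prime_imp_coprime)
    then show "\<exists>p\<in>prime_factors m. \<exists>k\<ge>1. n = p ^ k"
      using pk m by (intro bexI[of _ p] exI[of _ k]) (auto simp: prime_factors_dvd)
  qed auto
  then show "ln (real x) - (1 + ?C) \<le> (\<Sum>n | n \<in> {1..x} \<and> coprime n m. ?g n)"
    using mertens_lower[OF x] split by linarith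
  have "(\<Sum>n | n \<in> {1..x} \<and> \<not> coprime n m. ?g n) \<ge> 0"
    by (intro sum_nonneg) (auto simp: mangoldt_nonneg)
  then show "(\<Sum>n | n \<in> {1..x} \<and> coprime n m. ?g n) \<le> ln (real x) + 4"
    using mertens_upper[OF x] split by linarith
qed

text \<open>The partial sums for the conjugate sequence are conjugates of sums of size at most
  \<open>2 * B / (k + 1)\<close>, so their limit is smaller than every positive bound.\<close>

lemma L_at_1_cnj:
  assumes B: "\<And>x. norm (\<Sum>n=1..x. a n) \<le> B" and L: "L_at_1 a = 0"
  shows "L_at_1 (\<lambda>n. cnj (a n)) = 0"
proof (rule ccontr)
  assume nz: "L_at_1 (\<lambda>n. cnj (a n)) \<noteq> 0"
  have B': "norm (\<Sum>n=1..x. cnj (a n)) \<le> B" for x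
    using B[of x] by (metis cnj_sum complex_mod_cnj)
  have B0: "B \<ge> 0" using B[of 0] by simp
  have "norm (L_at_1 (\<lambda>n. cnj (a n))) \<le> 4 * B / (real k + 1)" for k
  proof -
    let ?S = "\<Sum>n=1..k. a n / of_nat n"
    have "(\<Sum>n=1..k. cnj (a n) / of_nat n) = cnj ?S" by simp
    then have "norm (L_at_1 (\<lambda>n. cnj (a n)) - cnj ?S) \<le> 2 * B / (real k + 1)"
      using norm_L_at_1_minus_le[OF B', of k] by simp
    moreover have "norm (cnj ?S) \<le> 2 * B / (real k + 1)"
      unfolding complex_mod_cnj using norm_L_at_1_minus_le[OF B, of k] L by simp
    moreover have "norm (L_at_1 (\<lambda>n. cnj (a n))) \<le> norm (L_at_1 (\<lambda>n. cnj (a n)) - cnj ?S) + norm (cnj ?S)"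
      by (metis diff_add_cancel norm_triangle_ineq)
    ultimately show ?thesis by simp
  qed
  moreover obtain k where "real k > 4 * B / norm (L_at_1 (\<lambda>n. cnj (a n)))" using reals_Archimedean2 by blast
  ultimately have "norm (L_at_1 (\<lambda>n. cnj (a n))) \<le> 4 * B / (real k + 1)"
    "norm (L_at_1 (\<lambda>n. cnj (a n))) * real k > 4 * B"
    using nz by (auto simp: field_simps)
  moreover have "norm (L_at_1 (\<lambda>n. cnj (a n))) > 0" using nz by simp
  ultimately show False by (simp add: field_simps)
qed

lemma ln_nat_unbounded:
  obtains x where "x > 0" "ln (real x) > B"
proof -
  obtain x :: nat where x: "real x > exp B" using reals_Archimedean2 by blast
  then have "real x > 0" using exp_gt_zero[of B] by linarith
  moreover have "ln (real x) > ln (exp B)" using x calculation by (subst ln_less_cancel_iff) auto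
  ultimately show ?thesis using that by simp
qed

text \<open>A character with L(1, chi) = 0 is not real, so its conjugate is a second one. The two
  contribute \<open>- 2 * ln x\<close> to the sum over all characters, the principal one only
  \<open>ln x\<close>, and the rest is bounded above, whereas the whole sum is nonnegative.\<close>

lemma L_at_1_nonzero:
  assumes m: "m > 0" and D: "dir_char m \<chi>" "\<chi> \<noteq> principal_char m"
  shows "L_at_1 \<chi> \<noteq> 0"
proof
  assume L: "L_at_1 \<chi> = 0"
  define T where "T \<psi> x = (\<Sum>n=1..x. \<psi> n / of_nat n * mangoldt n)" for \<psi> :: "nat \<Rightarrow> complex" and x
  define \<chi>' where "\<chi>' n = cnj (\<chi> n)" for n
  have PB: "norm (\<Sum>n=1..x. \<psi> n) \<le> real m" if "dir_char m \<psi>" "\<psi> \<noteq> principal_char m" for \<psi> x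
    using norm_sum_dir_char_le[OF that(1) m] dir_char_nonprincipal[OF that] by metis
  have "\<chi>' \<noteq> \<chi>" using L_at_1_real_nonzero[OF D(1) m PB[OF D]] L by (auto simp: \<chi>'_def fun_eq_iff)
  moreover have D': "dir_char m \<chi>'" unfolding \<chi>'_def by (rule dir_char_cnj[OF D(1)])
  moreover have np': "\<chi>' \<noteq> principal_char m"
  proof
    assume eq: "\<chi>' = principal_char m"
    have "\<chi> n = principal_char m n" for n
    proof -
      have "cnj (\<chi> n) = principal_char m n" using eq by (metis \<chi>'_def)
      then have "\<chi> n = cnj (principal_char m n)" by (metis complex_cnj_cnj)
      then show ?thesis by (simp add: principal_char_def)
    qed
    then show False using D(2) by auto
  qed
  moreover have L': "L_at_1 \<chi>' = 0" unfolding \<chi>'_def by (rule L_at_1_cnj[OF PB[OF D] L])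
  ultimately have Z: "Re (T \<psi> x) \<le> 2 * real m - ln (real x)" if "x > 0" "\<psi> = \<chi> \<or> \<psi> = \<chi>'" for \<psi> x
  proof -
    have "norm (T \<psi> x + of_real (ln (real x))) \<le> 2 * real m"
      unfolding T_def using that D D' np' L L' by (intro sum_dir_char_mangoldt_L_at_1_0[OF _ m PB]) auto
    then show ?thesis using complex_Re_le_cmod[of "T \<psi> x + of_real (ln (real x))"] by simp
  qed
  have "\<forall>\<psi>\<in>{\<psi>. dir_char m \<psi> \<and> \<psi> \<noteq> principal_char m}. \<exists>C. \<forall>x>0. Re (T \<psi> x) \<le> C"
  proof
    fix \<psi> assume "\<psi> \<in> {\<psi>. dir_char m \<psi> \<and> \<psi> \<noteq> principal_char m}"
    then have P: "dir_char m \<psi>" "\<psi> \<noteq> principal_char m" by auto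
    show "\<exists>C. \<forall>x>0. Re (T \<psi> x) \<le> C"
    proof (cases "L_at_1 \<psi> = 0")
      case False
      then show ?thesis
        using sum_dir_char_mangoldt_bounded[OF P(1) m PB[OF P]] complex_Re_le_cmod order_trans
        unfolding T_def by meson
    next
      case True
      have "Re (T \<psi> x) \<le> 2 * real m" if "x > 0" for x
      proof -
        have "norm (T \<psi> x + of_real (ln (real x))) \<le> 2 * real m"
          unfolding T_def by (rule sum_dir_char_mangoldt_L_at_1_0[OF P(1) m PB[OF P] True that])
        moreover have "ln (real x) \<ge> 0" using that by simp
        ultimately show ?thesis
          using complex_Re_le_cmod[of "T \<psi> x + of_real (ln (real x))"] by simp
      qed
      then show ?thesis by blast
    qed
  qed
  then obtain C where C: "\<And>\<psi> x. dir_char m \<psi> \<Longrightarrow> \<psi> \<noteq> principal_char m \<Longrightarrow> x > 0 \<Longrightarrow> Re (T \<psi> x) \<le> C \<psi>"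
    by (auto simp: bchoice_iff)
  let ?X = "{\<psi>. dir_char m \<psi>}"
  let ?Y = "?X - {principal_char m} - {\<chi>} - {\<chi>'}"
  have fin: "finite ?X" by (rule finite_dir_chars[OF m])
  obtain a' where a': "\<And>x. (\<Sum>\<psi>\<in>?X. \<psi> a' * T \<psi> x) =
    of_real (real (card ?X) * (\<Sum>n | n \<in> {1..x} \<and> [n = 1] (mod m). mangoldt n / real n))" "a' = 1"
    unfolding T_def using sum_dir_chars_mangoldt[OF m, of 1] by auto
  have T0: "Re (T (principal_char m) x) \<le> ln (real x) + 4" if "x > 0" for x
    using sum_principal_char_mangoldt_bounds[OF m] that unfolding T_def sum_principal_char_mangoldt Re_complex_of_real
    by metis
  have "ln (real x) \<le> 4 * real m + 4 + (\<Sum>\<psi>\<in>?Y. C \<psi>)" if x: "x > 0" for x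
  proof -
    have "0 \<le> real (card ?X) * (\<Sum>n | n \<in> {1..x} \<and> [n = 1] (mod m). mangoldt n / real n)"
      by (intro mult_nonneg_nonneg sum_nonneg) (auto simp: mangoldt_nonneg)
    also have "\<dots> = Re (\<Sum>\<psi>\<in>?X. \<psi> a' * T \<psi> x)"
      unfolding a'(1) by simp
    also have "\<dots> = (\<Sum>\<psi>\<in>?X. Re (T \<psi> x))"
      using a'(2) unfolding Re_sum by (intro sum.cong) (auto simp: dir_char_1 simp flip: One_nat_def)
    also have "\<dots> = Re (T (principal_char m) x) + (\<Sum>\<psi>\<in>?X - {principal_char m}. Re (T \<psi> x))"
      using fin dir_char_principal_char by (intro sum.remove) auto
    also have "(\<Sum>\<psi>\<in>?X - {principal_char m}. Re (T \<psi> x)) =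
        Re (T \<chi> x) + (\<Sum>\<psi>\<in>?X - {principal_char m} - {\<chi>}. Re (T \<psi> x))"
      using fin D by (intro sum.remove) auto
    also have "(\<Sum>\<psi>\<in>?X - {principal_char m} - {\<chi>}. Re (T \<psi> x)) = Re (T \<chi>' x) + (\<Sum>\<psi>\<in>?Y. Re (T \<psi> x))"
      using fin D' np' \<open>\<chi>' \<noteq> \<chi>\<close> by (intro sum.remove) auto
    finally have "0 \<le> Re (T (principal_char m) x) + (Re (T \<chi> x) + (Re (T \<chi>' x) + (\<Sum>\<psi>\<in>?Y. Re (T \<psi> x))))" .
    moreover have "(\<Sum>\<psi>\<in>?Y. Re (T \<psi> x)) \<le> (\<Sum>\<psi>\<in>?Y. C \<psi>)"
      using C x by (intro sum_mono) auto
    moreover have "Re (T \<chi> x) \<le> 2 * real m - ln (real x)" "Re (T \<chi>' x) \<le> 2 * real m - ln (real x)"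
      using Z[OF x] by auto
    ultimately show ?thesis using T0[OF x] by linarith
  qed
  moreover obtain x where "x > 0" "ln (real x) > 4 * real m + 4 + (\<Sum>\<psi>\<in>?Y. C \<psi>)" by (rule ln_nat_unbounded)
  ultimately show False by (simp add: not_less [symmetric])
qed

text \<open>With finitely many primes in the class, the sum of \<open>mangoldt n / n\<close> over
  the class would be bounded, proper prime powers being harmless. By orthogonality it is, up to a
  constant factor, at least \<open>ln x\<close> from the principal character plus bounded
  terms.\<close>

theorem dirichlet_primes:
  fixes m a :: nat
  assumes m: "m > 0" and a: "coprime a m"
  shows "infinite {p. prime p \<and> [p = a] (mod m)}"
proof
  assume finQ: "finite {p. prime p \<and> [p = a] (mod m)}"
  define T where "T \<psi> x = (\<Sum>n=1..x. \<psi> n / of_nat n * mangoldt n)" for \<psi> :: "nat \<Rightarrow> complex" and x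
  let ?X = "{\<psi>. dir_char m \<psi>}" and ?g = "\<lambda>n. mangoldt n / real n :: real"
  have PB: "norm (\<Sum>n=1..x. \<psi> n) \<le> real m" if "dir_char m \<psi>" "\<psi> \<noteq> principal_char m" for \<psi> x
    using norm_sum_dir_char_le[OF that(1) m] dir_char_nonprincipal[OF that] by metis
  have "\<forall>\<psi>\<in>?X - {principal_char m}. \<exists>C. \<forall>x. norm (T \<psi> x) \<le> C"
    unfolding T_def using sum_dir_char_mangoldt_bounded[OF _ m PB] L_at_1_nonzero[OF m] by blast
  then obtain C where C: "\<And>\<psi> x. \<psi> \<in> ?X - {principal_char m} \<Longrightarrow> norm (T \<psi> x) \<le> C \<psi>"
    by (auto simp: bchoice_iff)
  obtain C0 where C0: "\<And>x. x > 0 \<Longrightarrow> ln (real x) - C0 \<le> Re (T (principal_char m) x)"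
    unfolding T_def sum_principal_char_mangoldt Re_complex_of_real
    by (rule sum_principal_char_mangoldt_bounds[OF m]) blast
  obtain C1 where C1: "\<And>S. finite S \<Longrightarrow> (\<forall>n\<in>S. \<not> prime n) \<Longrightarrow> (\<Sum>n\<in>S. ?g n) \<le> C1"
    using sum_mangoldt_proper_prime_powers_bounded by blast
  obtain a' where a': "\<And>x. (\<Sum>\<psi>\<in>?X. \<psi> a' * T \<psi> x) =
    of_real (real (card ?X) * (\<Sum>n | n \<in> {1..x} \<and> [n = a] (mod m). ?g n))" "coprime a' m"
    unfolding T_def by (rule sum_dir_chars_mangoldt[OF m a]) blast
  define K where "K = (\<Sum>p | prime p \<and> [p = a] (mod m). ?g p) + C1"
  have K: "(\<Sum>n | n \<in> {1..x} \<and> [n = a] (mod m). ?g n) \<le> K" for x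
  proof -
    have "(\<Sum>n | n \<in> {1..x} \<and> [n = a] (mod m). ?g n) =
        (\<Sum>n\<in>{n. n \<in> {1..x} \<and> [n = a] (mod m) \<and> prime n} \<union> {n. n \<in> {1..x} \<and> [n = a] (mod m) \<and> \<not> prime n}. ?g n)"
      by (rule sum.cong) auto
    also have "\<dots> = (\<Sum>n | n \<in> {1..x} \<and> [n = a] (mod m) \<and> prime n. ?g n) +
        (\<Sum>n | n \<in> {1..x} \<and> [n = a] (mod m) \<and> \<not> prime n. ?g n)"
      by (rule sum.union_disjoint) auto
    also have "\<dots> \<le> K"
      unfolding K_def using finQ C1 mangoldt_nonneg
      by (intro add_mono sum_mono2) (auto simp: prime_ge_Suc_0_nat)
    finally show ?thesis .
  qed
  let ?B = "C0 + real (card ?X) * K + (\<Sum>\<psi>\<in>?X - {principal_char m}. C \<psi>)"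
  have "ln (real x) \<le> ?B" if x: "x > 0" for x
  proof -
    have "Re (\<Sum>\<psi>\<in>?X. \<psi> a' * T \<psi> x) \<le> real (card ?X) * K"
      unfolding a'(1) Re_complex_of_real using K[of x] by (intro mult_left_mono) auto
    moreover have "(\<Sum>\<psi>\<in>?X. \<psi> a' * T \<psi> x) =
        principal_char m a' * T (principal_char m) x + (\<Sum>\<psi>\<in>?X - {principal_char m}. \<psi> a' * T \<psi> x)"
      using finite_dir_chars[OF m] dir_char_principal_char by (intro sum.remove) auto
    moreover have "principal_char m a' = 1" using a'(2) by (simp add: principal_char_def)
    moreover have "norm (\<Sum>\<psi>\<in>?X - {principal_char m}. \<psi> a' * T \<psi> x) \<le> (\<Sum>\<psi>\<in>?X - {principal_char m}. C \<psi>)"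
    proof (rule sum_norm_le)
      fix \<psi> assume \<psi>: "\<psi> \<in> ?X - {principal_char m}"
      have "norm (\<psi> a') * norm (T \<psi> x) \<le> 1 * C \<psi>"
        using \<psi> C[OF \<psi>, of x] m by (intro mult_mono) (auto intro: norm_dir_char_le)
      then show "norm (\<psi> a' * T \<psi> x) \<le> C \<psi>" by (simp add: norm_mult)
    qed
    ultimately show ?thesis
      using C0[OF x] abs_Re_le_cmod[of "\<Sum>\<psi>\<in>?X - {principal_char m}. \<psi> a' * T \<psi> x"] by simp
  qed
  moreover obtain x where "x > 0" "ln (real x) > ?B" by (rule ln_nat_unbounded)
  ultimately show False by (simp add: not_less [symmetric])
qed

section \<open>Congruences and Frobenius lifts for power series\<close>

lemma Z_localized_of_int: "prime p \<Longrightarrow> of_int a \<in> Z_localized p"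
proof -
  assume "prime p"
  then have "\<not> int p dvd 1" using not_prime_unit by fastforce
  then show ?thesis
    unfolding Z_localized_def by (intro CollectI exI[of _ a] exI[of _ 1]) simp
qed

lemma Z_localized_of_nat: "prime p \<Longrightarrow> of_nat a \<in> Z_localized p"
  using Z_localized_of_int[of p "int a"] by simp

lemma Z_localizedE:
  assumes "x \<in> Z_localized p"
  obtains a b where "x = of_int a / of_int b" "\<not> int p dvd b" "b \<noteq> 0"
proof -
  obtain a b where "x = of_int a / of_int b" "\<not> int p dvd b"
    using assms unfolding Z_localized_def by blast
  then show ?thesis using that[of a b] by auto
qed

lemma Z_localized_divide_of_nat:
  assumes p: "prime p" and b: "\<not> p dvd b" and x: "x \<in> Z_localized p"
  shows "x / of_nat b \<in> Z_localized p"
proof -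
  obtain c d where x: "x = of_int c / of_int d" "\<not> int p dvd d" using x by (rule Z_localizedE)
  have "\<not> int p dvd d * int b" using x(2) b p by (simp add: prime_dvd_mult_iff)
  moreover have "x / of_nat b = of_int c / of_int (d * int b)" using x by simp
  ultimately show ?thesis unfolding Z_localized_def by blast
qed

lemma Z_localized_add:
  assumes p: "prime p" and x: "x \<in> Z_localized p" and y: "y \<in> Z_localized p"
  shows "x + y \<in> Z_localized p"
proof -
  obtain a b where x: "x = of_int a / of_int b" "\<not> int p dvd b" "b \<noteq> 0" using x by (rule Z_localizedE)
  obtain c d where y: "y = of_int c / of_int d" "\<not> int p dvd d" "d \<noteq> 0" using y by (rule Z_localizedE)
  have "\<not> int p dvd b * d" using x y p by (simp add: prime_dvd_mult_iff)
  moreover have "x + y = of_int (a * d + c * b) / of_int (b * d)" using x y by (simp add: add_frac_eq)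
  ultimately show ?thesis unfolding Z_localized_def by blast
qed

lemma Z_localized_mult:
  assumes p: "prime p" and x: "x \<in> Z_localized p" and y: "y \<in> Z_localized p"
  shows "x * y \<in> Z_localized p"
proof -
  obtain a b where x: "x = of_int a / of_int b" "\<not> int p dvd b" "b \<noteq> 0" using x by (rule Z_localizedE)
  obtain c d where y: "y = of_int c / of_int d" "\<not> int p dvd d" "d \<noteq> 0" using y by (rule Z_localizedE)
  have "\<not> int p dvd b * d" using x y p by (simp add: prime_dvd_mult_iff)
  moreover have "x * y = of_int (a * c) / of_int (b * d)" using x y by simp
  ultimately show ?thesis unfolding Z_localized_def by blast
qed

lemma Z_localized_of_nat_dvd:
  assumes p: "prime p" and z: "z \<in> Z_localized p" and a: "of_nat a = of_nat p * z"
  shows "p dvd a"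
proof -
  obtain c d where z: "z = of_int c / of_int d" "\<not> int p dvd d" "d \<noteq> 0" using z by (rule Z_localizedE)
  then have "of_int (int a * d) = (of_int (int p * c) :: rat)" using a by (simp add: field_simps)
  then have "int a * d = int p * c" by (simp only: of_int_eq_iff)
  then have "int p dvd int a * d" by simp
  then show ?thesis using z(2) p by (simp add: prime_dvd_mult_iff)
qed

text \<open>A predicate on subsets rather than a type, so that \<open>Z_localized p\<close> and the
  iterated power series sets \<open>fps_set\<close> over it are treated alike inside rings with
  rational coefficients.\<close>

definition subring_set :: "'a::comm_ring_1 set \<Rightarrow> bool" where
  "subring_set S \<longleftrightarrow> 1 \<in> S \<and> (\<forall>a\<in>S. \<forall>b\<in>S. a + b \<in> S \<and> a * b \<in> S \<and> - a \<in> S)"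

lemma subring_set_Z_localized: "prime p \<Longrightarrow> subring_set (Z_localized p)"
  unfolding subring_set_def
  using Z_localized_of_int[of p 1] Z_localized_add Z_localized_mult[of p "of_int (-1)"]
    Z_localized_of_int[of p "-1"] Z_localized_mult by auto

context
  fixes S :: "'a::comm_ring_1 set"
  assumes S: "subring_set S"
begin

lemma subring_1: "1 \<in> S"
  and subring_add: "a \<in> S \<Longrightarrow> b \<in> S \<Longrightarrow> a + b \<in> S"
  and subring_mult: "a \<in> S \<Longrightarrow> b \<in> S \<Longrightarrow> a * b \<in> S"
  and subring_uminus: "a \<in> S \<Longrightarrow> - a \<in> S"
  using S unfolding subring_set_def by blast+

lemma subring_0: "0 \<in> S"
  using subring_add[OF subring_1 subring_uminus[OF subring_1]] by simp

lemma subring_diff: "a \<in> S \<Longrightarrow> b \<in> S \<Longrightarrow> a - b \<in> S"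
  using subring_add[of a "- b"] subring_uminus by simp

lemma subring_sum: "(\<And>i. i \<in> I \<Longrightarrow> f i \<in> S) \<Longrightarrow> sum f I \<in> S"
  by (induction I rule: infinite_finite_induct) (auto intro: subring_0 subring_add)

lemma subring_power: "a \<in> S \<Longrightarrow> a ^ n \<in> S"
  by (induction n) (auto intro: subring_1 subring_mult)

lemma subring_of_nat: "of_nat n \<in> S"
  by (induction n) (auto intro: subring_0 subring_1 subring_add)

end

text \<open>Congruence modulo the ideal \<open>c S\<close> of the subring \<open>S\<close>.\<close>

definition scong :: "'a::comm_ring_1 set \<Rightarrow> nat \<Rightarrow> 'a \<Rightarrow> 'a \<Rightarrow> bool" where
  "scong S c a b \<longleftrightarrow> (\<exists>d\<in>S. a = b + of_nat c * d)"

context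
  fixes S :: "'a::comm_ring_1 set"
  assumes S: "subring_set S"
begin

lemma scong_refl: "scong S c a a"
  unfolding scong_def using subring_0[OF S] by (metis add.right_neutral mult_zero_right)

lemma scong_sym: "scong S c a b \<Longrightarrow> scong S c b a"
  unfolding scong_def
  by (metis (no_types) S add_diff_cancel_right' diff_conv_add_uminus mult_minus_right subring_uminus)

lemma scong_trans: "scong S c a b \<Longrightarrow> scong S c b d \<Longrightarrow> scong S c a d"
  unfolding scong_def by (metis (no_types) S add.assoc distrib_left subring_add)

lemma scong_add:
  assumes "scong S c a b" "scong S c a' b'"
  shows "scong S c (a + a') (b + b')"
proof -
  obtain d d' where "d \<in> S" "d' \<in> S" "a = b + of_nat c * d" "a' = b' + of_nat c * d'"
    using assms unfolding scong_def by blast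
  then show ?thesis unfolding scong_def
    by (intro bexI[of _ "d + d'"]) (auto simp: algebra_simps intro: subring_add[OF S])
qed

lemma scong_mult:
  assumes "scong S c a b" "scong S c a' b'" "a \<in> S" "b' \<in> S"
  shows "scong S c (a * a') (b * b')"
proof -
  obtain d d' where d: "d \<in> S" "d' \<in> S" "a = b + of_nat c * d" "a' = b' + of_nat c * d'"
    using assms unfolding scong_def by blast
  have "a * a' = b * b' + of_nat c * (d * b' + a * d')"
    using d(3,4) by (simp add: algebra_simps)
  then show ?thesis unfolding scong_def
    using d assms by (intro bexI[of _ "d * b' + a * d'"]) (auto intro: subring_add[OF S] subring_mult[OF S])
qed

lemma scong_power:
  assumes "scong S c a b" "a \<in> S" "b \<in> S"
  shows "scong S c (a ^ n) (b ^ n)"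
proof (induction n)
  case (Suc n)
  then show ?case using scong_mult[OF assms(1) Suc.IH assms(2) subring_power[OF S assms(3)]] by simp
qed (simp add: scong_refl)

lemma scong_sum: "(\<And>i. i \<in> I \<Longrightarrow> scong S c (f i) (g i)) \<Longrightarrow> scong S c (sum f I) (sum g I)"
  by (induction I rule: infinite_finite_induct) (auto intro: scong_refl scong_add)

text \<open>The middle binomial coefficients are divisible by \<open>p\<close>, since
  \<open>k * (p choose k)\<close> is and \<open>0 < k < p\<close>.\<close>

lemma scong_add_pow_prime:
  assumes p: "prime p" and ab: "a \<in> S" "b \<in> S"
  shows "scong S p ((a + b) ^ p) (a ^ p + b ^ p)"
proof -
  have p1: "p \<ge> 1" using prime_ge_1_nat[OF p] .
  have "(a + b) ^ p = (\<Sum>k\<le>p. of_nat (p choose k) * a ^ k * b ^ (p - k))"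
    by (rule binomial_ring)
  also have "{..p} = insert 0 (insert p {1..<p})" using p1 by auto
  also have "(\<Sum>k\<in>\<dots>. of_nat (p choose k) * a ^ k * b ^ (p - k)) =
      a ^ p + b ^ p + (\<Sum>k\<in>{1..<p}. of_nat (p choose k) * a ^ k * b ^ (p - k))"
    using p1 by (simp add: algebra_simps)
  finally have eq: "(a + b) ^ p = \<dots>" .
  have "scong S p (\<Sum>k\<in>{1..<p}. of_nat (p choose k) * a ^ k * b ^ (p - k)) (\<Sum>k\<in>{1..<p}. 0)"
  proof (rule scong_sum)
    fix k assume k: "k \<in> {1..<p}"
    then have "k * (p choose k) = p * ((p - 1) choose (k - 1))" by (intro times_binomial_minus1_eq) auto
    then have "p dvd k * (p choose k)" by simp
    moreover have "\<not> p dvd k" using k by (auto dest: dvd_imp_le)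
    ultimately have "p dvd (p choose k)" using p by (simp add: prime_dvd_mult_iff)
    then obtain u where "p choose k = p * u" by blast
    then have "of_nat (p choose k) * a ^ k * b ^ (p - k) = of_nat p * (of_nat u * a ^ k * b ^ (p - k))"
      by (simp add: mult.assoc)
    then show "scong S p (of_nat (p choose k) * a ^ k * b ^ (p - k)) 0"
      unfolding scong_def using ab
      by (auto intro!: subring_mult[OF S] subring_power[OF S] subring_of_nat[OF S])
  qed
  then show ?thesis
    unfolding eq using scong_add[OF scong_refl] by fastforce
qed

lemma scong_add_pow_prime_power:
  assumes p: "prime p" and ab: "a \<in> S" "b \<in> S"
  shows "scong S p ((a + b) ^ p ^ r) (a ^ p ^ r + b ^ p ^ r)"
proof (induction r)
  case (Suc r)
  have "scong S p (((a + b) ^ p ^ r) ^ p) ((a ^ p ^ r + b ^ p ^ r) ^ p)"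
    using ab by (intro scong_power Suc.IH subring_power[OF S] subring_add[OF S])
  moreover have "scong S p ((a ^ p ^ r + b ^ p ^ r) ^ p) ((a ^ p ^ r) ^ p + (b ^ p ^ r) ^ p)"
    using ab by (intro scong_add_pow_prime[OF p] subring_power[OF S])
  ultimately show ?case using scong_trans by (simp add: mult.commute flip: power_mult)
qed (simp add: scong_refl)

text \<open>In \<open>a^p - b^p = (a - b) (\<Sum>i<p. a^i b^(p-1-i))\<close> the second factor is congruent to
  \<open>p b^(p-1)\<close>, which gains one power of \<open>p\<close>.\<close>

lemma scong_pow_prime_power:
  assumes c: "scong S p a b" and ab: "a \<in> S" "b \<in> S"
  shows "scong S (p ^ Suc k) (a ^ p ^ k) (b ^ p ^ k)"
proof (induction k)
  case 0
  then show ?case using c by simp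
next
  case (Suc k)
  define A B where "A = a ^ p ^ k" and "B = b ^ p ^ k"
  have AB: "A \<in> S" "B \<in> S" unfolding A_def B_def using ab by (auto intro: subring_power[OF S])
  obtain d where d: "d \<in> S" "A = B + of_nat (p ^ Suc k) * d"
    using Suc unfolding scong_def A_def B_def by blast
  have "scong S p A B" unfolding scong_def
    using d by (intro bexI[of _ "of_nat (p ^ k) * d"]) (auto intro: subring_mult[OF S] subring_of_nat[OF S] subring_power[OF S] simp: mult.assoc)
  then have "scong S p (\<Sum>i<p. B ^ (p - Suc i) * A ^ i) (\<Sum>i<p. B ^ (p - Suc i) * B ^ i)"
    using AB by (intro scong_sum scong_mult scong_refl scong_power subring_power[OF S])
  also have "(\<Sum>i<p. B ^ (p - Suc i) * B ^ i) = (\<Sum>i<p. B ^ (p - 1))"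
    by (intro sum.cong) (auto simp flip: power_add)
  finally have "scong S p (\<Sum>i<p. B ^ (p - Suc i) * A ^ i) (of_nat p * B ^ (p - 1))" by simp
  then obtain e where e: "e \<in> S" "(\<Sum>i<p. B ^ (p - Suc i) * A ^ i) = of_nat p * B ^ (p - 1) + of_nat p * e"
    unfolding scong_def by blast
  have "A ^ p - B ^ p = (A - B) * (\<Sum>i<p. B ^ (p - Suc i) * A ^ i)"
    by (rule power_diff_sumr2)
  also have "\<dots> = of_nat (p ^ Suc (Suc k)) * (d * (B ^ (p - 1) + e))"
    unfolding e(2) using d(2) by (simp add: algebra_simps)
  finally have "A ^ p = B ^ p + of_nat (p ^ Suc (Suc k)) * (d * (B ^ (p - 1) + e))"
    by (simp add: algebra_simps)
  moreover have "d * (B ^ (p - 1) + e) \<in> S"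
    using d e AB by (intro subring_mult[OF S] subring_add[OF S] subring_power[OF S])
  ultimately have "scong S (p ^ Suc (Suc k)) (A ^ p) (B ^ p)" unfolding scong_def by blast
  then show ?case by (simp add: A_def B_def mult.commute flip: power_mult)
qed

end

section \<open>Power series over a subring and lifts of Frobenius\<close>

definition fps_set :: "'a::comm_ring_1 set \<Rightarrow> 'a fps set" where
  "fps_set S = {F. \<forall>n. F $ n \<in> S}"

lemma fps_setD: "F \<in> fps_set S \<Longrightarrow> F $ n \<in> S"
  by (simp add: fps_set_def)

lemma subring_set_fps_set:
  assumes "subring_set S"
  shows "subring_set (fps_set S)"
  unfolding subring_set_def fps_set_def
  by (auto simp: fps_mult_nth intro!: subring_add[OF assms] subring_mult[OF assms]
      subring_sum[OF assms] subring_uminus[OF assms] subring_0[OF assms] subring_1[OF assms])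

lemma scong_fps_set_iff: "scong (fps_set S) c F G \<longleftrightarrow> (\<forall>n. scong S c (F $ n) (G $ n))"
proof
  assume "\<forall>n. scong S c (F $ n) (G $ n)"
  then obtain d where d: "\<And>n. d n \<in> S" "\<And>n. F $ n = G $ n + of_nat c * d n"
    unfolding scong_def by metis
  then have "F = G + of_nat c * Abs_fps d"
    by (simp add: fps_eq_iff fps_of_nat[symmetric])
  then show "scong (fps_set S) c F G"
    unfolding scong_def fps_set_def using d(1) by (intro bexI[of _ "Abs_fps d"]) auto
next
  assume "scong (fps_set S) c F G"
  then show "\<forall>n. scong S c (F $ n) (G $ n)"
    unfolding scong_def fps_set_def by (auto simp: fps_of_nat[symmetric])
qed

text \<open>The lift \<open>F \<mapsto> F\<^sup>\<phi>(X^q)\<close> of the \<open>q\<close>-power map, given a lift \<open>\<phi>\<close> on coefficients.\<close>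

definition fps_frob :: "nat \<Rightarrow> ('a \<Rightarrow> 'a) \<Rightarrow> 'a::comm_ring_1 fps \<Rightarrow> 'a fps" where
  "fps_frob q \<phi> F = Abs_fps (\<lambda>n. if q dvd n then \<phi> (F $ (n div q)) else 0)"

lemma fps_frob_nth: "fps_frob q \<phi> F $ n = (if q dvd n then \<phi> (F $ (n div q)) else 0)"
  by (simp add: fps_frob_def)

text \<open>Induction on the coefficient index: \<open>F\<close> is split into its constant term and
  \<open>fps_X\<close> times a shift, the \<open>q\<close>-th power is additive modulo
  \<open>p\<close>, and the shift is needed only at an index smaller by \<open>q\<close>.\<close>

lemma scong_fps_frob:
  assumes S: "subring_set S" and p: "prime p" and r: "r > 0"
    and \<phi>: "\<And>a. a \<in> S \<Longrightarrow> scong S p (a ^ p ^ r) (\<phi> a)" and F: "F \<in> fps_set S"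
  shows "scong (fps_set S) p (F ^ p ^ r) (fps_frob (p ^ r) \<phi> F)"
proof -
  define q where "q = p ^ r"
  have q: "q > 0" using p by (simp add: q_def prime_gt_0_nat)
  have "scong S p ((F ^ q) $ n) (fps_frob q \<phi> F $ n)" if "F \<in> fps_set S" for n F
    using that
  proof (induction n arbitrary: F rule: less_induct)
    case (less n F)
    define F1 where "F1 = fps_shift 1 F"
    have F1: "F1 \<in> fps_set S" using less.prems by (auto simp: F1_def fps_set_def)
    have dec: "F = fps_const (F $ 0) + fps_X * F1"
      by (auto simp: fps_eq_iff F1_def fps_X_mult_nth)
    have in1: "fps_const (F $ 0) \<in> fps_set S" "fps_X * F1 \<in> fps_set S"
      using less.prems subring_0[OF S] F1 by (auto simp: fps_set_def fps_X_mult_nth)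
    have "scong (fps_set S) p ((fps_const (F $ 0) + fps_X * F1) ^ q) (fps_const (F $ 0) ^ q + (fps_X * F1) ^ q)"
      unfolding q_def by (rule scong_add_pow_prime_power[OF subring_set_fps_set[OF S] p in1])
    then have "scong S p ((F ^ q) $ n) ((fps_const (F $ 0) ^ q + (fps_X * F1) ^ q) $ n)"
      unfolding dec[symmetric] scong_fps_set_iff by blast
    also have "(fps_const (F $ 0) ^ q + (fps_X * F1) ^ q) $ n =
        (if n = 0 then (F $ 0) ^ q else 0) + (if n < q then 0 else (F1 ^ q) $ (n - q))"
      by (simp add: power_mult_distrib fps_X_power_mult_nth fps_const_power)
    finally have 1: "scong S p ((F ^ q) $ n) \<dots>" .
    have 2: "scong S p ((if n = 0 then (F $ 0) ^ q else 0) + (if n < q then 0 else (F1 ^ q) $ (n - q)))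
       (fps_frob q \<phi> F $ n)"
    proof (cases "n < q")
      case True
      then show ?thesis
        using \<phi>[of "F $ 0"] fps_setD[OF less.prems] scong_refl[OF S] q
        by (auto simp: fps_frob_nth q_def dest: dvd_imp_le)
    next
      case False
      have "scong S p ((F1 ^ q) $ (n - q)) (fps_frob q \<phi> F1 $ (n - q))"
        using False q by (intro less.IH F1) auto
      moreover have "fps_frob q \<phi> F1 $ (n - q) = fps_frob q \<phi> F $ n"
        using False q by (auto simp: fps_frob_nth F1_def dvd_minus_self le_div_geq)
      ultimately show ?thesis using False q by simp
    qed
    show ?case by (rule scong_trans[OF S 1 2])
  qed
  then show ?thesis using F unfolding scong_fps_set_iff q_def by blast
qed

text \<open>Fermat's little theorem for integers extends to fractions by clearing denominators, and
  is iterated \<open>r\<close> times. It makes the identity a Frobenius lift on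
  \<open>Z_localized p\<close>.\<close>

lemma scong_Z_localized_fermat:
  assumes p: "prime p" and a: "a \<in> Z_localized p"
  shows "scong (Z_localized p) p (a ^ p ^ r) a"
proof -
  note S = subring_set_Z_localized[OF p]
  have fermat: "\<exists>u. x ^ p = x + int p * u" for x :: int
  proof -
    have nat: "[n ^ p = n] (mod p)" for n :: nat
    proof (induction n)
      case 0
      then show ?case by (simp only: zero_power[OF prime_gt_0_nat[OF p]] cong_refl)
    next
      case (Suc n)
      have "scong (UNIV :: int set) p ((int n + 1) ^ p) (int n ^ p + 1 ^ p)"
        by (rule scong_add_pow_prime[OF _ p]) (auto simp: subring_set_def)
      then have "[(int n + 1) ^ p = int n ^ p + 1] (mod int p)"
        by (auto simp: scong_def cong_iff_dvd_diff)
      then have "[int (Suc n ^ p) = int (n ^ p + 1)] (mod int p)" by (simp add: add.commute)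
      then have "[Suc n ^ p = n ^ p + 1] (mod p)" by (simp only: cong_int_iff)
      also have "[n ^ p + 1 = n + 1] (mod p)" using Suc by (intro cong_add) auto
      finally show ?case by simp
    qed
    define n where "n = nat (x mod int p)"
    have n: "[x = int n] (mod int p)" using prime_gt_0_nat[OF p] by (simp add: n_def cong_def)
    have "[x ^ p = int n ^ p] (mod int p)" using n by (rule cong_pow)
    also have "[int n ^ p = int n] (mod int p)" using nat[of n] by (simp flip: cong_int_iff)
    also have "[int n = x] (mod int p)" using n by (rule cong_sym)
    finally have "int p dvd x ^ p - x" by (simp add: cong_iff_dvd_diff)
    then show ?thesis by (metis add.commute diff_add_cancel dvdE)
  qed
  have base: "scong (Z_localized p) p (a ^ p) a" if "a \<in> Z_localized p" for a
  proof -
    obtain x y where a: "a = of_int x / of_int y" "\<not> int p dvd y" "y \<noteq> 0" using \<open>a \<in> Z_localized p\<close> by (rule Z_localizedE)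
    obtain u v where uv: "x ^ p = x + int p * u" "y ^ p = y + int p * v" using fermat by metis
    define e :: rat where "e = of_int (u * y - x * v) / of_int (y ^ Suc p)"
    have "\<not> int p dvd y ^ Suc p" using a(2) p by (meson prime_dvd_power prime_int_nat_transfer prime_nat_int_transfer)
    then have "e \<in> Z_localized p" unfolding e_def Z_localized_def by blast
    moreover have "x ^ p * y = x * y ^ p + int p * (u * y - x * v)"
      unfolding uv by (simp add: algebra_simps)
    then have "(of_int x ^ p * of_int y :: rat) = of_int x * of_int y ^ p + of_nat p * of_int (u * y - x * v)"
      by (metis of_int_add of_int_mult of_int_of_nat_eq of_int_power)
    then have "a ^ p = a + of_nat p * e"
      using a(3) by (simp add: a(1) e_def power_divide field_simps)
    ultimately show ?thesis unfolding scong_def by blast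
  qed
  show ?thesis
  proof (induction r)
    case (Suc r)
    have "scong (Z_localized p) p ((a ^ p ^ r) ^ p) (a ^ p)"
      using a by (intro scong_power[OF S Suc.IH] subring_power[OF S])
    then show ?case using scong_trans[OF S _ base[OF a]] by (simp add: mult.commute flip: power_mult)
  qed (simp add: scong_refl[OF S])
qed


definition ring_hom_fun :: "('a::comm_ring_1 \<Rightarrow> 'a) \<Rightarrow> bool" where
  "ring_hom_fun \<phi> \<longleftrightarrow> \<phi> 1 = 1 \<and> (\<forall>a b. \<phi> (a + b) = \<phi> a + \<phi> b \<and> \<phi> (a * b) = \<phi> a * \<phi> b)"

context
  fixes \<phi> :: "'a::comm_ring_1 \<Rightarrow> 'a"
  assumes \<phi>: "ring_hom_fun \<phi>"
begin

lemma ring_hom_fun_1: "\<phi> 1 = 1"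
  and ring_hom_fun_add: "\<phi> (a + b) = \<phi> a + \<phi> b"
  and ring_hom_fun_mult: "\<phi> (a * b) = \<phi> a * \<phi> b"
  using \<phi> unfolding ring_hom_fun_def by blast+

lemma ring_hom_fun_0: "\<phi> 0 = 0"
  using ring_hom_fun_add[of 0 0] by simp

lemma ring_hom_fun_sum: "\<phi> (sum f I) = (\<Sum>i\<in>I. \<phi> (f i))"
  by (induction I rule: infinite_finite_induct) (simp_all add: ring_hom_fun_0 ring_hom_fun_add)

lemma ring_hom_fun_power: "\<phi> (a ^ n) = \<phi> a ^ n"
  by (induction n) (simp_all add: ring_hom_fun_1 ring_hom_fun_mult)

end

lemma sum_dvd_reindex:
  fixes f :: "nat \<Rightarrow> 'a::comm_monoid_add"
  assumes q: "q > 0" and f: "\<And>i. i \<le> q * k \<Longrightarrow> \<not> q dvd i \<Longrightarrow> f i = 0"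
  shows "(\<Sum>i=0..q * k. f i) = (\<Sum>j=0..k. f (q * j))"
proof -
  have "(\<Sum>i=0..q * k. f i) = (\<Sum>i\<in>(*) q ` {0..k}. f i)"
  proof (intro sum.mono_neutral_right ballI)
    fix i assume i: "i \<in> {0..q * k} - (*) q ` {0..k}"
    have "\<not> q dvd i"
    proof
      assume "q dvd i"
      then obtain j where "i = q * j" by blast
      then show False using i q by auto
    qed
    then show "f i = 0" using f i by simp
  qed (use q in auto)
  also have "\<dots> = (\<Sum>j=0..k. f (q * j))"
    using q by (subst sum.reindex) (auto intro: inj_onI)
  finally show ?thesis .
qed

lemma ring_hom_fps_frob:
  assumes \<phi>: "ring_hom_fun \<phi>" and q: "q > 0"
  shows "ring_hom_fun (fps_frob q \<phi>)"
  unfolding ring_hom_fun_def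
proof (intro conjI allI)
  show "fps_frob q \<phi> 1 = 1"
    using q by (auto simp: fps_eq_iff fps_frob_nth ring_hom_fun_0[OF \<phi>] ring_hom_fun_1[OF \<phi>] elim!: dvdE)
  fix F G
  show "fps_frob q \<phi> (F + G) = fps_frob q \<phi> F + fps_frob q \<phi> G"
    by (simp add: fps_eq_iff fps_frob_nth ring_hom_fun_add[OF \<phi>])
  show "fps_frob q \<phi> (F * G) = fps_frob q \<phi> F * fps_frob q \<phi> G"
  proof (rule fps_ext)
    fix n
    show "fps_frob q \<phi> (F * G) $ n = (fps_frob q \<phi> F * fps_frob q \<phi> G) $ n"
    proof (cases "q dvd n")
      case True
      then obtain k where k: "n = q * k" by blast
      have "(fps_frob q \<phi> F * fps_frob q \<phi> G) $ n =
          (\<Sum>j=0..k. fps_frob q \<phi> F $ (q * j) * fps_frob q \<phi> G $ (q * k - q * j))"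
        unfolding k fps_mult_nth by (rule sum_dvd_reindex[OF q]) (simp add: fps_frob_nth)
      also have "\<dots> = (\<Sum>j=0..k. \<phi> (F $ j) * \<phi> (G $ (k - j)))"
        using q by (simp add: fps_frob_nth flip: right_diff_distrib')
      also have "\<dots> = fps_frob q \<phi> (F * G) $ n"
        using q by (simp add: k fps_frob_nth fps_mult_nth ring_hom_fun_sum[OF \<phi>] ring_hom_fun_mult[OF \<phi>])
      finally show ?thesis by simp
    next
      case False
      have "fps_frob q \<phi> F $ i * fps_frob q \<phi> G $ (n - i) = 0" if "i \<le> n" for i
        using False that by (auto simp: fps_frob_nth) (metis dvd_add le_add_diff_inverse)
      then show ?thesis using False by (simp add: fps_mult_nth fps_frob_nth)
    qed
  qed
qed

text \<open>\<open>fps_frob\<close> is a ring homomorphism, so it commutes with powers of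
  \<open>G\<close>, and \<phi> fixes the coefficients of \<open>F\<close>. The defining sums have
  different lengths, but \<open>G $ 0 = 0\<close> kills the surplus terms.\<close>

lemma fps_frob_compose:
  assumes \<phi>: "ring_hom_fun \<phi>" and q: "q > 0" and F: "\<And>n. \<phi> (F $ n) = F $ n" and G: "G $ 0 = 0"
  shows "fps_frob q \<phi> (F oo G) = F oo fps_frob q \<phi> G"
proof (rule fps_ext)
  fix n
  note pw = ring_hom_fun_power[OF ring_hom_fps_frob[OF \<phi> q], symmetric]
  show "fps_frob q \<phi> (F oo G) $ n = (F oo fps_frob q \<phi> G) $ n"
  proof (cases "q dvd n")
    case True
    then obtain k where k: "n = q * k" by blast
    have "(F oo fps_frob q \<phi> G) $ n = (\<Sum>i=0..n. F $ i * \<phi> ((G ^ i) $ k))"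
      using q by (simp add: fps_compose_nth pw fps_frob_nth k)
    also have "\<dots> = (\<Sum>i=0..k. F $ i * \<phi> ((G ^ i) $ k))"
      using q G by (intro sum.mono_neutral_right)
        (auto simp: k startsby_zero_power_prefix ring_hom_fun_0[OF \<phi>])
    also have "\<dots> = fps_frob q \<phi> (F oo G) $ n"
      using q by (simp add: k fps_frob_nth fps_compose_nth ring_hom_fun_sum[OF \<phi>] ring_hom_fun_mult[OF \<phi>] F)
    finally show ?thesis by simp
  qed (simp add: fps_compose_nth pw fps_frob_nth)
qed

section \<open>Truncation of power series and extension of coefficients\<close>

lemma fps_mult_nth_cong:
  assumes "\<And>i. i \<le> n \<Longrightarrow> A $ i = B $ i" "\<And>i. i \<le> n \<Longrightarrow> C $ i = D $ i"
  shows "(A * C) $ n = (B * D) $ n"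
  using assms by (simp add: fps_mult_nth)

lemma fps_power_nth_cong:
  fixes A B :: "'a::comm_ring_1 fps"
  assumes "\<And>i. i \<le> n \<Longrightarrow> A $ i = B $ i"
  shows "(A ^ m) $ n = (B ^ m) $ n"
  using assms
proof (induction m arbitrary: n)
  case (Suc m)
  have "(A ^ m) $ i = (B ^ m) $ i" if "i \<le> n" for i using Suc that by simp
  then show ?case using Suc.prems fps_mult_nth_cong[of n A B] by simp
qed simp

lemma fps_compose_nth_cong:
  fixes A B :: "'a::comm_ring_1 fps"
  assumes "\<And>i. i \<le> n \<Longrightarrow> A $ i = B $ i"
  shows "(F oo A) $ n = (F oo B) $ n"
  using fps_power_nth_cong[OF assms] by (simp add: fps_compose_nth)

text \<open>With zero constant term, a product of at least two factors reaches degree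
  \<open>n\<close> only through coefficients of index below \<open>n\<close>. This separates the
  unknown coefficient from the known ones in recursions.\<close>

lemma fps_power_cutoff_nth:
  fixes A :: "'a::comm_ring_1 fps"
  assumes A: "A $ 0 = 0" and m: "m \<ge> 2" and i: "i \<le> n"
  shows "(fps_cutoff n A ^ m) $ i = (A ^ m) $ i"
proof -
  have A0: "fps_cutoff n A $ 0 = 0" using A by simp
  have eq: "G = fps_X * fps_shift 1 G" if "G $ 0 = 0" for G :: "'a fps"
    using that by (auto simp: fps_eq_iff fps_X_mult_nth)
  have nth: "(G ^ m) $ i = (if i < m then 0 else (fps_shift 1 G ^ m) $ (i - m))" if "G $ 0 = 0"
    for G :: "'a fps"
    by (subst eq[OF that]) (simp add: power_mult_distrib fps_X_power_mult_nth)
  show ?thesis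
    unfolding nth[OF A] nth[OF A0] using m i by (auto intro!: fps_power_nth_cong)
qed

text \<open>Views \<open>f\<close> as a series in \<open>t\<close> with coefficients constant in
  \<open>s\<close>, so that it can be composed with series over power series in
  \<open>s\<close>.\<close>

definition fps_lift :: "'a::comm_ring_1 fps \<Rightarrow> 'a fps fps" where
  "fps_lift f = Abs_fps (\<lambda>n. fps_const (f $ n))"

lemma fps_lift_nth [simp]: "fps_lift f $ n = fps_const (f $ n)"
  by (simp add: fps_lift_def)

lemma fps_const_sum: "fps_const (sum f I) = (\<Sum>i\<in>I. fps_const (f i))"
  by (induction I rule: infinite_finite_induct) (simp_all flip: fps_const_add)

lemma fps_lift_mult: "fps_lift (f * g) = fps_lift f * fps_lift g"
  by (simp add: fps_eq_iff[of "fps_lift _"] fps_mult_nth fps_const_sum)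

lemma fps_lift_power: "fps_lift (f ^ k) = fps_lift f ^ k"
proof (induction k)
  case 0
  show ?case by (rule fps_ext) simp
qed (simp add: fps_lift_mult)

lemma fps_lift_compose: "fps_lift (f oo g) = fps_lift f oo fps_lift g"
  by (simp add: fps_eq_iff[of "fps_lift _"] fps_compose_nth fps_const_sum flip: fps_lift_power)

section \<open>Formal group laws and the functional equation\<close>

text \<open>\<open>homog F\<close> is \<open>F(t, t s)\<close>, as a power series in \<open>t\<close> over power series in \<open>s\<close>. It turns
  \<open>fps2_subst\<close> into composition of power series in one variable.\<close>

definition homog :: "'a::comm_ring_1 fps fps \<Rightarrow> 'a fps fps" where
  "homog F = Abs_fps (\<lambda>d. Abs_fps (\<lambda>j. if j \<le> d then F $ j $ (d - j) else 0))"

lemma homog_nth: "homog F $ d $ j = (if j \<le> d then F $ j $ (d - j) else 0)"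
  by (simp add: homog_def)

lemma homog_add: "homog (F + G) = homog F + homog G"
  by (simp add: fps_eq_iff homog_nth)

lemma homog_mult: "homog (F * G) = homog F * homog G"
proof (intro fps_ext)
  fix d j
  have "(homog F * homog G) $ d $ j =
      (\<Sum>e=0..d. \<Sum>i=0..j. homog F $ e $ i * homog G $ (d - e) $ (j - i))"
    by (simp add: fps_mult_nth fps_sum_nth)
  also have "\<dots> = (\<Sum>i=0..j. \<Sum>e=0..d. homog F $ e $ i * homog G $ (d - e) $ (j - i))"
    by (rule sum.swap)
  also have "\<dots> = homog (F * G) $ d $ j"
  proof (cases "j \<le> d")
    case True
    have "(\<Sum>e=0..d. homog F $ e $ i * homog G $ (d - e) $ (j - i)) =
        (\<Sum>l=0..d - j. F $ i $ l * G $ (j - i) $ (d - j - l))" if i: "i \<in> {0..j}" for i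
    proof -
      have "(\<Sum>e=0..d. homog F $ e $ i * homog G $ (d - e) $ (j - i)) =
          (\<Sum>e\<in>(\<lambda>l. i + l) ` {0..d - j}. homog F $ e $ i * homog G $ (d - e) $ (j - i))"
      proof (intro sum.mono_neutral_right ballI)
        fix e assume e: "e \<in> {0..d} - (\<lambda>l. i + l) ` {0..d - j}"
        have "\<not> (i \<le> e \<and> j - i \<le> d - e)"
        proof
          assume "i \<le> e \<and> j - i \<le> d - e"
          then have "e = i + (e - i)" "e - i \<in> {0..d - j}" using i e by auto
          then show False using e by blast
        qed
        then show "homog F $ e $ i * homog G $ (d - e) $ (j - i) = 0"
          by (auto simp: homog_nth)
      qed (use i True in auto)
      also have "\<dots> = (\<Sum>l=0..d - j. homog F $ (i + l) $ i * homog G $ (d - (i + l)) $ (j - i))"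
        by (subst sum.reindex) (simp_all add: o_def)
      also have "\<dots> = (\<Sum>l=0..d - j. F $ i $ l * G $ (j - i) $ (d - j - l))"
      proof (intro sum.cong refl)
        fix l assume "l \<in> {0..d - j}"
        then have "j - i \<le> d - (i + l)" "d - (i + l) - (j - i) = d - j - l" using i True by auto
        then show "homog F $ (i + l) $ i * homog G $ (d - (i + l)) $ (j - i) =
          F $ i $ l * G $ (j - i) $ (d - j - l)"
          by (simp add: homog_nth)
      qed
      finally show ?thesis .
    qed
    then show ?thesis using True by (simp add: homog_nth fps_mult_nth fps_sum_nth)
  next
    case False
    have "homog F $ e $ i * homog G $ (d - e) $ (j - i) = 0" if "i \<in> {0..j}" "e \<in> {0..d}" for i e
      using that False by (auto simp: homog_nth)
    then show ?thesis using False by (simp add: homog_nth)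
  qed
  finally show "homog (F * G) $ d $ j = (homog F * homog G) $ d $ j" ..
qed

lemma homog_1: "homog 1 = 1"
  by (intro fps_ext) (auto simp: homog_nth)

lemma homog_power: "homog (F ^ k) = homog F ^ k"
  by (induction k) (simp_all add: homog_1 homog_mult)

text \<open>The cut-off \<open>k \<le> i + j\<close> in \<open>fps2_subst\<close> is the total
  degree \<open>d\<close>, exactly the cut-off in composition of series in \<open>t\<close>.\<close>

lemma homog_subst: "homog (fps2_subst g h) = fps_lift g oo homog h"
proof (intro fps_ext)
  fix d j
  have "(fps_lift g oo homog h) $ d $ j = (\<Sum>k=0..d. g $ k * homog (h ^ k) $ d $ j)"
    by (simp add: fps_compose_nth fps_sum_nth homog_power)
  also have "\<dots> = homog (fps2_subst g h) $ d $ j"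
    by (simp add: homog_nth fps2_subst_def)
  finally show "homog (fps2_subst g h) $ d $ j = (fps_lift g oo homog h) $ d $ j" ..
qed

text \<open>This is f(t) + f(t s), the image of f(x) + f(y) under \<open>homog\<close>.\<close>

definition homog_log_sum :: "'a::comm_ring_1 fps \<Rightarrow> 'a fps fps" where
  "homog_log_sum f = Abs_fps (\<lambda>n. fps_const (f $ n) * (1 + fps_X ^ n))"

lemma homog_log_sum_eq:
  "homog (fps2_subst f fps2_X + fps2_subst f fps2_Y) = homog_log_sum f"
  unfolding fps2_subst_X fps2_subst_Y homog_add
  by (intro fps_ext) (auto simp: homog_nth homog_log_sum_def fps_X_power_nth)

lemma fps_lift_compose_homog_fgl:
  "fps_lift (flog \<gamma>) oo homog (fgl \<gamma>) = homog_log_sum (flog \<gamma>)"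
proof -
  let ?f = "flog \<gamma>"
  have H0: "homog_log_sum ?f $ 0 = 0" by (simp add: homog_log_sum_def flog_0)
  have "fps_lift ?f oo homog (fgl \<gamma>) = fps_lift ?f oo (fps_lift (fps_inv ?f) oo homog_log_sum ?f)"
    unfolding fgl_def homog_subst homog_log_sum_eq ..
  also have "\<dots> = fps_lift (?f oo fps_inv ?f) oo homog_log_sum ?f"
    unfolding fps_lift_compose by (rule fps_compose_assoc[OF H0]) (simp add: fps_inv_def)
  also have "?f oo fps_inv ?f = fps_X"
    using flog_0 flog_1 by (intro fps_inv_right) auto
  also have "fps_lift fps_X = (fps_X :: rat fps fps)"
    by (intro fps_ext) auto
  finally show ?thesis using H0 by simp
qed

lemma homog_fgl_0: "homog (fgl \<gamma>) $ 0 = 0"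
proof -
  have "homog (fgl \<gamma>) $ 0 = fps_lift (fps_inv (flog \<gamma>)) $ 0"
    unfolding fgl_def homog_subst by simp
  then show ?thesis by (simp add: fps_inv_def)
qed

lemma p_integral_iff_homog:
  assumes "prime p"
  shows "p_integral p F \<longleftrightarrow> (\<forall>n. homog F $ n \<in> fps_set (Z_localized p))"
proof
  assume "p_integral p F"
  then show "\<forall>n. homog F $ n \<in> fps_set (Z_localized p)"
    using subring_0[OF subring_set_Z_localized[OF assms]]
    by (auto simp: p_integral_def fps_set_def homog_nth)
next
  assume *: "\<forall>n. homog F $ n \<in> fps_set (Z_localized p)"
  have "F $ j $ i = homog F $ (i + j) $ j" for i j by (simp add: homog_nth)
  then show "p_integral p F" using * unfolding p_integral_def fps_set_def by (metis mem_Collect_eq)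
qed

lemma fps_const_mult_in_fps_set:
  "subring_set S \<Longrightarrow> c \<in> S \<Longrightarrow> a \<in> fps_set S \<Longrightarrow> fps_const c * a \<in> fps_set S"
  by (auto simp: fps_set_def subring_mult)

text \<open>The denominator of \<open>f\<close> is compensated by the powers of \<open>p\<close> gained in \<open>A ^ m - B ^ m\<close>.\<close>

lemma scong_log_term:
  assumes p: "prime p" and m: "m > 0" "of_nat m * f \<in> Z_localized p"
    and AB: "scong (fps_set (fps_set (Z_localized p))) p A B"
    "A \<in> fps_set (fps_set (Z_localized p))" "B \<in> fps_set (fps_set (Z_localized p))"
  shows "scong (fps_set (Z_localized p)) p (fps_const f * (A ^ m) $ n) (fps_const f * (B ^ m) $ n)"
proof -
  note S0 = subring_set_Z_localized[OF p]
  note S1 = subring_set_fps_set[OF S0]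
  note S2 = subring_set_fps_set[OF S1]
  obtain k m' where k: "m = p ^ k * m'" "\<not> p dvd m'"
    using multiplicity_decompose'[of m p] m(1) p by (metis neq0_conv not_prime_unit)
  have m': "m' \<noteq> 0" using k by (metis dvd_0_right)
  have "scong (fps_set (fps_set (Z_localized p))) (p ^ Suc k) ((A ^ p ^ k) ^ m') ((B ^ p ^ k) ^ m')"
    by (intro scong_power[OF S2] scong_pow_prime_power[OF S2] AB subring_power[OF S2])
  then have "scong (fps_set (Z_localized p)) (p ^ Suc k) ((A ^ m) $ n) ((B ^ m) $ n)"
    unfolding scong_fps_set_iff[of "fps_set (Z_localized p)"] k(1) power_mult by blast
  then obtain D where D: "D \<in> fps_set (Z_localized p)" "(A ^ m) $ n = (B ^ m) $ n + of_nat (p ^ Suc k) * D"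
    unfolding scong_def by blast
  have "f * of_nat (p ^ Suc k) = of_nat p * (of_nat m * f / of_nat m')"
    using m' by (simp add: k(1))
  then have "fps_const f * (A ^ m) $ n = fps_const f * (B ^ m) $ n +
      of_nat p * (fps_const (of_nat m * f / of_nat m') * D)"
    unfolding D(2) by (simp add: distrib_left fps_of_nat[symmetric] flip: mult.assoc)
  moreover have "fps_const (of_nat m * f / of_nat m') * D \<in> fps_set (Z_localized p)"
    using Z_localized_divide_of_nat[OF p k(2) m(2)] D(1) by (intro fps_const_mult_in_fps_set[OF S0])
  ultimately show ?thesis unfolding scong_def by blast
qed

text \<open>Hazewinkel's lemma up to degree \<open>D\<close>, with g(x) = f(x) - c f(x^q). The
  congruence of \<open>P ^ q\<close> with its Frobenius twist makes f(P^q) congruent to f(x^q) +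
  f(y^q) modulo \<open>p\<close>; as \<open>c * p\<close> is integral, g(P) is integral. Since
  \<open>g\<close> has linear coefficient 1, \<open>P $ n\<close> is then determined by integral
  data of lower degree. The bound \<open>D\<close> allows \<open>c\<close> to depend on the range of
  degrees.\<close>

lemma functional_equation_integral:
  fixes f :: "rat fps" and P :: "rat fps fps"
  assumes p: "prime p" and r: "r > 0" and f0: "f $ 0 = 0" and f1: "f $ 1 = 1"
    and f: "\<And>m. m > 0 \<Longrightarrow> of_nat m * f $ m \<in> Z_localized p"
    and c: "c * of_nat p \<in> Z_localized p"
    and g: "\<And>n. n \<le> D \<Longrightarrow> f $ n - c * (if p ^ r dvd n then f $ (n div p ^ r) else 0) \<in> Z_localized p"
    and P0: "P $ 0 = 0" and P: "fps_lift f oo P = homog_log_sum f" and n: "n \<le> D"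
  shows "P $ n \<in> fps_set (Z_localized p)"
  using n
proof (induction n rule: less_induct)
  case (less n)
  note S0 = subring_set_Z_localized[OF p]
  note S1 = subring_set_fps_set[OF S0]
  note S2 = subring_set_fps_set[OF S1]
  let ?S1 = "fps_set (Z_localized p)"
  define q where "q = p ^ r"
  have q: "q \<ge> 2" unfolding q_def using r prime_ge_2_nat[OF p]
    by (metis One_nat_def Suc_leI order_trans power_increasing power_one_right prime_ge_1_nat[OF p])
  \<comment> \<open>\<open>\<phi>1\<close> replaces \<open>s\<close> by \<open>s^q\<close>, and
    \<open>\<phi>2\<close> also replaces \<open>t\<close> by \<open>t^q\<close>; so f(t) + f(t s)
    becomes f(t^q) + f(t^q s^q).\<close>
  define \<phi>1 where "\<phi>1 = fps_frob q (\<lambda>a::rat. a)"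
  define \<phi>2 where "\<phi>2 = fps_frob q \<phi>1"
  have hom1: "ring_hom_fun \<phi>1"
    unfolding \<phi>1_def using q by (intro ring_hom_fps_frob) (auto simp: ring_hom_fun_def)
  have \<phi>1_const: "\<phi>1 (fps_const a) = fps_const a" for a
    using q by (auto simp: \<phi>1_def fps_eq_iff fps_frob_nth elim!: dvdE)
  have frob1: "scong ?S1 p (a ^ p ^ r) (\<phi>1 a)" if "a \<in> ?S1" for a
    unfolding \<phi>1_def q_def using that scong_Z_localized_fermat[OF p]
    by (intro scong_fps_frob[OF S0 p r])
  have \<phi>1_in: "\<phi>1 a \<in> ?S1" if "a \<in> ?S1" for a
    using that subring_0[OF S0] by (auto simp: \<phi>1_def fps_frob_nth fps_set_def)
  define g where "g = Abs_fps (\<lambda>n. f $ n - c * (if q dvd n then f $ (n div q) else 0))"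
  have gZ: "g $ m \<in> Z_localized p" if "m \<le> D" for m
    using assms(7)[OF that] by (simp only: g_def q_def fps_nth_Abs_fps)
  have g0: "g $ 0 = 0" and g1: "g $ 1 = 1" using f0 f1 q by (auto simp: g_def)
  show ?case
  proof (cases "n = 0")
    case True
    then show ?thesis using P0 subring_0[OF S1] by simp
  next
    case False
    \<comment> \<open>Only coefficients below \<open>n\<close> are known to be integral, so
      \<open>P\<close> is truncated there before congruences are applied; coefficient
      \<open>n\<close> of its powers from the second on is unaffected.\<close>
    define P' where "P' = fps_cutoff n P"
    have P'S: "P' \<in> fps_set ?S1"
      using less subring_0[OF S1] by (auto simp: P'_def fps_set_def)
    have Xq: "(fps_lift f oo fps_X ^ q) $ m = fps_const (if q dvd m then f $ (m div q) else 0)" for m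
    proof -
      have "(fps_lift f oo fps_X ^ q) $ m = (\<Sum>i=0..m. if m = q * i then fps_const (f $ i) else 0)"
        by (auto simp: fps_compose_nth power_mult[symmetric] fps_X_power_nth intro!: sum.cong)
      also have "\<dots> = fps_const (if q dvd m then f $ (m div q) else 0)"
      proof (cases "q dvd m")
        case True
        then obtain k where k: "m = q * k" by blast
        then have "(\<Sum>i=0..m. if m = q * i then fps_const (f $ i) else 0) =
            (\<Sum>i=0..m. if k = i then fps_const (f $ i) else 0)"
          using q by (intro sum.cong) auto
        then show ?thesis using k q by simp
      qed (auto intro!: sum.neutral)
      finally show ?thesis .
    qed
    have "fps_lift g = fps_lift f - fps_const (fps_const c) * (fps_lift f oo fps_X ^ q)"
      by (rule fps_ext) (simp add: g_def Xq)
    then have "fps_lift g oo P = homog_log_sum f - fps_const (fps_const c) * (fps_lift f oo fps_X ^ q oo P)"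
      using P by (simp add: fps_compose_sub_distrib fps_compose_mult_distrib[OF P0])
    also have "fps_lift f oo fps_X ^ q oo P = fps_lift f oo (fps_X ^ q oo P)"
      using q by (intro fps_compose_assoc[symmetric] P0) simp
    also have "fps_X ^ q oo P = P ^ q"
      using fps_compose_power[OF P0, of fps_X q] P0 by (simp only: fps_X_fps_compose_startby0)
    finally have gP: "fps_lift g oo P = homog_log_sum f - fps_const (fps_const c) * (fps_lift f oo P ^ q)" .
    have "(fps_lift f oo P ^ q) $ n = (fps_lift f oo P' ^ q) $ n"
      unfolding P'_def by (intro fps_compose_nth_cong fps_power_cutoff_nth[symmetric] P0 q)
    also have "scong ?S1 p \<dots> ((fps_lift f oo \<phi>2 P') $ n)"
      unfolding fps_compose_nth
    proof (intro scong_sum[OF S1])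
      fix m
      show "scong ?S1 p (fps_lift f $ m * ((P' ^ q) ^ m) $ n) (fps_lift f $ m * (\<phi>2 P' ^ m) $ n)"
      proof (cases "m = 0")
        case True
        then show ?thesis using f0 scong_refl[OF S1] by simp
      next
        case False
        have "scong (fps_set ?S1) p (P' ^ q) (\<phi>2 P')"
          unfolding \<phi>2_def q_def by (rule scong_fps_frob[OF S1 p r frob1 P'S])
        moreover have "\<phi>2 P' \<in> fps_set ?S1"
          using P'S \<phi>1_in subring_0[OF S1] by (auto simp: \<phi>2_def fps_frob_nth fps_set_def[of ?S1])
        ultimately show ?thesis
          using False P'S f[of m] subring_power[OF S2] by (auto intro!: scong_log_term[OF p])
      qed
    qed
    also have "(fps_lift f oo \<phi>2 P') $ n = (fps_lift f oo \<phi>2 P) $ n"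
    proof (rule fps_compose_nth_cong)
      fix i assume "i \<le> n"
      then have "i div q < n" using False q by (cases "i = 0") (auto intro: less_le_trans[OF div_less_dividend])
      then show "\<phi>2 P' $ i = \<phi>2 P $ i" by (simp add: \<phi>2_def fps_frob_nth P'_def)
    qed
    also have "fps_lift f oo \<phi>2 P = \<phi>2 (homog_log_sum f)"
      unfolding \<phi>2_def P[symmetric] using q
      by (intro fps_frob_compose[symmetric] hom1 P0) (auto simp: \<phi>1_const)
    finally have sc: "scong ?S1 p ((fps_lift f oo P ^ q) $ n) (\<phi>2 (homog_log_sum f) $ n)" .
    then obtain d where d: "d \<in> ?S1"
      "(fps_lift f oo P ^ q) $ n = \<phi>2 (homog_log_sum f) $ n + of_nat p * d"
      unfolding scong_def by blast
    have \<phi>2H: "\<phi>2 (homog_log_sum f) $ n = fps_const (if q dvd n then f $ (n div q) else 0) * (1 + fps_X ^ n)"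
    proof (cases "q dvd n")
      case True
      then obtain k where k: "n = q * k" by blast
      have "\<phi>1 (fps_X) = fps_X ^ q"
        using q by (auto simp: \<phi>1_def fps_eq_iff fps_frob_nth fps_X_power_nth elim!: dvdE)
      then show ?thesis using q
        by (simp add: \<phi>2_def fps_frob_nth homog_log_sum_def k ring_hom_fun_mult[OF hom1] \<phi>1_const
            ring_hom_fun_add[OF hom1] ring_hom_fun_1[OF hom1] ring_hom_fun_power[OF hom1] power_mult)
    qed (simp add: \<phi>2_def fps_frob_nth)
    define u where "u = (if q dvd n then f $ (n div q) else 0)"
    have "(fps_lift g oo P) $ n =
        fps_const (f $ n) * (1 + fps_X ^ n) - fps_const c * (fps_const u * (1 + fps_X ^ n) + of_nat p * d)"
      unfolding gP fps_sub_nth fps_mult_left_const_nth d(2) \<phi>2H u_def[symmetric]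
      by (simp add: homog_log_sum_def)
    also have "\<dots> = fps_const (f $ n - c * u) * (1 + fps_X ^ n) - fps_const (c * of_nat p) * d"
      by (simp add: fps_of_nat[symmetric] algebra_simps flip: fps_const_sub fps_const_mult)
    also have "f $ n - c * u = g $ n" by (simp add: g_def u_def)
    finally have "(fps_lift g oo P) $ n = fps_const (g $ n) * (1 + fps_X ^ n) - fps_const (c * of_nat p) * d" .
    moreover have "\<dots> \<in> ?S1"
      using gZ[OF less.prems] c d(1)
      by (intro subring_diff[OF S1] fps_const_mult_in_fps_set[OF S0] subring_add[OF S1] subring_1[OF S1]
          subring_power[OF S1]) (auto simp: fps_set_def fps_X_def intro: subring_0[OF S0] subring_1[OF S0])
    \<comment> \<open>The linear term is the unknown \<open>P $ n\<close>; all other terms involve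
      only the truncation.\<close>
    moreover have "(fps_lift g oo P) $ n = P $ n + (\<Sum>m=2..n. fps_const (g $ m) * (P' ^ m) $ n)"
    proof -
      have "{0..n} = insert 0 (insert 1 {2..n})" using False by auto
      then have "(fps_lift g oo P) $ n = P $ n + (\<Sum>m=2..n. fps_const (g $ m) * (P ^ m) $ n)"
        using g0 g1 by (simp add: fps_compose_nth)
      moreover have "(P ^ m) $ n = (P' ^ m) $ n" if "m \<in> {2..n}" for m
        unfolding P'_def using that by (intro fps_power_cutoff_nth[symmetric] P0) auto
      ultimately show ?thesis by simp
    qed
    moreover have "(\<Sum>m=2..n. fps_const (g $ m) * (P' ^ m) $ n) \<in> ?S1"
      using gZ less.prems fps_setD[OF subring_power[OF S2 P'S]]
      by (intro subring_sum[OF S1] fps_const_mult_in_fps_set[OF S0]) auto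
    ultimately show ?thesis
      using subring_diff[OF S1] by (metis add_diff_cancel_right')
  qed
qed

section \<open>Denominators of the logarithm of an integral group law\<close>

lemma one_plus_fps_X_power_nth: "((1 + fps_X) ^ n :: 'a::comm_ring_1 fps) $ k = of_nat (n choose k)"
proof -
  have "((1 + fps_X) ^ n :: 'a fps) $ k = (\<Sum>i\<le>n. if i = k then of_nat (n choose k) else 0)"
    unfolding add.commute[of 1] binomial_ring fps_sum_nth
    by (intro sum.cong refl) (simp add: fps_of_nat[symmetric] fps_X_power_nth)
  also have "\<dots> = of_nat (n choose k)" by (simp add: binomial_eq_0)
  finally show ?thesis .
qed

text \<open>Only indices \<open>n = i * p\<close> are critical. The coefficient of
  \<open>t^n s^p\<close> is 0 in f(x) + f(y) for \<open>i \<ge> 2\<close>; in f(P) it is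
  \<open>f $ n * (n choose p)\<close> plus terms in lower coefficients of \<open>f\<close>, and the
  binomial coefficient is a unit. The index \<open>p\<close> itself is covered by
  \<open>f $ p = 0\<close>.\<close>

lemma log_coeff_integral_below_prime_square:
  fixes f :: "rat fps" and P :: "rat fps fps"
  assumes p: "prime p" and f0: "f $ 0 = 0" and f1: "f $ 1 = 1" and fp: "f $ p = 0"
    and f: "\<And>m. m > 0 \<Longrightarrow> of_nat m * f $ m \<in> Z_localized p"
    and P0: "P $ 0 = 0" and P: "fps_lift f oo P = homog_log_sum f"
    and PS: "\<And>n. P $ n \<in> fps_set (Z_localized p)"
    and binom: "\<And>i. 2 \<le> i \<Longrightarrow> i < p \<Longrightarrow> \<not> p dvd (i * p choose p)" and n: "n < p * p"
  shows "f $ n \<in> Z_localized p"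
  using n
proof (induction n rule: less_induct)
  case (less n)
  note S0 = subring_set_Z_localized[OF p]
  note S1 = subring_set_fps_set[OF S0]
  note S2 = subring_set_fps_set[OF S1]
  show ?case
  proof (cases "p dvd n")
    case False
    then have "n > 0" by (auto intro: Nat.gr0I)
    then show ?thesis using Z_localized_divide_of_nat[OF p False f[of n]] by simp
  next
    case True
    then obtain i where i: "n = i * p" by (metis dvdE mult.commute)
    have ip: "i < p" using less.prems i by simp
    consider "i = 0" | "i = 1" | "i \<ge> 2" by linarith
    then show ?thesis
    proof cases
      case 1
      then show ?thesis using i f0 subring_0[OF S0] by simp
    next
      case 2
      then show ?thesis using i fp subring_0[OF S0] by simp
    next
      case 3
      have pn: "0 < p" "p < n" using 3 i prime_gt_0_nat[OF p] by auto
      have "(fps_lift f oo P) $ 1 = homog_log_sum f $ 1" using P by simp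
      then have P1: "P $ 1 = 1 + fps_X"
        using f0 f1 by (simp add: fps_compose_nth homog_log_sum_def)
      have "0 = homog_log_sum f $ n $ p"
        using pn by (simp add: homog_log_sum_def fps_X_power_nth)
      also have "\<dots> = (\<Sum>m=0..n. f $ m * (P ^ m) $ n $ p)"
        unfolding P[symmetric] by (simp add: fps_compose_nth fps_sum_nth)
      also have "{0..n} = insert n {0..<n}" by auto
      also have "(\<Sum>m\<in>insert n {0..<n}. f $ m * (P ^ m) $ n $ p) =
          f $ n * of_nat (n choose p) + (\<Sum>m=0..<n. f $ m * (P ^ m) $ n $ p)"
        using startsby_zero_power_nth_same[OF P0, of n]
        by (simp add: P1[unfolded One_nat_def] one_plus_fps_X_power_nth)
      finally have "f $ n * of_nat (n choose p) = - (\<Sum>m=0..<n. f $ m * (P ^ m) $ n $ p)"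
        by (simp add: eq_neg_iff_add_eq_0)
      also have "\<dots> \<in> Z_localized p"
      proof (intro subring_uminus[OF S0] subring_sum[OF S0] subring_mult[OF S0])
        fix m assume "m \<in> {0..<n}"
        then show "f $ m \<in> Z_localized p" using less by auto
        have "P \<in> fps_set (fps_set (Z_localized p))" using PS by (simp add: fps_set_def)
        then show "(P ^ m) $ n $ p \<in> Z_localized p"
          by (intro fps_setD subring_power[OF S2])
      qed
      finally have "f $ n * of_nat (n choose p) / of_nat (n choose p) \<in> Z_localized p"
        using binom[OF 3 ip] by (intro Z_localized_divide_of_nat[OF p]) (auto simp: i)
      moreover have "n choose p \<noteq> 0" using pn by simp
      ultimately show ?thesis by simp
    qed
  qed
qed

section \<open>The numbers \<open>u_n\<close> and the Landau function\<close>

text \<open>Up to sign, \<open>coprime_fact p k\<close> is the value of the \<open>p\<close>-adic gamma function at \<open>k + 1\<close>.\<close>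

definition coprime_fact :: "nat \<Rightarrow> nat \<Rightarrow> nat" where
  "coprime_fact p k = \<Prod>{j \<in> {1..k}. \<not> p dvd j}"

lemma coprime_fact_0: "coprime_fact p 0 = 1"
  by (simp add: coprime_fact_def)

lemma coprime_fact_Suc: "coprime_fact p (Suc k) = coprime_fact p k * (if p dvd Suc k then 1 else Suc k)"
proof -
  have "{j \<in> {1..Suc k}. \<not> p dvd j} =
      (if p dvd Suc k then {j \<in> {1..k}. \<not> p dvd j} else insert (Suc k) {j \<in> {1..k}. \<not> p dvd j})"
    by (auto simp: le_Suc_eq)
  then show ?thesis by (simp add: coprime_fact_def mult.commute)
qed

lemma not_dvd_coprime_fact: "prime p \<Longrightarrow> \<not> p dvd coprime_fact p k"
  by (induction k) (auto simp: coprime_fact_0 coprime_fact_Suc prime_dvd_mult_iff simp del: dvd_mult_cancel1 dvd_mult_cancel2)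

lemma fact_eq_coprime_fact:
  assumes "p > 0"
  shows "fact k = coprime_fact p k * p ^ (k div p) * (fact (k div p) :: nat)"
proof (induction k)
  case 0
  show ?case by (simp add: coprime_fact_0)
next
  case (Suc k)
  show ?case
  proof (cases "p dvd Suc k")
    case True
    then have "Suc k div p = Suc (k div p)"
      using assms by (simp add: div_Suc dvd_eq_mod_eq_0)
    moreover have "Suc k = p * Suc (k div p)" using True calculation by (metis dvd_mult_div_cancel)
    ultimately have "fact (Suc k) = (p * Suc (k div p)) * (coprime_fact p k * p ^ (k div p) * (fact (k div p) :: nat))"
      using Suc by (metis fact_Suc of_nat_id)
    also have "\<dots> = coprime_fact p (Suc k) * p ^ Suc (k div p) * fact (Suc (k div p))"
      using True by (simp add: coprime_fact_Suc mult_ac del: mult_Suc_right)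
    finally show ?thesis using \<open>Suc k div p = Suc (k div p)\<close> by simp
  next
    case False
    then have "Suc k div p = k div p" by (simp add: div_Suc dvd_eq_mod_eq_0)
    then show ?thesis using Suc False by (simp add: coprime_fact_Suc algebra_simps)
  qed
qed

lemma fact_eq_coprime_fact_iterated:
  assumes "p > 0"
  shows "fact k = (\<Prod>j<J. coprime_fact p (k div p ^ j)) * p ^ (\<Sum>j=1..J. k div p ^ j) * (fact (k div p ^ J) :: nat)"
proof (induction J)
  case (Suc J)
  have "k div p ^ Suc J = k div p ^ J div p" by (simp only: power_Suc2 div_mult2_eq)
  then have "fact (k div p ^ J) = coprime_fact p (k div p ^ J) * p ^ (k div p ^ Suc J) * (fact (k div p ^ Suc J) :: nat)"
    using fact_eq_coprime_fact[OF assms, of "k div p ^ J"] by simp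
  then show ?case using Suc by (simp add: power_add mult_ac del: power_Suc)
qed simp

text \<open>After the multiples of \<open>p\<close> are stripped from the three factorials, the
  powers of \<open>p\<close> cancel, as \<open>i = 1 + (i - 1)\<close>; the factors left on the
  right are prime to \<open>p\<close>, including \<open>fact i\<close> because
  \<open>i < p\<close>.\<close>

lemma not_prime_dvd_mult_choose:
  assumes p: "prime p" and i: "0 < i" "i < p"
  shows "\<not> p dvd (i * p choose p)"
proof
  assume d: "p dvd (i * p choose p)"
  have p0: "p > 0" using p prime_gt_0_nat by blast
  obtain l where l: "i = Suc l" using i by (cases i) auto
  have "p \<le> i * p" using i by simp
  then have "(i * p choose p) * (fact p * fact (i * p - p)) = (fact (i * p) :: nat)"
    using binomial_fact_lemma[of p "i * p"] by (simp add: mult_ac)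
  also have "i * p - p = l * p" by (simp add: l)
  finally have eq: "(i * p choose p) * (fact p * fact (l * p)) = (fact (i * p) :: nat)" .
  have f: "fact (j * p) = coprime_fact p (j * p) * p ^ j * (fact j :: nat)" for j
    using fact_eq_coprime_fact[OF p0, of "j * p"] p0 by simp
  have fp: "fact p = coprime_fact p p * p" using fact_eq_coprime_fact[OF p0, of p] p0 by simp
  have "p ^ i * ((i * p choose p) * (coprime_fact p p * coprime_fact p (l * p) * fact l)) = p ^ i * (coprime_fact p (i * p) * fact i)"
    using eq unfolding f fp by (simp add: l mult_ac)
  then have "(i * p choose p) * (coprime_fact p p * coprime_fact p (l * p) * fact l) = coprime_fact p (i * p) * fact i"
    using p0 by simp
  then have "p dvd coprime_fact p (i * p) * fact i" using d by (metis dvd_mult2)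
  then show False
    using p i not_dvd_coprime_fact[OF p] by (auto simp: prime_dvd_mult_iff prime_dvd_fact_iff)
qed

text \<open>A shift by \<open>P\<close> keeps residues modulo \<open>P\<close> and divisibility by
  \<open>p\<close>, so every block of length \<open>P\<close> contributes the same factor. Its value
  need not be known, as it cancels later.\<close>

lemma coprime_fact_add_cong:
  assumes P: "p dvd P"
  shows "[coprime_fact p (k + c * P) = coprime_fact p P ^ c * coprime_fact p k] (mod P)"
proof (induction c)
  case (Suc c)
  have step: "[coprime_fact p (k + P) = coprime_fact p P * coprime_fact p k] (mod P)" for k
  proof (induction k)
    case (Suc k)
    have d: "p dvd Suc (k + P) \<longleftrightarrow> p dvd Suc k" using P by (metis add_Suc dvd_add_left_iff)
    have "[coprime_fact p (k + P) * (if p dvd Suc k then 1 else Suc (k + P)) =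
        (coprime_fact p P * coprime_fact p k) * (if p dvd Suc k then 1 else Suc k)] (mod P)"
      by (rule cong_mult[OF Suc]) (auto simp: cong_def simp flip: add_Suc)
    then show ?case by (simp add: coprime_fact_Suc d mult.assoc)
  qed (simp add: coprime_fact_0)
  have "[coprime_fact p (k + c * P + P) = coprime_fact p P * coprime_fact p (k + c * P)] (mod P)" by (rule step)
  also have "[coprime_fact p P * coprime_fact p (k + c * P) = coprime_fact p P * (coprime_fact p P ^ c * coprime_fact p k)] (mod P)"
    by (rule cong_scalar_left[OF Suc])
  finally show ?case by (simp add: ac_simps)
qed simp

definition Z_units :: "nat \<Rightarrow> rat set" where
  "Z_units p = {x. x \<noteq> 0 \<and> x \<in> Z_localized p \<and> inverse x \<in> Z_localized p}"

context
  fixes p :: nat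
  assumes p: "prime p"
begin

lemma Z_units_of_nat: "\<not> p dvd a \<Longrightarrow> of_nat a \<in> Z_units p"
  using Z_localized_divide_of_nat[OF p, of a 1] Z_localized_of_nat[OF p, of a] Z_localized_of_nat[OF p, of 1]
  by (auto simp: Z_units_def inverse_eq_divide intro: Nat.gr0I)

lemma Z_units_mult: "x \<in> Z_units p \<Longrightarrow> y \<in> Z_units p \<Longrightarrow> x * y \<in> Z_units p"
  by (simp add: Z_units_def Z_localized_mult[OF p])

lemma Z_units_1: "1 \<in> Z_units p"
  using Z_localized_of_nat[OF p, of 1] by (simp add: Z_units_def)

lemma Z_units_prod: "(\<And>i. i \<in> I \<Longrightarrow> f i \<in> Z_units p) \<Longrightarrow> prod f I \<in> Z_units p"
  by (induction I rule: infinite_finite_induct) (auto intro: Z_units_1 Z_units_mult)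

lemma Z_units_power: "x \<in> Z_units p \<Longrightarrow> x ^ n \<in> Z_units p"
  by (induction n) (auto intro: Z_units_1 Z_units_mult)

lemma Z_units_inverse: "x \<in> Z_units p \<Longrightarrow> inverse x \<in> Z_units p"
  by (simp add: Z_units_def)

lemma Z_units_power_int: "x \<in> Z_units p \<Longrightarrow> x powi k \<in> Z_units p"
  by (simp add: power_int_def Z_units_power Z_units_inverse)

lemma Z_unitsD: "x \<in> Z_units p \<Longrightarrow> x \<in> Z_localized p" "x \<in> Z_units p \<Longrightarrow> x \<noteq> 0"
  by (simp_all add: Z_units_def)

lemma scong_units_power_int:
  assumes xy: "x \<in> Z_units p" "y \<in> Z_units p" and c: "scong (Z_localized p) c x y"
  shows "scong (Z_localized p) c (x powi k) (y powi k)"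
proof -
  note S = subring_set_Z_localized[OF p]
  have "scong (Z_localized p) c (inverse x) (inverse y)"
  proof -
    have "scong (Z_localized p) c (y * (inverse x * inverse y)) (x * (inverse x * inverse y))"
      using xy c by (intro scong_mult[OF S scong_sym[OF S c] scong_refl[OF S]])
        (auto intro: Z_unitsD Z_units_inverse Z_units_mult)
    then show ?thesis using xy by (simp add: Z_units_def field_simps)
  qed
  then show ?thesis
    unfolding power_int_def using xy c
    by (auto intro: scong_power[OF S] Z_unitsD Z_units_inverse)
qed

lemma scong_units_prod:
  assumes "\<And>i. i \<in> I \<Longrightarrow> f i \<in> Z_units p \<and> g i \<in> Z_units p \<and> scong (Z_localized p) c (f i) (g i)"
  shows "scong (Z_localized p) c (prod f I) (prod g I)"
  using assms
proof (induction I rule: infinite_finite_induct)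
  case (insert i I)
  then have "scong (Z_localized p) c (f i * prod f I) (g i * prod g I)"
    by (intro scong_mult[OF subring_set_Z_localized[OF p]]) (auto intro!: Z_unitsD(1) Z_units_prod)
  then show ?case using insert by simp
qed (simp_all add: scong_refl[OF subring_set_Z_localized[OF p]])

lemma scong_of_cong:
  assumes "[a = b] (mod c * d)"
  shows "scong (Z_localized p) c (of_nat a) (of_nat b)"
proof -
  have "[int b = int a] (mod int (c * d))" using cong_sym[OF assms] by (simp only: cong_int_iff)
  then obtain k where "int a = int b + int c * int d * k"
    by (auto simp: cong_iff_lin)
  then have "(of_int (int a) :: rat) = of_int (int b + int c * int d * k)" by (simp only:)
  then have "(of_nat a :: rat) = of_nat b + of_nat c * of_int (int d * k)" by (simp add: mult.assoc)
  then show ?thesis unfolding scong_def using Z_localized_of_int[OF p] by blast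
qed

lemma power_int_p_in: "k \<ge> 0 \<Longrightarrow> of_nat p powi k \<in> Z_localized p"
  using Z_localized_of_nat[OF p, of "p ^ nat k"] by (simp add: power_int_def)

end

lemma power_int_sum:
  fixes x :: "'a::field"
  assumes "x \<noteq> 0"
  shows "x powi (sum f I) = (\<Prod>i\<in>I. x powi (f i))"
  by (induction I rule: infinite_finite_induct) (simp_all add: assms power_int_add)

section \<open>The Landau function and the \<open>p\<close>-adic valuation of
  \<open>u_n\<close>\<close>

lemma landau_divide_nat:
  "landau \<gamma> (real a / real b) = (\<Sum>\<nu>\<in>gsupp \<gamma>. \<gamma> \<nu> * int (\<nu> * a div b))"
  unfolding landau_def
  by (intro sum.cong refl) (metis floor_divide_of_nat_eq of_nat_mult times_divide_eq_right)

text \<open>Balance makes the Landau function periodic: a shift by \<open>k\<close> adds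
  \<open>\<nu> * k\<close> to each floor, with total weight 0.\<close>

lemma landau_add_nat:
  assumes "(\<Sum>\<nu>\<in>gsupp \<gamma>. int \<nu> * \<gamma> \<nu>) = 0"
  shows "landau \<gamma> (t + real k) = landau \<gamma> t"
proof -
  have "landau \<gamma> (t + real k) = (\<Sum>\<nu>\<in>gsupp \<gamma>. \<gamma> \<nu> * \<lfloor>real \<nu> * t\<rfloor> + int k * (int \<nu> * \<gamma> \<nu>))"
    unfolding landau_def
  proof (intro sum.cong refl)
    fix \<nu>
    have "real \<nu> * (t + real k) = real \<nu> * t + of_int (int (\<nu> * k))" by (simp add: algebra_simps)
    then have "\<lfloor>real \<nu> * (t + real k)\<rfloor> = \<lfloor>real \<nu> * t\<rfloor> + int (\<nu> * k)" by (simp only: floor_add_int)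
    then show "\<gamma> \<nu> * \<lfloor>real \<nu> * (t + real k)\<rfloor> = \<gamma> \<nu> * \<lfloor>real \<nu> * t\<rfloor> + int k * (int \<nu> * \<gamma> \<nu>)"
      by (simp add: algebra_simps)
  qed
  also have "\<dots> = landau \<gamma> t" using assms by (simp add: sum.distrib landau_def flip: sum_distrib_left)
  finally show ?thesis .
qed

lemma gsupp_dvd_glcm: "\<nu> \<in> gsupp \<gamma> \<Longrightarrow> \<nu> dvd glcm \<gamma>"
  by (simp add: glcm_def)

text \<open>With \<open>N = \<nu> * d\<close>, the left side is the floor of
  \<open>(M - 1/P) / d\<close>; an integer multiple of \<open>d\<close> is at most
  \<open>M - 1/P\<close> exactly if it is at most \<open>M - 1\<close>.\<close>

lemma mult_div_eq_of_dvd: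
  fixes N n P M \<nu> :: nat
  assumes \<nu>: "\<nu> dvd N" and N: "N > 0" and eq: "N * n + 1 = P * M"
  shows "\<nu> * n div P = \<nu> * (M - 1) div N"
proof -
  obtain d where d: "N = \<nu> * d" using \<nu> by blast
  have pos: "\<nu> > 0" "d > 0" "P > 0" "M > 0" using N eq d by (auto intro!: Nat.gr0I)
  define t where "t = (M - 1) div d"
  have t: "t * d \<le> M - 1" "M - 1 < Suc t * d"
    using pos div_times_less_eq_dividend[of "M - 1" d] dividend_less_div_times[of d "M - 1"]
    by (auto simp: t_def)
  have "P * t * d \<le> P * (M - 1)" using t(1) by (simp add: mult.assoc)
  also have "P * (M - 1) \<le> P * M - 1" using pos by (simp add: right_diff_distrib')
  also have "\<dots> = \<nu> * n * d" using eq d by (simp add: mult_ac)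
  finally have 1: "P * t \<le> \<nu> * n" using pos by simp
  have "M \<le> Suc t * d" using t(2) pos(4) by (metis Suc_diff_1 Suc_leI)
  then have "P * M \<le> P * Suc t * d" unfolding mult.assoc by (rule mult_le_mono2)
  moreover have "\<nu> * n * d < P * M" using eq d by (simp add: mult_ac)
  ultimately have "\<nu> * n * d < P * Suc t * d" by (rule less_le_trans[rotated])
  then have 2: "\<nu> * n < P * Suc t" by (simp only: mult_less_cancel2)
  have "\<nu> * n div P = t" using 1 2 by (intro div_nat_eqI) (simp_all add: mult.commute)
  then show ?thesis using pos by (simp add: t_def d)
qed

text \<open>Ties the valuation of \<open>u_n\<close>, given by Landau values at
  \<open>n / p ^ j\<close>, to the arguments \<open>(i - 1) / N\<close> of the condition.\<close>

lemma landau_divide_glcm: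
  assumes "finite (gsupp \<gamma>)" and eq: "glcm \<gamma> * n + 1 = P * M"
  shows "landau \<gamma> (real n / real P) = landau \<gamma> (real (M - 1) / real (glcm \<gamma>))"
  unfolding landau_divide_nat
  using mult_div_eq_of_dvd[OF gsupp_dvd_glcm glcm_pos[OF assms(1)] eq] by simp

text \<open>The \<open>p\<close>-adic unit left when the multiples of \<open>p\<close> are stripped
  from the factorials in \<open>J\<close> rounds; \<open>J = r\<close> gives the factor \<lambda>(n)
  of the proof idea.\<close>

definition unit_part :: "(nat \<Rightarrow> int) \<Rightarrow> nat \<Rightarrow> nat \<Rightarrow> nat \<Rightarrow> rat" where
  "unit_part \<gamma> p J n = (\<Prod>\<nu>\<in>gsupp \<gamma>. (\<Prod>j<J. of_nat (coprime_fact p (\<nu> * n div p ^ j))) powi \<gamma> \<nu>)"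

lemma ucoeff_eq_unit_part:
  assumes p: "prime p"
  shows "ucoeff \<gamma> n = unit_part \<gamma> p J n * of_nat p powi (\<Sum>j=1..J. landau \<gamma> (real n / real (p ^ j))) *
    (\<Prod>\<nu>\<in>gsupp \<gamma>. fact (\<nu> * n div p ^ J) powi \<gamma> \<nu>)"
proof -
  have p0: "p > 0" using p prime_gt_0_nat by blast
  have "fact (\<nu> * n) powi \<gamma> \<nu> = ((\<Prod>j<J. of_nat (coprime_fact p (\<nu> * n div p ^ j))) powi \<gamma> \<nu>) *
      (of_nat p powi (\<Sum>j=1..J. \<gamma> \<nu> * int (\<nu> * n div p ^ j))) *
      (fact (\<nu> * n div p ^ J) powi \<gamma> \<nu> :: rat)" for \<nu>
  proof -
    have "(fact (\<nu> * n) :: rat) = of_nat (fact (\<nu> * n))" by simp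
    also have "\<dots> = (\<Prod>j<J. of_nat (coprime_fact p (\<nu> * n div p ^ j))) *
        of_nat p powi (\<Sum>j=1..J. int (\<nu> * n div p ^ j)) * fact (\<nu> * n div p ^ J)"
      unfolding fact_eq_coprime_fact_iterated[OF p0, of "\<nu> * n" J] by (simp flip: of_nat_sum)
    finally show ?thesis
      by (simp add: power_int_mult_distrib sum_distrib_left mult.commute flip: power_int_mult)
  qed
  then have "ucoeff \<gamma> n = unit_part \<gamma> p J n *
      (\<Prod>\<nu>\<in>gsupp \<gamma>. of_nat p powi (\<Sum>j=1..J. \<gamma> \<nu> * int (\<nu> * n div p ^ j))) *
      (\<Prod>\<nu>\<in>gsupp \<gamma>. fact (\<nu> * n div p ^ J) powi \<gamma> \<nu>)"
    by (simp add: ucoeff_def unit_part_def prod.distrib)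
  also have "(\<Prod>\<nu>\<in>gsupp \<gamma>. of_nat p powi (\<Sum>j=1..J. \<gamma> \<nu> * int (\<nu> * n div p ^ j))) =
      (of_nat p powi (\<Sum>\<nu>\<in>gsupp \<gamma>. \<Sum>j=1..J. \<gamma> \<nu> * int (\<nu> * n div p ^ j)) :: rat)"
    using p0 by (simp add: power_int_sum)
  also have "(\<Sum>\<nu>\<in>gsupp \<gamma>. \<Sum>j=1..J. \<gamma> \<nu> * int (\<nu> * n div p ^ j)) =
      (\<Sum>j=1..J. landau \<gamma> (real n / real (p ^ j)))"
    unfolding landau_divide_nat by (rule sum.swap)
  finally show ?thesis .
qed

lemma unit_part_in_Z_units:
  assumes p: "prime p"
  shows "unit_part \<gamma> p J n \<in> Z_units p"
  unfolding unit_part_def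
  by (intro Z_units_prod[OF p] Z_units_power_int[OF p] Z_units_of_nat[OF p] not_dvd_coprime_fact[OF p])

text \<open>Each shift of an argument of \<open>coprime_fact\<close> by a multiple of \<open>p^s\<close> contributes a power of the same
  factor \<open>coprime_fact p (p^s)\<close>; these cancel since \<open>\<Sum>\<nu> \<gamma> \<nu> = 0\<close>.\<close>

lemma unit_part_cong:
  assumes p: "prime p" and bal: "(\<Sum>\<nu>\<in>gsupp \<gamma>. int \<nu> * \<gamma> \<nu>) = 0" and J: "J > 0" "J \<le> K"
  shows "scong (Z_localized p) (p ^ (K - J + 1)) (unit_part \<gamma> p J (n + c * p ^ K)) (unit_part \<gamma> p J n)"
proof -
  \<comment> \<open>\<open>\<epsilon> j\<close> is the block factor of round \<open>j\<close>, where
    congruences hold modulo \<open>p ^ (K - j)\<close>. The weakest modulus, at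
    \<open>j = J - 1\<close>, is the one in the statement.\<close>
  define \<epsilon> :: "nat \<Rightarrow> rat" where "\<epsilon> j = of_nat (coprime_fact p (p ^ (K - j)))" for j
  define E where "E = (\<Prod>j<J. \<epsilon> j)"
  have \<epsilon>: "\<epsilon> j \<in> Z_units p" for j
    unfolding \<epsilon>_def by (intro Z_units_of_nat not_dvd_coprime_fact p)
  have "E \<in> Z_units p" unfolding E_def by (intro Z_units_prod[OF p] \<epsilon>)
  then have E0: "E \<noteq> 0" by (rule Z_unitsD(2)[OF p])
  have G: "of_nat (coprime_fact p k) \<in> Z_units p" for k by (intro Z_units_of_nat not_dvd_coprime_fact p)
  have sc: "scong (Z_localized p) (p ^ (K - J + 1)) (of_nat (coprime_fact p (\<nu> * (n + c * p ^ K) div p ^ j)))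
      (\<epsilon> j ^ (\<nu> * c) * of_nat (coprime_fact p (\<nu> * n div p ^ j)))" if j: "j < J" for \<nu> j
  proof -
    have "\<nu> * (n + c * p ^ K) = \<nu> * n + (\<nu> * c * p ^ (K - j)) * p ^ j"
      using j J by (simp add: algebra_simps flip: power_add)
    then have "\<nu> * (n + c * p ^ K) div p ^ j = \<nu> * n div p ^ j + \<nu> * c * p ^ (K - j)"
      using prime_gt_0_nat[OF p] by simp
    moreover have "p dvd p ^ (K - j)" using j J by (intro dvd_power) auto
    ultimately have "[coprime_fact p (\<nu> * (n + c * p ^ K) div p ^ j) =
        coprime_fact p (p ^ (K - j)) ^ (\<nu> * c) * coprime_fact p (\<nu> * n div p ^ j)] (mod p ^ (K - j))"
      using coprime_fact_add_cong[of p "p ^ (K - j)" "\<nu> * n div p ^ j" "\<nu> * c"] by simp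
    moreover have "p ^ (K - j) = p ^ (K - J + 1) * p ^ (J - 1 - j)"
      unfolding power_add[symmetric] using j J by (intro arg_cong[of _ _ "\<lambda>i. p ^ i"]) auto
    ultimately have "[coprime_fact p (\<nu> * (n + c * p ^ K) div p ^ j) =
        coprime_fact p (p ^ (K - j)) ^ (\<nu> * c) * coprime_fact p (\<nu> * n div p ^ j)] (mod p ^ (K - J + 1) * p ^ (J - 1 - j))"
      by simp
    from scong_of_cong[OF p this] show ?thesis by (simp add: \<epsilon>_def)
  qed
  have "scong (Z_localized p) (p ^ (K - J + 1)) (unit_part \<gamma> p J (n + c * p ^ K))
      (\<Prod>\<nu>\<in>gsupp \<gamma>. (\<Prod>j<J. \<epsilon> j ^ (\<nu> * c) * of_nat (coprime_fact p (\<nu> * n div p ^ j))) powi \<gamma> \<nu>)"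
    unfolding unit_part_def
    using sc by (intro scong_units_prod[OF p] conjI scong_units_power_int[OF p] Z_units_power_int[OF p]
      Z_units_prod[OF p] Z_units_mult[OF p] Z_units_power[OF p] \<epsilon> G) auto
  also have "(\<Prod>\<nu>\<in>gsupp \<gamma>. (\<Prod>j<J. \<epsilon> j ^ (\<nu> * c) * of_nat (coprime_fact p (\<nu> * n div p ^ j))) powi \<gamma> \<nu>) =
      (\<Prod>\<nu>\<in>gsupp \<gamma>. E powi (int c * (int \<nu> * \<gamma> \<nu>)) * (\<Prod>j<J. of_nat (coprime_fact p (\<nu> * n div p ^ j))) powi \<gamma> \<nu>)"
  proof (intro prod.cong refl)
    fix \<nu>
    have "E powi (int c * (int \<nu> * \<gamma> \<nu>)) = (E ^ (\<nu> * c)) powi \<gamma> \<nu>"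
      by (simp add: mult_ac flip: power_int_mult power_int_of_nat)
    then show "(\<Prod>j<J. \<epsilon> j ^ (\<nu> * c) * of_nat (coprime_fact p (\<nu> * n div p ^ j))) powi \<gamma> \<nu> =
        E powi (int c * (int \<nu> * \<gamma> \<nu>)) * (\<Prod>j<J. of_nat (coprime_fact p (\<nu> * n div p ^ j))) powi \<gamma> \<nu>"
      by (simp add: prod.distrib E_def power_int_mult_distrib prod_power_distrib)
  qed
  also have "\<dots> = E powi (int c * (\<Sum>\<nu>\<in>gsupp \<gamma>. int \<nu> * \<gamma> \<nu>)) * unit_part \<gamma> p J n"
    unfolding sum_distrib_left power_int_sum[OF E0] prod.distrib unit_part_def ..
  also have "\<dots> = unit_part \<gamma> p J n" by (simp add: bal)
  finally show ?thesis .
qed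

section \<open>The two directions of the criterion\<close>

locale balanced_system =
  fixes \<gamma> :: "nat \<Rightarrow> int"
  assumes fin: "finite (gsupp \<gamma>)"
    and bal: "(\<Sum>\<nu>\<in>gsupp \<gamma>. int \<nu> * \<gamma> \<nu>) = 0"
    and landau_nonneg: "\<And>t::real. landau \<gamma> t \<ge> 0"
begin

abbreviation (input) "N \<equiv> glcm \<gamma>"

lemma N_pos: "N > 0"
  by (rule glcm_pos[OF fin])

lemma gsupp_le: "\<nu> \<in> gsupp \<gamma> \<Longrightarrow> \<nu> \<le> N"
  using gsupp_dvd_glcm N_pos by (auto intro: dvd_imp_le)

lemma landau_glcm_mod:
  "landau \<gamma> (real (a + k * N) / real N) = landau \<gamma> (real a / real N)"
proof -
  have "real (a + k * N) / real N = real a / real N + real k"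
    using N_pos by (simp add: field_simps)
  then show ?thesis using landau_add_nat[OF bal] by simp
qed

lemma prod_fact_div_eq_1:
  assumes "N * n < P"
  shows "(\<Prod>\<nu>\<in>gsupp \<gamma>. fact (\<nu> * n div P) powi \<gamma> \<nu>) = (1::rat)"
proof (intro prod.neutral ballI)
  fix \<nu> assume "\<nu> \<in> gsupp \<gamma>"
  then have "\<nu> * n < P" using assms gsupp_le by (meson le_less_trans mult_le_mono1)
  then show "fact (\<nu> * n div P) powi \<gamma> \<nu> = (1::rat)" by simp
qed

lemma sum_landau_ge:
  "(\<Sum>j\<in>I. landau \<gamma> (f j)) \<ge> int (card {j \<in> I. landau \<gamma> (f j) \<ge> 1})" if "finite I"
proof -
  have "int (card {j \<in> I. landau \<gamma> (f j) \<ge> 1}) = (\<Sum>j\<in>{j \<in> I. landau \<gamma> (f j) \<ge> 1}. 1)" by simp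
  also have "\<dots> \<le> (\<Sum>j\<in>{j \<in> I. landau \<gamma> (f j) \<ge> 1}. landau \<gamma> (f j))" by (intro sum_mono) auto
  also have "\<dots> \<le> (\<Sum>j\<in>I. landau \<gamma> (f j))" using that landau_nonneg by (intro sum_mono2) auto
  finally show ?thesis .
qed

lemma sum_landau_ge_bound:
  assumes "\<And>j. 1 \<le> j \<Longrightarrow> j \<le> k \<Longrightarrow> landau \<gamma> (f j) \<ge> 1" "k \<le> J"
  shows "(\<Sum>j=1..J. landau \<gamma> (f j)) \<ge> int k"
proof -
  have "{1..k} \<subseteq> {j \<in> {1..J}. landau \<gamma> (f j) \<ge> 1}" using assms by auto
  then have "card {1..k} \<le> card {j \<in> {1..J}. landau \<gamma> (f j) \<ge> 1}" by (intro card_mono) auto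
  then show ?thesis using sum_landau_ge[of "{1..J}" f] by simp
qed

lemma ucoeff_eq:
  assumes p: "prime p" and J: "N * n < p ^ J"
  shows "ucoeff \<gamma> n = unit_part \<gamma> p J n * of_nat p powi (\<Sum>j=1..J. landau \<gamma> (real n / real (p ^ j)))"
  using ucoeff_eq_unit_part[OF p, of \<gamma> n J] prod_fact_div_eq_1[OF J] by simp

lemma ucoeff_eq_p_power_mult:
  assumes p: "prime p" and k: "\<And>j. 1 \<le> j \<Longrightarrow> j \<le> k \<Longrightarrow> landau \<gamma> (real n / real (p ^ j)) \<ge> 1"
  shows "\<exists>z\<in>Z_localized p. ucoeff \<gamma> n = of_nat (p ^ k) * z"
proof -
  \<comment> \<open>Large enough that \<open>N * n < p ^ J\<close>, and at least \<open>k\<close> so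
    that all \<open>k\<close> given terms occur.\<close>
  define J where "J = N * n + k"
  have "J < p ^ J" using p by (intro power_gt_expt) (auto simp: prime_gt_Suc_0_nat)
  then have J: "N * n < p ^ J" by (simp add: J_def)
  define E where "E = (\<Sum>j=1..J. landau \<gamma> (real n / real (p ^ j)))"
  have E: "E \<ge> int k" unfolding E_def using k by (intro sum_landau_ge_bound) (auto simp: J_def)
  have p0: "(of_nat p :: rat) \<noteq> 0" using p by (auto simp: prime_gt_0_nat)
  have "ucoeff \<gamma> n = unit_part \<gamma> p J n * of_nat p powi (int k + (E - int k))"
    using ucoeff_eq[OF p J] by (simp add: E_def)
  also have "\<dots> = of_nat (p ^ k) * (unit_part \<gamma> p J n * of_nat p powi (E - int k))"
    unfolding power_int_add[OF disjI1[OF p0]] by simp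
  finally have "ucoeff \<gamma> n = \<dots>" .
  moreover have "unit_part \<gamma> p J n * of_nat p powi (E - int k) \<in> Z_localized p"
    using E by (intro Z_localized_mult[OF p] Z_unitsD(1)[OF p unit_part_in_Z_units[OF p]] power_int_p_in[OF p]) auto
  ultimately show ?thesis by blast
qed

lemma ucoeff_in: "prime p \<Longrightarrow> ucoeff \<gamma> n \<in> Z_localized p"
  using ucoeff_eq_p_power_mult[of p 0 n] by auto

lemma flog_mult_in:
  assumes p: "prime p"
  shows "of_nat m * flog \<gamma> $ m \<in> Z_localized p"
  using ucoeff_in[OF p] Z_localized_of_nat[OF p, of 0] by (simp add: flog_def)

definition landau_condition :: bool where
  "landau_condition \<longleftrightarrow> (\<forall>i::nat. 2 \<le> i \<and> i \<le> N - 1 \<and> gcd i N = 1 \<longrightarrow>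
     landau \<gamma> ((real i - 1) / real N) \<ge> 1)"

text \<open>By periodicity \<open>M\<close> may be replaced by its residue \<open>i\<close>;
  coprimality and \<open>M\<close> not being congruent to 1 place \<open>i\<close> between 2 and
  \<open>N - 1\<close>.\<close>

lemma landau_ge_1:
  assumes cond: landau_condition and M: "coprime M N" "\<not> [M = 1] (mod N)"
  shows "landau \<gamma> (real (M - 1) / real N) \<ge> 1"
proof -
  define i where "i = M mod N"
  have "N \<noteq> 1"
  proof
    assume "N = 1"
    then show False using M(2) by (simp add: cong_def)
  qed
  then have N2: "N \<ge> 2" using N_pos by linarith
  have cop: "coprime i N" using M(1) N_pos by (simp add: i_def)
  have "i \<noteq> 0" using cop N2 by (intro notI) simp
  moreover have "i \<noteq> 1" using M(2) N2 by (auto simp: i_def cong_def)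
  moreover have "i < N" using N_pos by (simp add: i_def)
  ultimately have i: "2 \<le> i" "i \<le> N - 1" by auto
  have "M = i + (M div N) * N" by (simp add: i_def)
  then have "M - 1 = (i - 1) + (M div N) * N" using i by linarith
  then have "landau \<gamma> (real (M - 1) / real N) = landau \<gamma> (real (i - 1) / real N)"
    by (simp only: landau_glcm_mod)
  also have "real (i - 1) = real i - 1" using i by (simp add: of_nat_diff)
  finally have eq: "landau \<gamma> (real (M - 1) / real N) = landau \<gamma> ((real i - 1) / real N)" .
  have "gcd i N = 1" using cop by simp
  with i have "2 \<le> i \<and> i \<le> N - 1 \<and> gcd i N = 1" by (intro conjI)
  with cond[unfolded landau_condition_def] have "landau \<gamma> ((real i - 1) / real N) \<ge> 1"
    by (elim allE[of _ i] mp)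
  then show ?thesis by (simp only: eq)
qed

lemma cong_mult_add_1: "[m * x + 1 = 1] (mod m)" for m x :: nat
  by (simp only: cong_def add.commute[of _ 1] mod_mult_self2)

text \<open>\<open>M\<close> is inverse to \<open>p ^ j\<close> modulo \<open>N\<close>, so it is
  congruent to 1 only if \<open>p ^ j\<close> is.\<close>

lemma landau_prime_power_ge_1:
  assumes cond: landau_condition and p: "coprime p N" and eq: "N * n + 1 = p ^ j * M"
    and j: "\<not> [p ^ j = 1] (mod N)"
  shows "landau \<gamma> (real n / real (p ^ j)) \<ge> 1"
proof -
  have PM: "[p ^ j * M = 1] (mod N)" unfolding eq[symmetric] by (rule cong_mult_add_1)
  then have "coprime M N" by (metis cong_imp_coprime cong_sym coprime_1_left coprime_mult_left_iff)
  moreover have "\<not> [M = 1] (mod N)"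
  proof
    assume "[M = 1] (mod N)"
    then have "[p ^ j * M = p ^ j * 1] (mod N)" by (rule cong_scalar_left)
    then show False using PM j by (metis cong_sym cong_trans mult.right_neutral)
  qed
  ultimately show ?thesis
    unfolding landau_divide_glcm[OF fin eq] by (rule landau_ge_1[OF cond])
qed

theorem integral_of_landau_condition:
  assumes cond: landau_condition and p: "prime p" "p > N"
  shows "p_integral p (fgl \<gamma>)"
  unfolding p_integral_iff_homog[OF p(1)]
proof
  fix D
  note S = subring_set_Z_localized[OF p(1)]
  have p0: "(of_nat p :: rat) \<noteq> 0" using p by auto
  have cop: "coprime p N" using p N_pos by (intro prime_imp_coprime) (auto dest: dvd_imp_le)
  define r where "r = ord N p"
  have r: "r > 0" using cop by (simp add: r_def ord_eq_0 coprime_commute)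
  have ord: "[p ^ j = 1] (mod N) \<longleftrightarrow> r dvd j" for j unfolding r_def by (rule ord_divides)
  define q where "q = p ^ r"
  have q1: "[q = 1] (mod N)" unfolding q_def ord by simp
  have q0: "q > 0" using p by (simp add: q_def)
  \<comment> \<open>A multiple of \<open>r\<close>, so that \<open>p ^ K\<close> is 1 modulo
    \<open>N\<close>, and large enough for \<open>p ^ K > D\<close>.\<close>
  define K where "K = r * (D + 1)"
  have KD: "D < p ^ K"
  proof -
    have "1 * (D + 1) \<le> K" unfolding K_def using r by (intro mult_le_mono1) simp
    then have "D < K" by simp
    also have "K < p ^ K" using p by (intro power_gt_expt) (auto simp: prime_gt_Suc_0_nat)
    finally show ?thesis .
  qed
  have "[p ^ K = 1] (mod N)" unfolding ord by (simp add: K_def)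
  moreover have pK: "1 \<le> p ^ K" using p by (simp add: Suc_le_eq)
  ultimately have "N dvd p ^ K - 1" by (simp add: cong_altdef_nat)
  \<comment> \<open>\<open>n2\<close> approximates the \<open>p\<close>-adic number
    \<open>-1/N\<close>, near which all \<open>x\<close> with \<open>N * x + 1\<close> divisible by
    a high power of \<open>p\<close> lie. It serves to define one constant \<open>c\<close> for all
    degrees up to \<open>D\<close>.\<close>
  then obtain n2 where "p ^ K - 1 = N * n2" by blast
  then have n2: "p ^ K = N * n2 + 1" using pK by linarith
  define e where "e = (\<Sum>j=1..r. landau \<gamma> (real n2 / real (p ^ j)))"
  have rK: "r \<le> K" by (simp add: K_def)
  \<comment> \<open>For \<open>0 < j < r\<close> the power \<open>p ^ j\<close> is not 1 modulo
    \<open>N\<close>, so the condition applies; only \<open>j = r\<close> may contribute 0.\<close>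
  have e: "e \<ge> int (r - 1)"
    unfolding e_def
  proof (rule sum_landau_ge_bound)
    fix j assume j: "1 \<le> j" "j \<le> r - 1"
    have "N * n2 + 1 = p ^ j * p ^ (K - j)" using n2 j rK by (simp flip: power_add)
    moreover have "\<not> r dvd j" using j by (auto dest: dvd_imp_le)
    ultimately show "landau \<gamma> (real n2 / real (p ^ j)) \<ge> 1"
      using landau_prime_power_ge_1[OF cond cop] ord by metis
  qed simp
  \<comment> \<open>\<open>c * q\<close> is the power of \<open>p\<close> times the unit by which
    \<open>u\<close> changes when index \<open>q * y\<close> passes to \<open>y\<close>, with the
    unit frozen at \<open>n2\<close>. As \<open>e \<ge> r - 1\<close>, at most one \<open>p\<close>
    remains in the denominator of \<open>c\<close>.\<close>
  define c where "c = of_nat p powi (e - int r) * unit_part \<gamma> p r n2"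
  have c: "c * of_nat p \<in> Z_localized p"
  proof -
    have "c * of_nat p = of_nat p powi (e - int r + 1) * unit_part \<gamma> p r n2"
      using p0 by (simp add: c_def power_int_add)
    then show ?thesis
      using e r by (simp only:) (intro Z_localized_mult[OF p(1)] power_int_p_in[OF p(1)]
        Z_unitsD(1)[OF p(1) unit_part_in_Z_units[OF p(1)]], simp)
  qed
  have cq: "c * of_nat q = of_nat p powi e * unit_part \<gamma> p r n2"
  proof -
    have "of_nat p powi (e - int r) * (of_nat q :: rat) = of_nat p powi (e - int r + int r)"
      unfolding power_int_add[OF disjI1[OF p0]] by (simp add: q_def)
    then show ?thesis by (simp add: c_def mult_ac)
  qed
  have g: "flog \<gamma> $ n - c * (if p ^ r dvd n then flog \<gamma> $ (n div p ^ r) else 0) \<in> Z_localized p"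
    if nD: "n \<le> D" for n
  proof (cases "n \<ge> 1 \<and> N dvd n - 1")
    case False
    \<comment> \<open>Since \<open>q\<close> is 1 modulo \<open>N\<close>, a multiple of
      \<open>q\<close> not congruent to 1 keeps that property when divided by \<open>q\<close>, and
      both terms vanish.\<close>
    have "flog \<gamma> $ (n div q) = 0" if "q dvd n"
    proof (rule ccontr)
      assume "flog \<gamma> $ (n div q) \<noteq> 0"
      then have y: "n div q \<ge> 1" "N dvd n div q - 1" by (auto simp: flog_def split: if_splits)
      then have "[n div q = 1] (mod N)" by (simp add: cong_to_1'_nat cong_altdef_nat)
      then have "[q * (n div q) = 1 * 1] (mod N)" using q1 by (intro cong_mult)
      moreover have "q * (n div q) = n" using that by simp
      ultimately have "[n = 1] (mod N)" by simp
      moreover have "n \<ge> 1" using y(1) by (cases n) auto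
      ultimately show False using False by (simp add: cong_altdef_nat)
    qed
    moreover have "flog \<gamma> $ n = 0" using False by (auto simp: flog_def)
    ultimately show ?thesis using subring_0[OF S] by (simp add: q_def)
  next
    case True
    define x where "x = (n - 1) div N"
    have x: "N * x + 1 = n" using True by (simp add: x_def)
    have fn: "flog \<gamma> $ n = ucoeff \<gamma> x / of_nat n" using True by (simp add: flog_def x_def)
    have n0: "n > 0" using True by simp
    obtain k m where k: "n = p ^ k * m" "\<not> p dvd m"
      using multiplicity_decompose'[of n p] n0 p(1) by (metis neq0_conv not_prime_unit)
    have m0: "m > 0" using k by (auto intro: Nat.gr0I)
    show ?thesis
    proof (cases "q dvd n")
      case False
      have kr: "k < r"
      proof (rule ccontr)
        assume "\<not> k < r"
        then have "q dvd n" unfolding q_def k(1) by (intro dvd_mult2 le_imp_power_dvd) simp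
        then show False using False by simp
      qed
      \<comment> \<open>Here \<open>k < r\<close>, so the first \<open>k\<close> Landau values are
        at least 1 and \<open>p ^ k\<close> divides \<open>u_x\<close>, cancelling the
        denominator.\<close>
      obtain z where z: "z \<in> Z_localized p" "ucoeff \<gamma> x = of_nat (p ^ k) * z"
      proof -
        have "landau \<gamma> (real x / real (p ^ j)) \<ge> 1" if j: "1 \<le> j" "j \<le> k" for j
        proof -
          have "N * x + 1 = p ^ j * (p ^ (k - j) * m)"
            using j unfolding x k(1) by (simp flip: power_add mult.assoc)
          moreover have "\<not> r dvd j" using j kr by (auto dest: dvd_imp_le)
          ultimately show ?thesis using landau_prime_power_ge_1[OF cond cop] ord by metis
        qed
        then show ?thesis using that ucoeff_eq_p_power_mult[OF p(1)] by blast
      qed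
      have "flog \<gamma> $ n = z / of_nat m" unfolding fn z(2) using p0 by (simp add: k(1))
      then show ?thesis
        using False Z_localized_divide_of_nat[OF p(1) k(2) z(1)] by (simp add: q_def)
    next
      case True
      then obtain y where y: "n = q * y" by blast
      have rk: "r \<le> k"
      proof (rule ccontr)
        assume "\<not> r \<le> k"
        then have "p ^ Suc k dvd q" unfolding q_def by (intro le_imp_power_dvd) simp
        then have "p ^ k * p dvd p ^ k * m" using True k(1) by (metis dvd_trans power_Suc2)
        then show False using k(2) p0 by simp
      qed
      have kK: "k \<le> K"
      proof -
        have "p ^ k \<le> n" using k(1) m0 by simp
        then have "p ^ k < p ^ K" using nD KD by linarith
        then show ?thesis using p(1) by (simp add: prime_gt_Suc_0_nat power_strict_increasing_iff)
      qed
      have "[q * y = 1] (mod N)" unfolding y[symmetric] x[symmetric] by (rule cong_mult_add_1)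
      moreover have "[q * y = 1 * y] (mod N)" using q1 by (rule cong_scalar_right)
      ultimately have y1: "[y = 1] (mod N)" by (metis cong_sym cong_trans mult_1)
      have y0: "y \<ge> 1" using y n0 by (cases y) auto
      then have Ny: "N dvd y - 1" using y1 by (simp add: cong_altdef_nat)
      define x' where "x' = (y - 1) div N"
      have x': "N * x' = y - 1" using Ny by (simp add: x'_def)
      have fy: "flog \<gamma> $ y = ucoeff \<gamma> x' / of_nat y" using y0 Ny by (simp add: flog_def x'_def)
      \<comment> \<open>Both \<open>N * x + 1 = n\<close> and \<open>N * n2 + 1 = p ^ K\<close> are
        divisible by \<open>p ^ k\<close>, and \<open>N\<close> is prime to
        \<open>p\<close>.\<close>
      have "\<exists>d. n2 = x + d * p ^ k"
      proof -
        have le: "x \<le> n2"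
        proof -
          have "N * x + 1 \<le> N * n2 + 1" using x nD KD n2 by linarith
          then show ?thesis using N_pos by simp
        qed
        have "p ^ k dvd (N * n2 + 1) - (N * x + 1)"
          unfolding n2[symmetric] x using kK k(1) by (intro dvd_diff_nat le_imp_power_dvd) auto
        then have "p ^ k dvd N * (n2 - x)" by (simp add: right_diff_distrib')
        then have "p ^ k dvd n2 - x"
          using cop by (metis coprime_dvd_mult_right_iff coprime_power_left_iff)
        then obtain d where "n2 - x = p ^ k * d" by blast
        then have "n2 = x + d * p ^ k" using le by (simp add: mult.commute)
        then show ?thesis ..
      qed
      then obtain d where d: "n2 = x + d * p ^ k" by blast
      have e_eq: "(\<Sum>j=1..r. landau \<gamma> (real x / real (p ^ j))) = e"
        unfolding e_def
      proof (intro sum.cong refl)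
        fix j assume "j \<in> {1..r}"
        then have "p ^ k = p ^ (k - j) * p ^ j" using rk by (simp flip: power_add)
        then have "real n2 / real (p ^ j) = real x / real (p ^ j) + real (d * p ^ (k - j))"
          using p(1) prime_gt_0_nat[OF p(1)] unfolding d by (simp add: field_simps)
        then show "landau \<gamma> (real x / real (p ^ j)) = landau \<gamma> (real n2 / real (p ^ j))"
          by (simp only: landau_add_nat[OF bal])
      qed
      have "ucoeff \<gamma> x = unit_part \<gamma> p r x * of_nat p powi e * ucoeff \<gamma> x'"
      proof -
        have "\<nu> * x div p ^ r = \<nu> * x'" if "\<nu> \<in> gsupp \<gamma>" for \<nu>
        proof -
          have "\<nu> * x div p ^ r = \<nu> * (y - 1) div N"
            using mult_div_eq_of_dvd[OF gsupp_dvd_glcm[OF that] N_pos] x y unfolding q_def by metis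
          also have "\<dots> = \<nu> * x'" unfolding x'[symmetric] using N_pos by simp
          finally show ?thesis .
        qed
        then show ?thesis
          using ucoeff_eq_unit_part[OF p(1), of \<gamma> x r] unfolding e_eq by (simp add: ucoeff_def)
      qed
      \<comment> \<open>The units at \<open>x\<close> and \<open>n2\<close> agree modulo
        \<open>p ^ (k - r + 1)\<close>; together with \<open>p ^ e\<close> and
        \<open>e \<ge> r - 1\<close> this supplies the full \<open>p ^ k\<close> needed for the
        denominator \<open>n\<close>.\<close>
      moreover obtain z where z: "z \<in> Z_localized p" "unit_part \<gamma> p r x = unit_part \<gamma> p r n2 + of_nat (p ^ (k - r + 1)) * z"
        using scong_sym[OF S unit_part_cong[OF p(1) bal r rk, of x d]] unfolding d scong_def by blast
      ultimately have "ucoeff \<gamma> x - c * of_nat q * ucoeff \<gamma> x' =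
          of_nat (p ^ (k - r + 1)) * of_nat p powi e * (z * ucoeff \<gamma> x')"
        unfolding cq by (simp add: algebra_simps)
      also have "of_nat (p ^ (k - r + 1)) * of_nat p powi e =
          of_nat (p ^ k) * (of_nat p powi (e + 1 - int r) :: rat)"
      proof -
        have "of_nat (p ^ (k - r + 1)) * of_nat p powi e = (of_nat p powi (int (k - r + 1) + e) :: rat)"
          unfolding power_int_add[OF disjI1[OF p0]] by (simp only: power_int_of_nat of_nat_power)
        also have "int (k - r + 1) + e = int k + (e + 1 - int r)" using rk by simp
        also have "(of_nat p powi \<dots> :: rat) = of_nat (p ^ k) * of_nat p powi (e + 1 - int r)"
          unfolding power_int_add[OF disjI1[OF p0]] by simp
        finally show ?thesis .
      qed
      finally have main: "ucoeff \<gamma> x - c * of_nat q * ucoeff \<gamma> x' =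
          of_nat (p ^ k) * (of_nat p powi (e + 1 - int r) * (z * ucoeff \<gamma> x'))" by (simp only: mult.assoc)
      have "flog \<gamma> $ n - c * flog \<gamma> $ y = (ucoeff \<gamma> x - c * of_nat q * ucoeff \<gamma> x') / of_nat n"
        unfolding fn fy using q0 y0 by (simp add: y field_simps)
      also have "\<dots> = (of_nat p powi (e + 1 - int r) * (z * ucoeff \<gamma> x')) / of_nat m"
        unfolding main using p0 by (simp add: k(1))
      also have "\<dots> \<in> Z_localized p"
        using e r by (intro Z_localized_divide_of_nat[OF p(1) k(2)] Z_localized_mult[OF p(1)]
          power_int_p_in[OF p(1)] z(1) ucoeff_in[OF p(1)]) auto
      finally show ?thesis using True y q0 by (simp add: q_def)
    qed
  qed
  show "homog (fgl \<gamma>) $ D \<in> fps_set (Z_localized p)"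
    by (rule functional_equation_integral[OF p(1) r flog_0 flog_1 flog_mult_in[OF p(1)] c g
          homog_fgl_0 fps_lift_compose_homog_fgl order_refl])
qed

theorem landau_condition_of_integral:
  assumes fin_bad: "finite {p. prime p \<and> \<not> p_integral p (fgl \<gamma>)}"
  shows landau_condition
  unfolding landau_condition_def
proof (intro allI impI, elim conjE)
  fix i :: nat assume i: "2 \<le> i" "i \<le> N - 1" "gcd i N = 1"
  have cop: "coprime i N" using i(3) by (simp only: coprime_iff_gcd_eq_1)
  \<comment> \<open>The primes sought are those congruent to the inverse \<open>i'\<close> of
    \<open>i\<close>. Dirichlet's theorem provides infinitely many, so one avoids both the bad
    primes and those up to \<open>N\<close>.\<close>
  define i' where "i' = i ^ (totient N - 1)"
  have ii': "[i * i' = 1] (mod N)" unfolding i'_def by (rule power_totient_inverse[OF N_pos cop])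
  have "coprime i' N" using cop by (simp add: i'_def)
  then have "infinite {p. prime p \<and> [p = i'] (mod N)}" by (rule dirichlet_primes[OF N_pos])
  then have "infinite ({p. prime p \<and> [p = i'] (mod N)} - {p. prime p \<and> \<not> p_integral p (fgl \<gamma>)} - {..N})"
    using fin_bad by (intro Diff_infinite_finite) auto
  then obtain p where "p \<in> {p. prime p \<and> [p = i'] (mod N)} - {p. prime p \<and> \<not> p_integral p (fgl \<gamma>)} - {..N}"
    using infinite_imp_nonempty by blast
  then have p: "prime p" "[p = i'] (mod N)" "p_integral p (fgl \<gamma>)" "p > N" by auto
  have p0: "p > 0" using p by simp
  have "[i * p = i * i'] (mod N)" using p(2) by (rule cong_scalar_left)
  then have ip1: "[i * p = 1] (mod N)" using ii' by (rule cong_trans)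
  have "1 \<le> i * p" using i p0 by simp
  then have "N dvd i * p - 1" using ip1 by (simp add: cong_altdef_nat)
  then obtain n where "i * p - 1 = N * n" by blast
  then have "N * n + 1 = i * p" using \<open>1 \<le> i * p\<close> by linarith
  then have n: "N * n + 1 = p * i" by (simp only: mult.commute)
  have iN: "i < N" using i N_pos by linarith
  \<comment> \<open>If \<open>p\<close> were 1 modulo \<open>N\<close>, so would be its inverse
    \<open>i\<close>, against \<open>2 \<le> i < N\<close>.\<close>
  have fp: "flog \<gamma> $ p = 0"
  proof (rule ccontr)
    assume "flog \<gamma> $ p \<noteq> 0"
    then have "N dvd p - 1" "p \<ge> 1" by (auto simp: flog_def split: if_splits)
    then have "[p = 1] (mod N)" by (simp add: cong_altdef_nat)
    then have "[i * p = i * 1] (mod N)" by (rule cong_scalar_left)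
    then have "[i = 1] (mod N)" using ip1 by (metis cong_sym cong_trans mult.right_neutral)
    then show False using i iN by (simp add: cong_def)
  qed
  have "flog \<gamma> $ (p * i) \<in> Z_localized p"
  proof (rule log_coeff_integral_below_prime_square[OF p(1) flog_0 flog_1 fp flog_mult_in[OF p(1)]
        homog_fgl_0 fps_lift_compose_homog_fgl])
    show "homog (fgl \<gamma>) $ n \<in> fps_set (Z_localized p)" for n
      using p(3) unfolding p_integral_iff_homog[OF p(1)] by blast
    show "\<not> p dvd (i * p choose p)" if "2 \<le> i" "i < p" for i
      using that by (intro not_prime_dvd_mult_choose[OF p(1)]) auto
    show "p * i < p * p" using iN p(4) p0 by simp
  qed
  moreover have "flog \<gamma> $ (p * i) = ucoeff \<gamma> n / of_nat (p * i)"
    using flog_nth[OF fin, of n] unfolding n .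
  ultimately have "ucoeff \<gamma> n / of_nat (p * i) * of_nat i \<in> Z_localized p"
    using Z_localized_mult[OF p(1)] Z_localized_of_nat[OF p(1)] by metis
  then have up: "ucoeff \<gamma> n / of_nat p \<in> Z_localized p" using i by (simp add: field_simps)
  \<comment> \<open>Otherwise \<open>u_n\<close> would be a \<open>p\<close>-adic unit: by
    \<open>N * n < p ^ 2\<close> two rounds exhaust the factorials, and the second contributes 0.
    But \<open>u_n / p\<close> is integral.\<close>
  have "landau \<gamma> (real n / real p) \<noteq> 0"
  proof
    assume L0: "landau \<gamma> (real n / real p) = 0"
    have "N * n < p * i" using n by simp
    also have "p * i < p * p" using iN p(4) p0 by simp
    finally have small: "N * n < p ^ 2" by (simp add: power2_eq_square)
    have "landau \<gamma> (real n / real (p ^ 2)) = 0"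
      unfolding landau_divide_nat
    proof (intro sum.neutral ballI)
      fix \<nu> assume "\<nu> \<in> gsupp \<gamma>"
      then have "\<nu> * n < p ^ 2" using small gsupp_le by (meson le_less_trans mult_le_mono1)
      then show "\<gamma> \<nu> * int (\<nu> * n div p ^ 2) = 0" by simp
    qed
    then have "(\<Sum>j=1..2. landau \<gamma> (real n / real (p ^ j))) = 0"
      using L0 by (simp add: numeral_2_eq_2)
    then have u: "ucoeff \<gamma> n = unit_part \<gamma> p 2 n" using ucoeff_eq[OF p(1) small] by simp
    have "inverse (unit_part \<gamma> p 2 n) \<in> Z_localized p" "unit_part \<gamma> p 2 n \<noteq> 0"
      using unit_part_in_Z_units[OF p(1)] by (auto simp: Z_units_def)
    then have "1 / of_nat p \<in> Z_localized p"
      using Z_localized_mult[OF p(1) up, of "inverse (unit_part \<gamma> p 2 n)"] by (simp add: u field_simps)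
    moreover have "of_nat 1 = of_nat p * (1 / of_nat p :: rat)" using p0 by simp
    ultimately have "p dvd 1" by (rule Z_localized_of_nat_dvd[OF p(1)])
    then show False using p(1) by simp
  qed
  then have "landau \<gamma> (real n / real p) \<ge> 1" using landau_nonneg[of "real n / real p"] by linarith
  then show "landau \<gamma> ((real i - 1) / real N) \<ge> 1"
    using landau_divide_glcm[OF fin n] i by (simp add: of_nat_diff)
qed

end

theorem proposition6:
  fixes \<gamma> :: "nat \<Rightarrow> int"
  assumes "finite (gsupp \<gamma>)"
    and "(\<Sum>\<nu>\<in>gsupp \<gamma>. int \<nu> * \<gamma> \<nu>) = 0"
    and "\<And>t::real. landau \<gamma> t \<ge> 0"
  shows "(finite {p. prime p \<and> \<not> p_integral p (fgl \<gamma>)} \<longleftrightarrow>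
            (\<forall>i::nat. 2 \<le> i \<and> i \<le> glcm \<gamma> - 1 \<and> gcd i (glcm \<gamma>) = 1 \<longrightarrow>
               landau \<gamma> ((real i - 1) / real (glcm \<gamma>)) \<ge> 1)) \<and>
         ((\<forall>i::nat. 2 \<le> i \<and> i \<le> glcm \<gamma> - 1 \<and> gcd i (glcm \<gamma>) = 1 \<longrightarrow>
               landau \<gamma> ((real i - 1) / real (glcm \<gamma>)) \<ge> 1) \<longrightarrow>
            (\<forall>p. prime p \<and> p > glcm \<gamma> \<longrightarrow> p_integral p (fgl \<gamma>)))"
proof -
  interpret balanced_system \<gamma> using assms by unfold_locales
  have "finite {p. prime p \<and> \<not> p_integral p (fgl \<gamma>)}" if landau_condition
  proof (rule finite_subset)
    show "{p. prime p \<and> \<not> p_integral p (fgl \<gamma>)} \<subseteq> {..glcm \<gamma>}"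
      using integral_of_landau_condition[OF that] by (auto simp: not_le [symmetric])
  qed simp
  then have "finite {p. prime p \<and> \<not> p_integral p (fgl \<gamma>)} \<longleftrightarrow> landau_condition"
    using landau_condition_of_integral by (rule iffI[rotated])
  moreover have "landau_condition \<longrightarrow> (\<forall>p. prime p \<and> p > glcm \<gamma> \<longrightarrow> p_integral p (fgl \<gamma>))"
    using integral_of_landau_condition by simp
  ultimately show ?thesis
    unfolding landau_condition_def by (rule conjI)
qed

end
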